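(* For any $a>0$ and any $e_1,e_2$ with $0<e_1<e_2<1$, the sequence of sets of alternatives $$\Upsilon_n(e_1,e_2,a)=\Bigl\{F\in\Im:\ n^{1/2}\max_{e_1\le x\le e_2}|F(x)-F_0(x)|>a,\ \ n^{1/2}(F-F_0)\in\Im_1\Bigr\},\qquad n=1,2,\ldots,$$ is uniformly consistent (for the Kolmogorov test).
   Context: $\Im$ is the set of all c.d.f.'s of random variables taking values in $[0,1]$, and $F_0(x)=x$ for $x\in[0,1]$. $\Im_1$ is an arbitrary (fixed) subset of differentiable functions $G$ on $[0,1]$ such that the set of derivatives $g(x)=\frac{dG(x)}{dx}$, $G\in\Im_1$, is compact in $\mathbb{L}_2([0,1])$. $X_1,\ldots,X_n$ is an i.i.d. sample with c.d.f. $F_n\in\Im$; the hypothesis is $\mathbb{H}_0: F_n=F_0$. $\hat F_n$ is the empirical c.d.f. of the sample, $T(F)=\max_{x\in[0,1]}|F(x)-F_0(x)|$, and $T(\hat F_n)$ is the Kolmogorov test statistic. A Kolmogorov test $K_n=K_n(X_1,\ldots,X_n)$ rejects the hypothesis when $T(\hat F_n)$ exceeds a critical value. $\alpha(K_n)$ denotes its type I error probability, $\beta(K_n,F)$ its type II error probability for the alternative $F\in\Im$, and $\beta(K_n,\Upsilon_n)=\sup_{F\in\Upsilon_n}\beta(K_n,F)$. A sequence of sets $\Upsilon_n\subset\Im$ is $\alpha$-uniformly consistent ($0<\alpha<1$) if for Kolmogorov tests $K_n$ with $\alpha(K_n)=\alpha+o(1)$ as $n\to\infty$ one has $\limsup_{n\to\infty}\beta(K_n,\Upsilon_n)<1-\alpha$.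 It is uniformly consistent if it is $\alpha$-uniformly consistent for all $\alpha$, $0<\alpha<1$. *)

theory Defs
  imports "HOL-Probability.Probability"
begin

subsection \<open>The metric space \<open>L2([0,1])\<close>\<close>

text \<open>
  Elements of \<open>L2([0,1])\<close> are equivalence classes of square-integrable functions under
  equality almost everywhere. Values outside \<open>[0,1]\<close> play no role: the underlying measure is
  Lebesgue measure restricted to \<open>[0,1]\<close>.
\<close>

abbreviation leb01 :: "real measure" where
  "leb01 \<equiv> lebesgue_on {0..1}"

definition square_integrable01 :: "(real \<Rightarrow> real) set" where
  "square_integrable01 =
     {f \<in> borel_measurable leb01. integrable leb01 (\<lambda>x. (f x)\<^sup>2)}"

definition ae_eq01 :: "((real \<Rightarrow> real) \<times> (real \<Rightarrow> real)) set" where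
  "ae_eq01 = {(f, g). f \<in> square_integrable01 \<and> g \<in> square_integrable01 \<and>
                      (AE x in leb01. f x = g x)}"

definition L2_space :: "(real \<Rightarrow> real) set set" where
  "L2_space = square_integrable01 // ae_eq01"

text \<open>The class of a function that is not square-integrable is empty, hence not in \<open>L2_space\<close>.\<close>

definition L2_class :: "(real \<Rightarrow> real) \<Rightarrow> (real \<Rightarrow> real) set" where
  "L2_class f = ae_eq01 `` {f}"

definition L2_dist :: "(real \<Rightarrow> real) set \<Rightarrow> (real \<Rightarrow> real) set \<Rightarrow> real" where
  "L2_dist A B =
     sqrt (LINT x|leb01. ((SOME f. f \<in> A) x - (SOME g. g \<in> B) x)\<^sup>2)"

lemma equiv_ae_eq01: "equiv square_integrable01 ae_eq01"
proof (rule equivI)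
  show "ae_eq01 \<subseteq> square_integrable01 \<times> square_integrable01"
    by (auto simp: ae_eq01_def)
  show "refl_on square_integrable01 ae_eq01"
    by (auto simp: ae_eq01_def refl_on_def)
  show "sym ae_eq01"
    by (auto simp: ae_eq01_def sym_def elim: eventually_mono)
  show "trans ae_eq01"
  proof (rule transI)
    fix f g h assume "(f, g) \<in> ae_eq01" "(g, h) \<in> ae_eq01"
    then have *: "f \<in> square_integrable01" "h \<in> square_integrable01"
      and "AE x in leb01. f x = g x" "AE x in leb01. g x = h x"
      by (auto simp: ae_eq01_def)
    from this(3,4) have "AE x in leb01. f x = h x"
      by eventually_elim simp
    with * show "(f, h) \<in> ae_eq01"
      by (simp add: ae_eq01_def)
  qed
qed

lemma square_integrable01_mult:
  assumes "u \<in> square_integrable01" "v \<in> square_integrable01"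
  shows "integrable leb01 (\<lambda>x. u x * v x)"
proof (rule Bochner_Integration.integrable_bound)
  show "integrable leb01 (\<lambda>x. (u x)\<^sup>2 + (v x)\<^sup>2)"
    using assms by (auto simp: square_integrable01_def)
  show "(\<lambda>x. u x * v x) \<in> borel_measurable leb01"
    using assms by (auto simp: square_integrable01_def)
  have "\<bar>a * b\<bar> \<le> a\<^sup>2 + b\<^sup>2" for a b :: real
  proof -
    have "0 \<le> (\<bar>a\<bar> - \<bar>b\<bar>)\<^sup>2" "0 \<le> a\<^sup>2 + b\<^sup>2"
      by simp_all
    then show ?thesis
      unfolding power2_diff power2_abs abs_mult by linarith
  qed
  then show "AE x in leb01. norm (u x * v x) \<le> norm ((u x)\<^sup>2 + (v x)\<^sup>2)"
    by simp
qed

lemma square_integrable01_lincomb: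
  assumes "u \<in> square_integrable01" "v \<in> square_integrable01"
  shows "(\<lambda>x. a * u x + b * v x) \<in> square_integrable01"
    and "(LINT x|leb01. (a * u x + b * v x)\<^sup>2) =
           a\<^sup>2 * (LINT x|leb01. (u x)\<^sup>2) + 2 * a * b * (LINT x|leb01. u x * v x)
             + b\<^sup>2 * (LINT x|leb01. (v x)\<^sup>2)"
proof -
  have i: "integrable leb01 (\<lambda>x. (u x)\<^sup>2)" "integrable leb01 (\<lambda>x. (v x)\<^sup>2)"
    "integrable leb01 (\<lambda>x. u x * v x)"
    using assms square_integrable01_mult[OF assms] by (auto simp: square_integrable01_def)
  have eq: "(a * u x + b * v x)\<^sup>2 =
      a\<^sup>2 * (u x)\<^sup>2 + 2 * a * b * (u x * v x) + b\<^sup>2 * (v x)\<^sup>2" for x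
    by (simp add: power2_eq_square algebra_simps)
  show "(\<lambda>x. a * u x + b * v x) \<in> square_integrable01"
    unfolding square_integrable01_def mem_Collect_eq eq using i assms
    by (auto simp: square_integrable01_def)
  show "(LINT x|leb01. (a * u x + b * v x)\<^sup>2) =
           a\<^sup>2 * (LINT x|leb01. (u x)\<^sup>2) + 2 * a * b * (LINT x|leb01. u x * v x)
             + b\<^sup>2 * (LINT x|leb01. (v x)\<^sup>2)"
    unfolding eq using i by simp
qed

lemma L2_minkowski:
  assumes "u \<in> square_integrable01" "v \<in> square_integrable01"
  shows "sqrt (LINT x|leb01. (u x + v x)\<^sup>2) \<le>
           sqrt (LINT x|leb01. (u x)\<^sup>2) + sqrt (LINT x|leb01. (v x)\<^sup>2)"
proof -
  define A where "A = (LINT x|leb01. (u x)\<^sup>2)"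
  define B where "B = (LINT x|leb01. u x * v x)"
  define C where "C = (LINT x|leb01. (v x)\<^sup>2)"
  have nn: "A \<ge> 0" "C \<ge> 0"
    by (simp_all add: A_def C_def)
  have q: "0 \<le> a\<^sup>2 * A + 2 * a * b * B + b\<^sup>2 * C" for a b
  proof -
    have "0 \<le> (LINT x|leb01. (a * u x + b * v x)\<^sup>2)"
      by simp
    then show ?thesis
      unfolding square_integrable01_lincomb(2)[OF assms] A_def B_def C_def .
  qed
  have cs: "B\<^sup>2 \<le> A * C"
  proof (cases "C = 0")
    case True
    have "B = 0"
    proof (rule ccontr)
      assume "B \<noteq> 0"
      then show False
        using q[of 1 "- (A + 1) / (2 * B)"] True by (simp add: field_simps)
    qed
    then show ?thesis
      by (simp add: True)
  next
    case False
    with nn have C: "C > 0"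
      by simp
    have "0 \<le> C * (A * C - B\<^sup>2)"
      using q[of C "- B"] by (simp add: power2_eq_square algebra_simps)
    with C show ?thesis
      by (simp add: zero_le_mult_iff)
  qed
  have "B \<le> sqrt (A * C)"
    by (rule real_le_rsqrt[OF cs])
  then have "A + 2 * B + C \<le> (sqrt A + sqrt C)\<^sup>2"
    using nn by (simp add: power2_sum real_sqrt_mult)
  moreover have "(LINT x|leb01. (u x + v x)\<^sup>2) = A + 2 * B + C"
    using square_integrable01_lincomb(2)[OF assms, of 1 1] by (simp add: A_def B_def C_def)
  ultimately show ?thesis
    using nn unfolding A_def[symmetric] C_def[symmetric]
    by (intro real_le_lsqrt) auto
qed

lemma L2_space_some:
  assumes "A \<in> L2_space"
  shows "(SOME f. f \<in> A) \<in> square_integrable01" and "A = L2_class (SOME f. f \<in> A)"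
proof -
  have "A \<noteq> {}"
    using assms equiv_ae_eq01 in_quotient_imp_non_empty unfolding L2_space_def by blast
  then have *: "(SOME f. f \<in> A) \<in> A"
    by (simp add: some_in_eq)
  with assms show "(SOME f. f \<in> A) \<in> square_integrable01"
    using equiv_ae_eq01 in_quotient_imp_subset unfolding L2_space_def by blast
  from assms obtain f where "A = ae_eq01 `` {f}"
    unfolding L2_space_def by (rule quotientE)
  with * show "A = L2_class (SOME f. f \<in> A)"
    unfolding L2_class_def using equiv_class_eq[OF equiv_ae_eq01] by blast
qed

lemma square_integrable01_diff:
  assumes "u \<in> square_integrable01" "v \<in> square_integrable01"
  shows "(\<lambda>x. u x - v x) \<in> square_integrable01"
  using square_integrable01_lincomb(1)[OF assms, of 1 "-1"] by simp

lemma L2_dist_class: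
  assumes "f \<in> square_integrable01" "g \<in> square_integrable01"
  shows "L2_dist (L2_class f) (L2_class g) = sqrt (LINT x|leb01. (f x - g x)\<^sup>2)"
proof -
  let ?f = "SOME h. h \<in> L2_class f" and ?g = "SOME h. h \<in> L2_class g"
  have "f \<in> L2_class f" "g \<in> L2_class g"
    unfolding L2_class_def using equiv_class_self[OF equiv_ae_eq01] assms by auto
  then have "?f \<in> L2_class f" "?g \<in> L2_class g"
    using someI[of "\<lambda>h. h \<in> L2_class f" f] someI[of "\<lambda>h. h \<in> L2_class g" g] by simp_all
  then have *: "?f \<in> square_integrable01" "?g \<in> square_integrable01"
    and ae: "AE x in leb01. f x = ?f x" "AE x in leb01. g x = ?g x"
    by (auto simp: L2_class_def ae_eq01_def)
  have m: "(\<lambda>x. (?f x - ?g x)\<^sup>2) \<in> borel_measurable leb01"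
      "(\<lambda>x. (f x - g x)\<^sup>2) \<in> borel_measurable leb01"
    using * assms by (auto simp: square_integrable01_def)
  have "AE x in leb01. (?f x - ?g x)\<^sup>2 = (f x - g x)\<^sup>2"
    using ae by eventually_elim simp
  then have "(LINT x|leb01. (?f x - ?g x)\<^sup>2) = (LINT x|leb01. (f x - g x)\<^sup>2)"
    by (intro integral_cong_AE m)
  then show ?thesis
    unfolding L2_dist_def by simp
qed

interpretation L2: Metric_space L2_space L2_dist
proof
  show "0 \<le> L2_dist A B" for A B
    by (simp add: L2_dist_def)
  show "L2_dist A B = L2_dist B A" for A B
    by (simp add: L2_dist_def power2_commute)
  show "L2_dist A B = 0 \<longleftrightarrow> A = B" if "A \<in> L2_space" "B \<in> L2_space" for A B
  proof
    let ?f = "SOME f. f \<in> A" and ?g = "SOME f. f \<in> B"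
    assume "L2_dist A B = 0"
    then have "(LINT x|leb01. (?f x - ?g x)\<^sup>2) = 0"
      by (simp add: L2_dist_def)
    moreover have "integrable leb01 (\<lambda>x. (?f x - ?g x)\<^sup>2)"
      using square_integrable01_diff[OF L2_space_some(1)[OF that(1)] L2_space_some(1)[OF that(2)]]
      by (simp add: square_integrable01_def)
    ultimately have "AE x in leb01. (?f x - ?g x)\<^sup>2 = 0"
      using integral_nonneg_eq_0_iff_AE[of leb01 "\<lambda>x. (?f x - ?g x)\<^sup>2"] by simp
    then have "AE x in leb01. ?f x = ?g x"
      by simp
    then have "(?f, ?g) \<in> ae_eq01"
      using L2_space_some(1) that by (simp add: ae_eq01_def)
    then have "L2_class ?f = L2_class ?g"
      unfolding L2_class_def by (rule equiv_class_eq[OF equiv_ae_eq01])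
    then show "A = B"
      using L2_space_some(2) that by metis
  qed (simp add: L2_dist_def)
  show "L2_dist A C \<le> L2_dist A B + L2_dist B C"
    if "A \<in> L2_space" "B \<in> L2_space" "C \<in> L2_space" for A B C
    using L2_minkowski[OF
        square_integrable01_diff[OF L2_space_some(1)[OF that(1)] L2_space_some(1)[OF that(2)]]
        square_integrable01_diff[OF L2_space_some(1)[OF that(2)] L2_space_some(1)[OF that(3)]]]
    by (simp add: L2_dist_def)
qed


subsection \<open>Function classes with compact derivatives\<close>

text \<open>
  Functions on \<open>[0,1]\<close> are represented by their extensional extension to the real line, so that
  membership in a set of such functions depends on the values on \<open>[0,1]\<close> only. Derivatives at
  the end points are one-sided.
\<close>

definition deriv01 :: "(real \<Rightarrow> real) \<Rightarrow> real \<Rightarrow> real" where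
  "deriv01 G x = vector_derivative G (at x within {0..1})"

definition L2_compact_derivatives :: "(real \<Rightarrow> real) set \<Rightarrow> bool" where
  "L2_compact_derivatives I1 \<longleftrightarrow>
     I1 \<subseteq> {G \<in> extensional {0..1}. G differentiable_on {0..1}} \<and>
     compactin L2.mtopology ((\<lambda>G. L2_class (deriv01 G)) ` I1)"


subsection \<open>Distribution functions and the Kolmogorov test\<close>

definition cdfs01 :: "(real \<Rightarrow> real) set" where
  "cdfs01 = {cdf N | N. real_distribution N \<and> measure N {0..1} = 1}"

definition F0 :: "real \<Rightarrow> real" where
  "F0 x = max 0 (min 1 x)"

text \<open>
  The joint law of an i.i.d. sample \<open>X 1, \<dots>, X n\<close> with distribution function \<open>F\<close>;
  \<open>interval_measure F\<close> is the probability measure on the real line with distribution function \<open>F\<close>.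
\<close>

definition sample_law :: "nat \<Rightarrow> (real \<Rightarrow> real) \<Rightarrow> (nat \<Rightarrow> real) measure" where
  "sample_law n F = (\<Pi>\<^sub>M i\<in>{1..n}. interval_measure F)"

definition empirical_cdf :: "nat \<Rightarrow> (nat \<Rightarrow> real) \<Rightarrow> real \<Rightarrow> real" where
  "empirical_cdf n X x = real (card {i \<in> {1..n}. X i \<le> x}) / real n"

definition max_dev :: "real set \<Rightarrow> (real \<Rightarrow> real) \<Rightarrow> real" where
  "max_dev S F = (SUP x\<in>S. \<bar>F x - F0 x\<bar>)"

definition T_stat :: "(real \<Rightarrow> real) \<Rightarrow> real" where
  "T_stat F = max_dev {0..1} F"

text \<open>The Kolmogorov test with critical value \<open>c\<close> rejects iff \<open>T_stat (empirical_cdf n X) > c\<close>.\<close>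

definition type1_error :: "nat \<Rightarrow> real \<Rightarrow> real" where
  "type1_error n c =
     measure (sample_law n F0)
       {X \<in> space (sample_law n F0). T_stat (empirical_cdf n X) > c}"

definition type2_error :: "nat \<Rightarrow> real \<Rightarrow> (real \<Rightarrow> real) \<Rightarrow> real" where
  "type2_error n c F =
     measure (sample_law n F)
       {X \<in> space (sample_law n F). \<not> T_stat (empirical_cdf n X) > c}"

text \<open>The supremum is taken in \<open>ereal\<close>, where it is also defined for an empty set of alternatives.\<close>

definition sup_type2_error :: "nat \<Rightarrow> real \<Rightarrow> (real \<Rightarrow> real) set \<Rightarrow> ereal" where
  "sup_type2_error n c U = (SUP F\<in>U. ereal (type2_error n c F))"

definition alpha_uniformly_consistent :: "real \<Rightarrow> (nat \<Rightarrow> (real \<Rightarrow> real) set) \<Rightarrow> bool" where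
  "alpha_uniformly_consistent \<alpha> U \<longleftrightarrow>
     (\<forall>c :: nat \<Rightarrow> real. (\<lambda>n. type1_error n (c n)) \<longlonglongrightarrow> \<alpha> \<longrightarrow>
        limsup (\<lambda>n. sup_type2_error n (c n) (U n)) < ereal (1 - \<alpha>))"

definition uniformly_consistent :: "(nat \<Rightarrow> (real \<Rightarrow> real) set) \<Rightarrow> bool" where
  "uniformly_consistent U \<longleftrightarrow> (\<forall>\<alpha>. 0 < \<alpha> \<and> \<alpha> < 1 \<longrightarrow> alpha_uniformly_consistent \<alpha> U)"

definition alternatives ::
  "(real \<Rightarrow> real) set \<Rightarrow> real \<Rightarrow> real \<Rightarrow> real \<Rightarrow> nat \<Rightarrow> (real \<Rightarrow> real) set" where
  "alternatives I1 e1 e2 a n =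
     {F \<in> cdfs01. sqrt n * max_dev {e1..e2} F > a \<and>
                  (\<lambda>x\<in>{0..1}. sqrt n * (F x - F0 x)) \<in> I1}"

lemma cdfs01_interval_measure:
  assumes "F \<in> cdfs01"
  shows "real_distribution (interval_measure F)" and "cdf (interval_measure F) = F"
proof -
  obtain N where N: "real_distribution N" "F = cdf N"
    using assms by (auto simp: cdfs01_def)
  interpret real_distribution N by (rule N(1))
  show "real_distribution (interval_measure F)"
    unfolding N(2)
    by (intro real_distribution_interval_measure cdf_nondecreasing cdf_is_right_cont
        cdf_lim_at_bot cdf_lim_at_top_prob)
  show "cdf (interval_measure F) = F"
    unfolding N(2)
    by (intro cdf_interval_measure cdf_nondecreasing cdf_is_right_cont cdf_lim_at_bot)
qed

lemma F0_eq_cdf_uniform: "F0 = cdf (uniform_measure lborel {0..1})"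
proof
  fix x :: real
  have "{0..1} \<inter> {..x} = {0..min 1 x}"
    by auto
  then show "F0 x = cdf (uniform_measure lborel {0..1}) x"
    by (simp add: F0_def cdf_def measure_uniform_measure max_def)
qed

lemma F0_in_cdfs01: "F0 \<in> cdfs01"
proof -
  let ?U = "uniform_measure lborel {0..1::real}"
  interpret prob_space ?U
    by (rule prob_space_uniform_measure) auto
  have "real_distribution ?U"
    by unfold_locales auto
  moreover have "measure ?U {0..1} = 1"
    by (simp add: measure_uniform_measure)
  ultimately show ?thesis
    unfolding cdfs01_def F0_eq_cdf_uniform by blast
qed

end

theory Submission
  imports Defs
begin

text \<open>
  Put \<open>G = sqrt n * (F - F0)\<close> for an alternative \<open>F\<close>. The type II error is the probability that
  \<open>B + G\<close> stays within \<open>\<plusminus>b\<close> on \<open>[0,1]\<close>, where \<open>B = sqrt n * (empirical_cdf - F)\<close> and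
  \<open>b = sqrt n * c\<close>, while \<open>1 - \<alpha>\<close> is the limit of the probability that \<open>B\<close> alone stays within
  \<open>\<plusminus>b\<close> under the hypothesis. In both cases \<open>B\<close> is asymptotically a Brownian bridge, so the claim
  is a strict and uniform form of Anderson's inequality for the bridge: a shift \<open>G\<close> with
  \<open>\<bar>G\<bar> > a\<close> at some point \<open>x\<close> of \<open>[e1,e2]\<close> lowers this probability by a fixed amount.

  The bridge is used only through its values on the grids \<open>split_grid x l\<close>, which contain \<open>x\<close> and
  divide \<open>[0,x]\<close> and \<open>[x,1]\<close> dyadically. On such a grid the probability of the band is a tree of
  one-dimensional Gaussian integrals (\<open>gauss_tree\<close>): the value at the midpoint of an interval is
  normal given the end points, and given the midpoint the two halves are independent. The
  theorem rests on four properties of these trees.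

  \<^item> Log-concavity (\<open>gauss_tree_log_concave\<close>), jointly in the shift, the half-width and the end
    values. It follows from the Prekopa-Leindler inequality on the line, applied at each node.

  \<^item> The gap (\<open>grid_prob_gap\<close>). Condition on the value \<open>u\<close> of the bridge at \<open>x\<close>. Without shift,
    the conditional probability \<open>k u\<close> of the band is even and log-concave, so that its superlevel
    sets are centred intervals; with shift, each superlevel set of the corresponding \<open>f\<close> has at
    most the same length, by log-concavity, but misses the points near one of \<open>\<plusminus>b\<close>, since it is
    confined to \<open>\<bar>u + G x\<bar> \<le> b\<close>. A centred Gaussian charges such a displaced set less. The loss
    does not depend on \<open>l\<close>, because \<open>k\<close> is bounded below up to a fixed distance from \<open>\<plusminus>b\<close>
    by a small-ball estimate that is uniform in \<open>l\<close> (\<open>gauss_tree_small_ball\<close>).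

  \<^item> Convergence (\<open>grid_hit_tendsto\<close>). The counts of a sample in the grid cells obey the same
    recursion with binomial in place of normal laws (\<open>grid_event_prob_eq_binom_tree\<close>), and each
    level passes to the limit by the central limit theorem for binomial laws.

  \<^item> Continuity in the half-width, uniformly in \<open>l\<close> (\<open>grid_prob_uniform_continuity\<close>), again by
    log-concavity and the small-ball estimate.

  The grid probability is an upper bound for the type II error. For the level of the test a lower
  bound on the acceptance probability is needed, and this is where chaining enters
  (\<open>emp_dev_oscillation\<close>): under the hypothesis the empirical process oscillates little between
  grid points, except on an event whose probability tends to zero with \<open>l\<close>, uniformly in large \<open>n\<close>.

  If the conclusion failed, there would be sample sizes tending to infinity and alternatives whose
  type II error is asymptotically at least \<open>1 - \<alpha>\<close>. Compactness bounds the derivatives of the functions \<open>G\<close> in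
  \<open>L2\<close>, so these functions are bounded and uniformly Hoelder continuous; along a subsequence the
  critical values, the points \<open>x\<close> and the values of \<open>G\<close> on a given grid converge. In the limit
  \<open>1 - \<alpha>\<close> is at most the shifted grid probability, hence at most the centred one minus the gap,
  and that is at most \<open>1 - \<alpha>\<close> minus half the gap plus the oscillation error. Refining the grid
  gives the contradiction.
\<close>

section \<open>The Prekopa-Leindler inequality on the line\<close>

lemma nn_integral_layer_cake:
  fixes f :: "'a \<Rightarrow> real"
  assumes "sigma_finite_measure M" and [measurable]: "f \<in> borel_measurable M"
  shows "(\<integral>\<^sup>+x. ennreal (f x) \<partial>M) = (\<integral>\<^sup>+l\<in>{0..}. emeasure M {x \<in> space M. l < f x} \<partial>lborel)"
proof -
  interpret sigma_finite_measure M by fact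
  interpret pair_sigma_finite M lborel
    by unfold_locales
  have "ennreal (f x) = (\<integral>\<^sup>+l. indicator {0..} l * indicator {p. snd p < f (fst p)} (x, l) \<partial>lborel)" for x
  proof -
    have "ennreal (f x) = emeasure lborel {0..<max 0 (f x)}"
      by (simp add: max_def ennreal_neg)
    also have "\<dots> = (\<integral>\<^sup>+l. indicator {0..<max 0 (f x)} l \<partial>lborel)"
      by simp
    finally show ?thesis
      by (auto simp: indicator_def intro!: nn_integral_cong)
  qed
  then have "(\<integral>\<^sup>+x. ennreal (f x) \<partial>M)
      = (\<integral>\<^sup>+x. (\<integral>\<^sup>+l. indicator {0..} l * indicator {p. snd p < f (fst p)} (x, l) \<partial>lborel) \<partial>M)"
    by simp
  also have "\<dots> = (\<integral>\<^sup>+l. (\<integral>\<^sup>+x. indicator {0..} l * indicator {p. snd p < f (fst p)} (x, l) \<partial>M) \<partial>lborel)"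
    by (intro Fubini'[symmetric]) (simp add: case_prod_beta' indicator_def)
  also have "\<dots> = (\<integral>\<^sup>+l\<in>{0..}. emeasure M {x \<in> space M. l < f x} \<partial>lborel)"
  proof (intro nn_integral_cong)
    fix l :: real
    have "(\<integral>\<^sup>+x. indicator {0..} l * indicator {p. snd p < f (fst p)} (x, l) \<partial>M)
        = (\<integral>\<^sup>+x. indicator {0..} l * indicator {x \<in> space M. l < f x} x \<partial>M)"
      by (intro nn_integral_cong) (auto simp: indicator_def)
    then show "(\<integral>\<^sup>+x. indicator {0..} l * indicator {p. snd p < f (fst p)} (x, l) \<partial>M)
        = emeasure M {x \<in> space M. l < f x} * indicator {0..} l"
      by (simp add: nn_integral_cmult_indicator mult.commute)
  qed
  finally show ?thesis .
qed

lemma level_measure_measurable: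
  fixes f :: "'a \<Rightarrow> real"
  assumes "sigma_finite_measure M" and [measurable]: "f \<in> borel_measurable M"
  shows "(\<lambda>l. emeasure M {x \<in> space M. l < f x}) \<in> borel_measurable borel"
proof -
  interpret sigma_finite_measure M by fact
  show ?thesis by measurable
qed

text \<open>
  The translates of \<open>(1 - t) A\<close> by the minimum of \<open>t B\<close>, and of \<open>t B\<close> by the maximum of
  \<open>(1 - t) A\<close>, lie in the sumset and meet in one point only, so their measures add up.
\<close>

lemma measure_scaled_sumset_compact:
  fixes A B C :: "real set"
  assumes "compact A" "A \<noteq> {}" "compact B" "B \<noteq> {}" and t: "0 < t" "t < 1"
    and C: "C \<in> sets borel" "bounded C"
    and sub: "\<And>a b. a \<in> A \<Longrightarrow> b \<in> B \<Longrightarrow> (1 - t) * a + t * b \<in> C"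
  shows "(1 - t) * measure lborel A + t * measure lborel B \<le> measure lborel C"
proof -
  obtain p where p: "p \<in> A" "\<And>a. a \<in> A \<Longrightarrow> a \<le> p"
    using compact_attains_sup[OF assms(1,2)] by blast
  obtain q where q: "q \<in> B" "\<And>b. b \<in> B \<Longrightarrow> q \<le> b"
    using compact_attains_inf[OF assms(3,4)] by blast
  define A' where "A' = (\<lambda>a. t * q + (1 - t) * a) ` A"
  define B' where "B' = (\<lambda>b. (1 - t) * p + t * b) ` B"
  have cA: "compact A'" "compact B'"
    unfolding A'_def B'_def using assms(1,3)
    by (auto intro!: compact_continuous_image continuous_intros)
  have lb: "measure lebesgue S = measure lborel S" if "compact S" for S :: "real set"
    using that by (simp add: borel_compact)
  have mA: "measure lborel A' = (1 - t) * measure lborel A"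
  proof -
    have "measure lebesgue A' = (1 - t) * measure lebesgue A"
      using measure_lebesgue_affine[of "1 - t" "t * q" A] t by (simp add: A'_def add.commute)
    then show ?thesis
      using lb[OF cA(1)] lb[OF assms(1)] by simp
  qed
  have mB: "measure lborel B' = t * measure lborel B"
  proof -
    have "measure lebesgue B' = t * measure lebesgue B"
      using measure_lebesgue_affine[of t "(1 - t) * p" B] t by (simp add: B'_def add.commute)
    then show ?thesis
      using lb[OF cA(2)] lb[OF assms(3)] by simp
  qed
  \<comment> \<open>The only common point of the two translates.\<close>
  define z where "z = (1 - t) * p + t * q"
  have le: "a \<le> z" if "a \<in> A'" for a
    using that p(2) t by (auto simp: A'_def z_def)
  have ge: "z \<le> b" if "b \<in> B'" for b
    using that q(2) t by (auto simp: B'_def z_def)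
  have fm: "A' \<in> fmeasurable lborel" "B' \<in> fmeasurable lborel" "C \<in> fmeasurable lborel"
    using cA C by (auto simp: fmeasurable_compact intro!: fmeasurableI emeasure_bounded_finite)
  have "A' \<inter> B' \<subseteq> {z}"
    using le ge by force
  then have "measure lborel (A' \<inter> B') \<le> measure lborel {z}"
    by (intro measure_mono_fmeasurable) (use cA in \<open>auto intro: borel_compact fmeasurable_compact\<close>)
  then have "measure lborel (A' \<inter> B') = 0"
    by (simp add: measure_le_0_iff)
  then have "measure lborel (A' \<union> B') = measure lborel A' + measure lborel B'"
    using measure_Un3[OF fm(1,2)] by simp
  moreover have "A' \<union> B' \<subseteq> C"
    using sub p(1) q(1) by (auto simp: A'_def B'_def add.commute)
  then have "measure lborel (A' \<union> B') \<le> measure lborel C"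
    using fmeasurableD[OF fmeasurable.Un[OF fm(1,2)]] by (intro measure_mono_fmeasurable fm)
  ultimately show ?thesis
    using mA mB by simp
qed

text \<open>
  The general case follows from the compact one by inner regularity. The conclusion concerns any
  measurable \<open>C\<close> that contains the sumset, since the sumset itself may fail to be measurable.
\<close>

lemma brunn_minkowski_line:
  fixes A B C :: "real set"
  assumes A: "A \<in> sets borel" "A \<noteq> {}" "bounded A" and B: "B \<in> sets borel" "B \<noteq> {}" "bounded B"
    and t: "0 < t" "t < 1"
    and C: "C \<in> sets borel" "bounded C"
    and sub: "\<And>a b. a \<in> A \<Longrightarrow> b \<in> B \<Longrightarrow> (1 - t) * a + t * b \<in> C"
  shows "(1 - t) * measure lborel A + t * measure lborel B \<le> measure lborel C"
proof -
  have inner: "\<exists>K. compact K \<and> K \<noteq> {} \<and> K \<subseteq> S \<and> measure lborel S - e \<le> measure lborel K"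
    if S: "S \<in> sets borel" "S \<noteq> {}" "bounded S" and "e > 0" for S :: "real set" and e
  proof -
    have "S \<in> sets lebesgue" using S by auto
    from sets_lebesgue_inner_closed[OF this \<open>e > 0\<close>] obtain T where
      T: "closed T" "T \<subseteq> S" "(S - T) \<in> lmeasurable" "emeasure lebesgue (S - T) < ennreal e" by metis
    obtain s where s: "s \<in> S" using S by auto
    define K where "K = insert s T"
    have K: "compact K" "K \<noteq> {}" "K \<subseteq> S"
      using T s S(3) bounded_subset by (auto simp: K_def compact_eq_bounded_closed)
    have fS: "S \<in> fmeasurable lborel"
      using S by (auto intro!: fmeasurableI emeasure_bounded_finite)
    have "measure lborel S = measure lborel T + measure lborel (S - T)"
      using measure_Un3[of T lborel "S - T"] T fS
      by (metis Diff_disjoint Un_Diff_cancel borel_closed fmeasurable.Diff fmeasurable_compact compact_eq_bounded_closed S(3) bounded_subset measure_empty diff_zero sup.absorb2)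
    moreover have "measure lborel (S - T) \<le> e"
    proof -
      have "measure lebesgue (S - T) < e"
        using T(4) \<open>e > 0\<close> T(3) by (simp add: emeasure_eq_measure2 ennreal_less_iff)
      moreover have "measure lebesgue (S - T) = measure lborel (S - T)"
        using S T by (intro measure_completion) (auto intro: borel_closed)
      ultimately show ?thesis by simp
    qed
    moreover have "measure lborel T \<le> measure lborel K"
      using K T by (intro measure_mono_fmeasurable) (auto simp: K_def fmeasurable_compact borel_closed)
    ultimately show ?thesis using K by (intro exI[of _ K]) auto
  qed
  show ?thesis
  proof (rule field_le_epsilon)
    fix e :: real assume e: "e > 0"
    from inner[OF A e] obtain K where K: "compact K" "K \<noteq> {}" "K \<subseteq> A" "measure lborel A - e \<le> measure lborel K" by blast
    from inner[OF B e] obtain L where L: "compact L" "L \<noteq> {}" "L \<subseteq> B" "measure lborel B - e \<le> measure lborel L" by blast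
    have "(1 - t) * measure lborel K + t * measure lborel L \<le> measure lborel C"
      using K L by (intro measure_scaled_sumset_compact t C) (auto intro: sub)
    moreover have "(1 - t) * (measure lborel A - e) \<le> (1 - t) * measure lborel K"
      "t * (measure lborel B - e) \<le> t * measure lborel L"
      using K L t by (auto intro!: mult_left_mono)
    ultimately show "(1 - t) * measure lborel A + t * measure lborel B \<le> measure lborel C + e"
      by (simp add: algebra_simps)
  qed
qed

text \<open>
  After division by their suprema, \<open>f\<close> and \<open>g\<close> have nonempty superlevel sets exactly at the
  levels below 1. There the Brunn-Minkowski inequality bounds the superlevel sets of \<open>h\<close>;
  integration over the levels gives an arithmetic mean of the two integrals, which exceeds the
  geometric one by Young's inequality.
\<close>

theorem prekopa_leindler_line:
  fixes f g h :: "real \<Rightarrow> real"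
  assumes [measurable]: "f \<in> borel_measurable borel" "g \<in> borel_measurable borel" "h \<in> borel_measurable borel"
    and nn: "\<And>x. 0 \<le> f x" "\<And>x. 0 \<le> g x" "\<And>x. 0 \<le> h x"
    and bd: "\<And>x. f x \<le> K" "\<And>x. g x \<le> K"
    and supp: "\<And>x. R < \<bar>x\<bar> \<Longrightarrow> f x = 0" "\<And>x. R < \<bar>x\<bar> \<Longrightarrow> g x = 0" "\<And>x. R < \<bar>x\<bar> \<Longrightarrow> h x = 0"
    and int: "integrable lborel h"
    and t: "0 < t" "t < 1"
    and le: "\<And>x y. f x powr (1 - t) * g y powr t \<le> h ((1 - t) * x + t * y)"
  shows "(LINT x|lborel. f x) powr (1 - t) * (LINT x|lborel. g x) powr t \<le> (LINT x|lborel. h x)"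
proof (cases "(\<forall>x. f x = 0) \<or> (\<forall>x. g x = 0)")
  case True
  then have "(LINT x|lborel. f x) = 0 \<or> (LINT x|lborel. g x) = 0"
    by auto
  then show ?thesis
    using nn by (auto intro: Bochner_Integration.integral_nonneg)
next
  case False
  have bdd: "bdd_above (range f)" "bdd_above (range g)"
    using bd by (auto intro!: bdd_aboveI)
  define F where "F = (SUP x. f x)"
  define G where "G = (SUP x. g x)"
  have leF: "f x \<le> F" and leG: "g x \<le> G" for x
    unfolding F_def G_def by (auto intro: cSUP_upper bdd)
  have pos: "F > 0" "G > 0"
    using False nn leF leG by (metis less_le order_trans not_le)+
  define c where "c = F powr (1 - t) * G powr t"
  have c: "c > 0"
    using pos by (simp add: c_def)
  have intfg: "integrable lborel f" "integrable lborel g"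
  proof -
    have K: "0 \<le> K" using nn(1) bd(1) order_trans by blast
    have dom: "norm (u x) \<le> norm (K * indicator {-R..R} x :: real)"
      if "\<And>x. 0 \<le> u x" "\<And>x. u x \<le> K" "\<And>x. R < \<bar>x\<bar> \<Longrightarrow> u x = 0" for u x
      using that(1)[of x] that(2)[of x] that(3)[of x] K by (cases "R < \<bar>x\<bar>") (auto simp: indicator_def)
    have "integrable lborel (\<lambda>x. K * indicator {-R..R} x :: real)"
      by (intro integrable_mult_right integrable_real_indicator) (auto simp: emeasure_lborel_Icc_eq)
    then show "integrable lborel f"
      by (rule Bochner_Integration.integrable_bound)
        (simp, rule AE_I2, rule dom[OF nn(1) bd(1) supp(1)])
    have "integrable lborel (\<lambda>x. K * indicator {-R..R} x :: real)"
      by (intro integrable_mult_right integrable_real_indicator) (auto simp: emeasure_lborel_Icc_eq)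
    then show "integrable lborel g"
      by (rule Bochner_Integration.integrable_bound)
        (simp, rule AE_I2, rule dom[OF nn(2) bd(2) supp(2)])
  qed
  have sf: "sigma_finite_measure (lborel :: real measure)"
    by (rule lborel.sigma_finite_measure_axioms)
  have bset: "bounded {x. l < u x}" if "l \<ge> 0" "\<And>x. R < \<bar>x\<bar> \<Longrightarrow> u x = 0" for l and u :: "real \<Rightarrow> real"
  proof (rule bounded_subset[OF bounded_closed_interval[of "-R" R]], rule subsetI)
    fix x assume "x \<in> {x. l < u x}"
    then have "\<not> R < \<bar>x\<bar>"
      using that by force
    then show "x \<in> {-R..R}"
      by auto
  qed
  have em: "emeasure lborel {x. l < u x} = ennreal (measure lborel {x. l < u x})"
    if "l \<ge> 0" "\<And>x. R < \<bar>x\<bar> \<Longrightarrow> u x = 0" for l and u :: "real \<Rightarrow> real"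
    using emeasure_bounded_finite[OF bset[of l u]] that
    by (simp add: emeasure_eq_ennreal_measure less_top)
  \<comment> \<open>At levels from 1 on, both sets on the left are empty.\<close>
  have level: "ennreal (1 - t) * emeasure lborel {x. l < f x / F} + ennreal t * emeasure lborel {x. l < g x / G}
      \<le> emeasure lborel {x. l < h x / c}" if l: "l \<ge> 0" for l
  proof (cases "l < 1")
    case True
    have "l * F < (SUP x. f x)" "l * G < (SUP x. g x)"
      using True pos by (auto simp: F_def[symmetric] G_def[symmetric])
    then have "\<exists>x. l * F < f x" "\<exists>x. l * G < g x"
      using less_cSUP_iff[of UNIV f] less_cSUP_iff[of UNIV g] bdd by auto
    then have ex: "\<exists>x. l < f x / F" "\<exists>x. l < g x / G"
      using pos by (auto simp: pos_less_divide_eq)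
    have "(1 - t) * measure lborel {x. l < f x / F} + t * measure lborel {x. l < g x / G}
        \<le> measure lborel {x. l < h x / c}"
    proof (rule brunn_minkowski_line)
      show "{x. l < f x / F} \<noteq> {}" "{x. l < g x / G} \<noteq> {}"
        using ex by auto
      show "bounded {x. l < f x / F}" "bounded {x. l < g x / G}" "bounded {x. l < h x / c}"
        using supp by (auto intro!: bset l)
      fix x y assume "x \<in> {x. l < f x / F}" "y \<in> {x. l < g x / G}"
      then have xy: "l * F < f x" "l * G < g y"
        using pos by (auto simp: pos_less_divide_eq)
      have "l * c = (l * F) powr (1 - t) * (l * G) powr t"
        using l pos t by (auto simp: c_def powr_mult powr_add[symmetric] algebra_simps)
      also have "\<dots> < f x powr (1 - t) * g y powr t"
      proof (intro mult_strict_mono powr_less_mono2)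
        have "0 \<le> l * F" "0 \<le> l * G"
          using l pos by auto
        then show "0 \<le> l * F" "0 < f x powr (1 - t)" "0 \<le> l * G"
          using xy(1) by auto
      qed (use xy t in auto)
      also note le
      finally show "(1 - t) * x + t * y \<in> {x. l < h x / c}"
        using c by (simp add: pos_less_divide_eq)
    qed (use t in auto)
    then show ?thesis
      using t l supp by (subst (1 2 3) em) (auto simp: ennreal_mult'[symmetric] ennreal_plus[symmetric] simp del: ennreal_plus intro: ennreal_leI)
  next
    case False
    then have "{x. l < f x / F} = {}" "{x. l < g x / G} = {}"
      using leF leG pos by (auto simp: pos_less_divide_eq not_less) (smt (verit) mult_le_cancel_right1 order_trans)+
    then show ?thesis
      by simp
  qed
  have lay: "(\<integral>\<^sup>+x. ennreal (u x) \<partial>lborel) = (\<integral>\<^sup>+l\<in>{0..}. emeasure lborel {x. l < u x} \<partial>lborel)"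
    if "u \<in> borel_measurable borel" for u :: "real \<Rightarrow> real"
    using nn_integral_layer_cake[OF sf, of u] that by simp
  have meas[measurable]: "(\<lambda>l. emeasure lborel {x. l < u x}) \<in> borel_measurable borel"
    if "u \<in> borel_measurable borel" for u :: "real \<Rightarrow> real"
    using level_measure_measurable[OF sf, of u] that by simp
  have "ennreal (1 - t) * (\<integral>\<^sup>+x. ennreal (f x / F) \<partial>lborel) + ennreal t * (\<integral>\<^sup>+x. ennreal (g x / G) \<partial>lborel)
     = (\<integral>\<^sup>+l\<in>{0..}. (ennreal (1 - t) * emeasure lborel {x. l < f x / F} + ennreal t * emeasure lborel {x. l < g x / G}) \<partial>lborel)"
    by (subst (1 2) lay) (auto simp: nn_integral_cmult[symmetric] nn_integral_add[symmetric] distrib_right mult.assoc)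
  also have "\<dots> \<le> (\<integral>\<^sup>+l\<in>{0..}. emeasure lborel {x. l < h x / c} \<partial>lborel)"
    by (intro nn_integral_mono) (auto simp: indicator_def level)
  also have "\<dots> = (\<integral>\<^sup>+x. ennreal (h x / c) \<partial>lborel)"
    by (subst lay) auto
  finally have "ennreal ((1 - t) * (LINT x|lborel. f x / F) + t * (LINT x|lborel. g x / G)) \<le> ennreal (LINT x|lborel. h x / c)"
    using intfg int nn pos c t
    by (subst (asm) (1 2 3) nn_integral_eq_integral)
       (auto simp: ennreal_mult'[symmetric] ennreal_plus[symmetric] simp del: ennreal_plus intro!: Bochner_Integration.integral_nonneg divide_nonneg_pos)
  then have main: "(1 - t) * ((LINT x|lborel. f x) / F) + t * ((LINT x|lborel. g x) / G) \<le> (LINT x|lborel. h x) / c"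
    using nn c by (subst (asm) ennreal_le_iff) (auto intro!: Bochner_Integration.integral_nonneg divide_nonneg_pos)
  define I where "I = (LINT x|lborel. f x)"
  define J where "J = (LINT x|lborel. g x)"
  have IJ: "I \<ge> 0" "J \<ge> 0"
    unfolding I_def J_def using nn by (auto intro!: Bochner_Integration.integral_nonneg)
  show ?thesis
  proof (cases "I = 0 \<or> J = 0")
    case True
    then show ?thesis
      using nn by (auto simp: I_def J_def intro!: Bochner_Integration.integral_nonneg)
  next
    case False
    with IJ have "I > 0" "J > 0" by auto
    then have "(I / F) powr (1 - t) * (J / G) powr t \<le> (1 - t) * (I / F) + t * (J / G)"
      using pos t by (intro Youngs_inequality_0) auto
    also note main[folded I_def J_def]
    finally have "I powr (1 - t) * J powr t / c \<le> (LINT x|lborel. h x) / c"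
      using pos IJ by (simp add: powr_divide c_def)
    then show ?thesis
      using c by (simp add: I_def J_def divide_le_cancel)
  qed
qed

section \<open>Log-concavity of Gaussian bridge probabilities\<close>

text \<open>
  The leaves of the tree are the cells between consecutive points of the grid \<open>\<tau>\<close>. A node of
  height \<open>l\<close> whose first leaf is \<open>lo\<close> covers the interval from \<open>\<tau> lo\<close> to \<open>\<tau> (lo + 2 ^ l)\<close>.
  Its parameter below is the fraction of the interval that falls to the left child.
\<close>

abbreviation split_prop :: "(nat \<Rightarrow> real) \<Rightarrow> nat \<Rightarrow> nat \<Rightarrow> real" where
  "split_prop \<tau> l lo \<equiv> (\<tau> (lo + 2 ^ l) - \<tau> lo) / (\<tau> (lo + 2 ^ Suc l) - \<tau> lo)"

text \<open>
  Standard deviation and mean of a Brownian bridge at the splitting point, given its values \<open>x\<close>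
  and \<open>z\<close> at the ends of the interval.
\<close>

definition bridge_sd :: "(nat \<Rightarrow> real) \<Rightarrow> nat \<Rightarrow> nat \<Rightarrow> real" where
  "bridge_sd \<tau> l lo =
     sqrt ((\<tau> (lo + 2 ^ Suc l) - \<tau> lo) * split_prop \<tau> l lo * (1 - split_prop \<tau> l lo))"

definition bridge_mean :: "(nat \<Rightarrow> real) \<Rightarrow> nat \<Rightarrow> nat \<Rightarrow> real \<Rightarrow> real \<Rightarrow> real" where
  "bridge_mean \<tau> l lo x z = x + split_prop \<tau> l lo * (z - x)"

definition band :: "real \<Rightarrow> real \<Rightarrow> real set" where
  "band c b = {y. \<bar>y + c\<bar> \<le> b}"

text \<open>
  The probability that a Brownian bridge from \<open>x\<close> to \<open>z\<close> over a node, shifted by \<open>c\<close>, is at most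
  \<open>b\<close> in modulus at the interior grid points. The end points carry no constraint: this makes the
  two children independent given the value at the splitting point, and makes the limit theorem
  for these trees hold at all \<open>x\<close> and \<open>z\<close>.
\<close>

fun gauss_tree :: "(nat \<Rightarrow> real) \<Rightarrow> (nat \<Rightarrow> real) \<Rightarrow> real \<Rightarrow> nat \<Rightarrow> nat \<Rightarrow> real \<Rightarrow> real \<Rightarrow> real" where
  "gauss_tree \<tau> c b 0 lo x z = 1"
| "gauss_tree \<tau> c b (Suc l) lo x z =
     (LINT y|lborel. normal_density (bridge_mean \<tau> l lo x z) (bridge_sd \<tau> l lo) y *
        (indicator (band (c (lo + 2 ^ l)) b) y * (gauss_tree \<tau> c b l lo x y * gauss_tree \<tau> c b l (lo + 2 ^ l) y z)))"

lemma band_borel[measurable]: "band c b \<in> sets borel"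
  unfolding band_def by measurable

lemma split_prop_bounds:
  assumes "strict_mono_on {..N} \<tau>" "lo + 2 ^ Suc l \<le> N"
  shows "0 < split_prop \<tau> l lo" "split_prop \<tau> l lo < 1" "0 < bridge_sd \<tau> l lo"
proof -
  have a: "\<tau> lo < \<tau> (lo + 2 ^ l)" "\<tau> (lo + 2 ^ l) < \<tau> (lo + 2 ^ Suc l)"
    using assms(2) by (auto intro!: strict_mono_onD[OF assms(1)])
  then show 1: "0 < split_prop \<tau> l lo" "split_prop \<tau> l lo < 1"
    by (auto simp: divide_less_eq)
  then show "0 < bridge_sd \<tau> l lo"
    unfolding bridge_sd_def using a by simp
qed

lemma gauss_tree_measurable[measurable]:
  "(\<lambda>p. gauss_tree \<tau> c b l lo (fst p) (snd p)) \<in> borel_measurable (borel \<Otimes>\<^sub>M borel)"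
proof (induction l arbitrary: lo)
  case 0
  then show ?case by simp
next
  case (Suc l)
  note [measurable] = Suc
  have 1: "(\<lambda>q::(real\<times>real)\<times>real. gauss_tree \<tau> c b l lo (fst (fst q)) (snd q)) \<in> borel_measurable ((borel \<Otimes>\<^sub>M borel) \<Otimes>\<^sub>M lborel)"
    using measurable_compose[OF _ Suc[of lo], of "\<lambda>q::(real\<times>real)\<times>real. (fst (fst q), snd q)" "(borel \<Otimes>\<^sub>M borel) \<Otimes>\<^sub>M lborel"] by simp
  have 2: "(\<lambda>q::(real\<times>real)\<times>real. gauss_tree \<tau> c b l (lo + 2 ^ l) (snd q) (snd (fst q))) \<in> borel_measurable ((borel \<Otimes>\<^sub>M borel) \<Otimes>\<^sub>M lborel)"
    using measurable_compose[OF _ Suc[of "lo + 2 ^ l"], of "\<lambda>q::(real\<times>real)\<times>real. (snd q, snd (fst q))" "(borel \<Otimes>\<^sub>M borel) \<Otimes>\<^sub>M lborel"] by simp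
  note [measurable] = 1 2
  show ?case
    unfolding gauss_tree.simps normal_density_def bridge_mean_def
    by (intro lborel.borel_measurable_lebesgue_integral) (simp add: case_prod_beta')
qed

lemma gauss_tree_measurable':
  assumes "f \<in> borel_measurable M" "g \<in> borel_measurable M"
  shows "(\<lambda>w. gauss_tree \<tau> c b l lo (f w) (g w)) \<in> borel_measurable M"
  using measurable_compose[OF measurable_Pair[OF assms] gauss_tree_measurable] by simp

text \<open>
  The conditional probability at a node given the value \<open>y\<close> at its splitting point.
\<close>

abbreviation node_val :: "(nat \<Rightarrow> real) \<Rightarrow> (nat \<Rightarrow> real) \<Rightarrow> real \<Rightarrow> nat \<Rightarrow> nat \<Rightarrow> real \<Rightarrow> real \<Rightarrow> real \<Rightarrow> real" where
  "node_val \<tau> c b l lo x z y \<equiv> indicator (band (c (lo + 2 ^ l)) b) y *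
     (gauss_tree \<tau> c b l lo x y * gauss_tree \<tau> c b l (lo + 2 ^ l) y z)"

lemma node_val_measurable[measurable]: "node_val \<tau> c b l lo x z \<in> borel_measurable borel"
  by (intro borel_measurable_times gauss_tree_measurable') auto

lemma gauss_tree_bounds:
  assumes "strict_mono_on {..N} \<tau>" "lo + 2 ^ l \<le> N"
  shows "0 \<le> gauss_tree \<tau> c b l lo x z \<and> gauss_tree \<tau> c b l lo x z \<le> 1"
  using assms(2)
proof (induction l arbitrary: lo x z)
  case (Suc l)
  have sd: "0 < bridge_sd \<tau> l lo"
    using split_prop_bounds(3)[OF assms(1)] Suc.prems by simp
  let ?d = "normal_density (bridge_mean \<tau> l lo x z) (bridge_sd \<tau> l lo)"
  have b: "0 \<le> node_val \<tau> c b l lo x z y" "node_val \<tau> c b l lo x z y \<le> 1" for y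
    using Suc.IH[of lo x y] Suc.IH[of "lo + 2 ^ l" y z] Suc.prems
    by (auto simp: indicator_def mult_2 intro!: mult_le_one)
  have le: "?d y * node_val \<tau> c b l lo x z y \<le> ?d y" for y
    using mult_left_mono[OF b(2), of "?d y"] by simp
  have "(LINT y|lborel. ?d y * node_val \<tau> c b l lo x z y) \<le> (LINT y|lborel. ?d y)"
    using le sd by (intro integral_mono_AE' AE_I2) (auto intro!: mult_nonneg_nonneg b)
  moreover have "0 \<le> (LINT y|lborel. ?d y * node_val \<tau> c b l lo x z y)"
    by (intro Bochner_Integration.integral_nonneg mult_nonneg_nonneg b) auto
  ultimately show ?case
    using sd by simp
qed simp

lemma node_val_bounds:
  assumes "strict_mono_on {..N} \<tau>" "lo + 2 ^ Suc l \<le> N"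
  shows "0 \<le> node_val \<tau> c b l lo x z y" "node_val \<tau> c b l lo x z y \<le> 1"
  using gauss_tree_bounds[OF assms(1), of lo l] gauss_tree_bounds[OF assms(1), of "lo + 2^l" l] assms(2)
  by (auto simp: indicator_def mult_2 intro!: mult_le_one)

lemma node_integrable:
  assumes "strict_mono_on {..N} \<tau>" "lo + 2 ^ Suc l \<le> N" "0 < \<sigma>"
  shows "integrable lborel (\<lambda>y. normal_density m \<sigma> y * node_val \<tau> c b l lo x z y)"
proof (rule Bochner_Integration.integrable_bound[OF integrable_normal_density[OF assms(3), of m]])
  show "AE y in lborel. norm (normal_density m \<sigma> y * node_val \<tau> c b l lo x z y) \<le> norm (normal_density m \<sigma> y)"
  proof (rule AE_I2)
    fix y
    show "norm (normal_density m \<sigma> y * node_val \<tau> c b l lo x z y) \<le> norm (normal_density m \<sigma> y)"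
      unfolding norm_mult[of "normal_density m \<sigma> y"] using node_val_bounds[OF assms(1,2), where c=c and b=b and x=x and z=z and y=y]
      by (intro mult_left_le) (simp_all only: real_norm_def abs_of_nonneg abs_ge_zero)
  qed
qed measurable

lemma normal_density_log_concave:
  assumes t: "0 < t" "t < 1"
  shows "normal_density m1 \<sigma> y1 powr (1 - t) * normal_density m2 \<sigma> y2 powr t
    \<le> normal_density ((1 - t) * m1 + t * m2) \<sigma> ((1 - t) * y1 + t * y2)"
proof (cases "\<sigma> = 0")
  case True then show ?thesis by (simp add: normal_density_def)
next
  case False
  define u1 where "u1 = y1 - m1"
  define u2 where "u2 = y2 - m2"
  define K where "K = 1 / sqrt (2 * pi * \<sigma>\<^sup>2)"
  have K: "K > 0" using False by (simp add: K_def)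
  have sq: "((1 - t) * u1 + t * u2)\<^sup>2 \<le> (1 - t) * u1\<^sup>2 + t * u2\<^sup>2"
  proof -
    have "(1 - t) * u1\<^sup>2 + t * u2\<^sup>2 - ((1 - t) * u1 + t * u2)\<^sup>2 = t * (1 - t) * (u1 - u2)\<^sup>2"
      by (simp add: power2_eq_square algebra_simps)
    also have "\<dots> \<ge> 0" using t by simp
    finally show ?thesis by simp
  qed
  have nd: "normal_density m \<sigma> y = K * exp (- (y - m)\<^sup>2 / (2 * \<sigma>\<^sup>2))" for m y
    by (simp add: normal_density_def K_def)
  have "normal_density m1 \<sigma> y1 powr (1 - t) * normal_density m2 \<sigma> y2 powr t
      = (K powr (1 - t) * K powr t) * (exp (- u1\<^sup>2 / (2 * \<sigma>\<^sup>2)) powr (1 - t) * exp (- u2\<^sup>2 / (2 * \<sigma>\<^sup>2)) powr t)"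
    unfolding nd u1_def u2_def using K by (simp add: powr_mult)
  also have "K powr (1 - t) * K powr t = K"
    using K by (simp add: powr_add[symmetric])
  also have "exp (- u1\<^sup>2 / (2 * \<sigma>\<^sup>2)) powr (1 - t) * exp (- u2\<^sup>2 / (2 * \<sigma>\<^sup>2)) powr t
      = exp (- ((1 - t) * u1\<^sup>2 + t * u2\<^sup>2) / (2 * \<sigma>\<^sup>2))"
  proof -
    have "- u1\<^sup>2 / (2 * \<sigma>\<^sup>2) * (1 - t) + - u2\<^sup>2 / (2 * \<sigma>\<^sup>2) * t = - ((1 - t) * u1\<^sup>2 + t * u2\<^sup>2) / (2 * \<sigma>\<^sup>2)"
      unfolding times_divide_eq_left add_divide_distrib[symmetric] by (simp add: mult.commute)
    then show ?thesis
      by (simp only: exp_powr_real exp_add[symmetric])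
  qed
  also have "\<dots> \<le> exp (- ((1 - t) * u1 + t * u2)\<^sup>2 / (2 * \<sigma>\<^sup>2))"
    by (simp only: exp_le_cancel_iff, intro divide_right_mono) (use sq in auto)
  also have "K * \<dots> = normal_density ((1 - t) * m1 + t * m2) \<sigma> ((1 - t) * y1 + t * y2)"
    unfolding nd u1_def u2_def by (simp add: algebra_simps)
  finally show ?thesis using K by simp
qed

lemma band_convex:
  assumes t: "0 < t" "t < 1" and "y1 \<in> band c1 b1" "y2 \<in> band c2 b2"
  shows "(1 - t) * y1 + t * y2 \<in> band ((1 - t) * c1 + t * c2) ((1 - t) * b1 + t * b2)"
proof -
  have "\<bar>(1 - t) * y1 + t * y2 + ((1 - t) * c1 + t * c2)\<bar> = \<bar>(1 - t) * (y1 + c1) + t * (y2 + c2)\<bar>"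
    by (simp add: algebra_simps)
  also have "\<dots> \<le> (1 - t) * \<bar>y1 + c1\<bar> + t * \<bar>y2 + c2\<bar>"
    using abs_triangle_ineq[of "(1 - t) * (y1 + c1)" "t * (y2 + c2)"] t by (simp add: abs_mult)
  also have "\<dots> \<le> (1 - t) * b1 + t * b2"
    using assms by (intro add_mono mult_left_mono) (auto simp: band_def)
  finally show ?thesis by (simp add: band_def)
qed

lemma node_val_log_concave_step:
  assumes mono: "strict_mono_on {..N} \<tau>" and lo: "lo + 2 ^ Suc l \<le> N" and t: "0 < t" "t < 1"
    and children: "\<And>i u1 v1 u2 v2. i \<in> {lo, lo + 2 ^ l} \<Longrightarrow>
      gauss_tree \<tau> c1 b1 l i u1 v1 powr (1 - t) * gauss_tree \<tau> c2 b2 l i u2 v2 powr t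
      \<le> gauss_tree \<tau> (\<lambda>i. (1 - t) * c1 i + t * c2 i) ((1 - t) * b1 + t * b2) l i
          ((1 - t) * u1 + t * u2) ((1 - t) * v1 + t * v2)"
  shows "node_val \<tau> c1 b1 l lo x1 z1 y1 powr (1 - t) * node_val \<tau> c2 b2 l lo x2 z2 y2 powr t
     \<le> node_val \<tau> (\<lambda>i. (1 - t) * c1 i + t * c2 i) ((1 - t) * b1 + t * b2) l lo
          ((1 - t) * x1 + t * x2) ((1 - t) * z1 + t * z2) ((1 - t) * y1 + t * y2)"
    (is "?L \<le> ?R")
proof (cases "y1 \<in> band (c1 (lo + 2 ^ l)) b1 \<and> y2 \<in> band (c2 (lo + 2 ^ l)) b2")
  case True
  let ?i = "lo + 2 ^ l"
  have i: "lo + 2 ^ l \<le> N" "?i + 2 ^ l \<le> N" using lo by auto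
  note nn = gauss_tree_bounds[OF mono i(1), THEN conjunct1] gauss_tree_bounds[OF mono i(2), THEN conjunct1]
  have "?L = (gauss_tree \<tau> c1 b1 l lo x1 y1 powr (1 - t) * gauss_tree \<tau> c2 b2 l lo x2 y2 powr t) *
         (gauss_tree \<tau> c1 b1 l ?i y1 z1 powr (1 - t) * gauss_tree \<tau> c2 b2 l ?i y2 z2 powr t)"
    using True nn by (simp add: powr_mult)
  also have "\<dots> \<le> ?R"
    using band_convex[OF t, of y1 "c1 ?i" b1 y2 "c2 ?i" b2] True
      mult_mono[OF children[of lo x1 y1 x2 y2] children[of ?i y1 z1 y2 z2] nn(1)]
    by (simp add: nn)
  finally show ?thesis .
next
  case False
  then have "node_val \<tau> c1 b1 l lo x1 z1 y1 = 0 \<or> node_val \<tau> c2 b2 l lo x2 z2 y2 = 0"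
    by auto
  then have "?L = 0"
    by (elim disjE) (simp_all only: powr_0 mult_zero_left mult_zero_right)
  then show ?thesis
    using node_val_bounds(1)[OF mono lo] by (simp only:)
qed

text \<open>
  The integrand at a node is the product of a Gaussian density whose mean is linear in the end
  values, the indicator of a band that is convex in all parameters, and the two children, which
  are log-concave by induction. Prekopa-Leindler transfers log-concavity to the integral.
\<close>

theorem gauss_tree_log_concave:
  assumes "strict_mono_on {..N} \<tau>" "lo + 2 ^ l \<le> N" and t: "0 < t" "t < 1"
  shows "gauss_tree \<tau> c1 b1 l lo x1 z1 powr (1 - t) * gauss_tree \<tau> c2 b2 l lo x2 z2 powr t
     \<le> gauss_tree \<tau> (\<lambda>i. (1 - t) * c1 i + t * c2 i) ((1 - t) * b1 + t * b2) l lo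
          ((1 - t) * x1 + t * x2) ((1 - t) * z1 + t * z2)"
  using assms(2)
proof (induction l arbitrary: lo x1 x2 z1 z2)
  case (Suc l)
  define c where "c = (\<lambda>i. (1 - t) * c1 i + t * c2 i)"
  define b where "b = (1 - t) * b1 + t * b2"
  define x where "x = (1 - t) * x1 + t * x2"
  define z where "z = (1 - t) * z1 + t * z2"
  define \<sigma> where "\<sigma> = bridge_sd \<tau> l lo"
  have sd: "0 < \<sigma>"
    using split_prop_bounds(3)[OF assms(1) Suc.prems] by (simp add: \<sigma>_def)
  let ?m1 = "bridge_mean \<tau> l lo x1 z1" and ?m2 = "bridge_mean \<tau> l lo x2 z2" and ?m = "bridge_mean \<tau> l lo x z"
  let ?f = "\<lambda>y. normal_density ?m1 \<sigma> y * node_val \<tau> c1 b1 l lo x1 z1 y"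
  let ?g = "\<lambda>y. normal_density ?m2 \<sigma> y * node_val \<tau> c2 b2 l lo x2 z2 y"
  let ?h = "\<lambda>y. normal_density ?m \<sigma> y * node_val \<tau> c b l lo x z y"
  have m: "?m = (1 - t) * ?m1 + t * ?m2"
    unfolding bridge_mean_def x_def z_def by (simp only: ring_distribs) (simp add: algebra_simps)
  note nb = node_val_bounds[OF assms(1) Suc.prems]
  have *: "(LINT y|lborel. ?f y) powr (1 - t) * (LINT y|lborel. ?g y) powr t \<le> (LINT y|lborel. ?h y)"
  proof (rule prekopa_leindler_line)
    show "0 \<le> ?f y" "0 \<le> ?g y" "0 \<le> ?h y" for y
      using nb by auto
    have dl: "normal_density m \<sigma> y \<le> 1 / sqrt (2 * pi * \<sigma>\<^sup>2)" for m y
      unfolding normal_density_def using sd by (intro mult_left_le) auto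
    show "?f y \<le> 1 / sqrt (2 * pi * \<sigma>\<^sup>2)" "?g y \<le> 1 / sqrt (2 * pi * \<sigma>\<^sup>2)" for y
      by (rule order_trans[OF mult_left_le[OF nb(2) normal_density_nonneg] dl])+
    let ?i = "lo + 2 ^ l"
    define R where "R = \<bar>b1\<bar> + \<bar>b2\<bar> + \<bar>b\<bar> + \<bar>c1 ?i\<bar> + \<bar>c2 ?i\<bar> + \<bar>c ?i\<bar>"
    show "?f y = 0" "?g y = 0" "?h y = 0" if "R < \<bar>y\<bar>" for y
    proof -
      have "y \<notin> band (c1 ?i) b1" "y \<notin> band (c2 ?i) b2" "y \<notin> band (c ?i) b"
        using that by (auto simp: R_def band_def)
      then show "?f y = 0" "?g y = 0" "?h y = 0"
        by simp_all
    qed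
    show "integrable lborel ?h"
      by (rule node_integrable[OF assms(1) Suc.prems sd])
    show "?f y1 powr (1 - t) * ?g y2 powr t \<le> ?h ((1 - t) * y1 + t * y2)" for y1 y2
    proof -
      have node: "node_val \<tau> c1 b1 l lo x1 z1 y1 powr (1 - t) * node_val \<tau> c2 b2 l lo x2 z2 y2 powr t
          \<le> node_val \<tau> c b l lo x z ((1 - t) * y1 + t * y2)"
        unfolding c_def b_def x_def z_def using Suc.prems
        by (intro node_val_log_concave_step[OF assms(1) Suc.prems t] Suc.IH) auto
      have "?f y1 powr (1 - t) * ?g y2 powr t =
        (normal_density ?m1 \<sigma> y1 powr (1 - t) * normal_density ?m2 \<sigma> y2 powr t) *
        (node_val \<tau> c1 b1 l lo x1 z1 y1 powr (1 - t) * node_val \<tau> c2 b2 l lo x2 z2 y2 powr t)"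
        by (simp only: powr_mult mult_ac)
      also have "\<dots> \<le> ?h ((1 - t) * y1 + t * y2)"
        unfolding m by (intro mult_mono normal_density_log_concave[OF t] node) auto
      finally show ?thesis .
    qed
  qed (use t in auto)
  show ?case
    using * by (simp add: \<sigma>_def c_def b_def x_def z_def)
qed simp

lemma node_val_log_concave:
  assumes mono: "strict_mono_on {..N} \<tau>" and lo: "lo + 2 ^ Suc l \<le> N" and t: "0 < t" "t < 1"
  shows "node_val \<tau> c1 b1 l lo x1 z1 y1 powr (1 - t) * node_val \<tau> c2 b2 l lo x2 z2 y2 powr t
     \<le> node_val \<tau> (\<lambda>i. (1 - t) * c1 i + t * c2 i) ((1 - t) * b1 + t * b2) l lo
          ((1 - t) * x1 + t * x2) ((1 - t) * z1 + t * z2) ((1 - t) * y1 + t * y2)"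
  using lo by (intro node_val_log_concave_step[OF mono lo t] gauss_tree_log_concave[OF mono _ t]) auto

section \<open>Small-ball bounds for the Gaussian bridge\<close>

text \<open>
  The bridge is symmetric: reflection of the values turns the shift \<open>c\<close> into \<open>- c\<close>.
\<close>

lemma gauss_tree_uminus:
  "gauss_tree \<tau> (\<lambda>i. - c i) b l lo (- x) (- z) = gauss_tree \<tau> c b l lo x z"
proof (induction l arbitrary: lo x z)
  case (Suc l)
  let ?f = "\<lambda>y. normal_density (bridge_mean \<tau> l lo (- x) (- z)) (bridge_sd \<tau> l lo) y *
    node_val \<tau> (\<lambda>i. - c i) b l lo (- x) (- z) y"
  have "gauss_tree \<tau> (\<lambda>i. - c i) b (Suc l) lo (- x) (- z) = (LINT y|lborel. ?f y)"
    by simp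
  also have "\<dots> = (LINT y|lborel. ?f (- y))"
    using lborel_integral_real_affine[of "-1" ?f 0] by simp
  also have "\<dots> = (LINT y|lborel. normal_density (bridge_mean \<tau> l lo x z) (bridge_sd \<tau> l lo) y *
    node_val \<tau> c b l lo x z y)"
  proof (intro Bochner_Integration.integral_cong refl)
    fix y
    have "bridge_mean \<tau> l lo (- x) (- z) = - bridge_mean \<tau> l lo x z"
    proof -
      have "- x + p * (- z - - x) = - (x + p * (z - x))" for p :: real
        by (simp add: algebra_simps)
      then show ?thesis
        unfolding bridge_mean_def .
    qed
    then have "normal_density (bridge_mean \<tau> l lo (- x) (- z)) (bridge_sd \<tau> l lo) (- y)
        = normal_density (bridge_mean \<tau> l lo x z) (bridge_sd \<tau> l lo) y"
      by (simp add: normal_density_def power2_commute)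
    moreover have "- y \<in> band (- c (lo + 2 ^ l)) b \<longleftrightarrow> y \<in> band (c (lo + 2 ^ l)) b"
      by (auto simp: band_def)
    ultimately show "?f (- y) = normal_density (bridge_mean \<tau> l lo x z) (bridge_sd \<tau> l lo) y * node_val \<tau> c b l lo x z y"
      using Suc[of lo x y] Suc[of "lo + 2 ^ l" y z] by (simp add: indicator_def)
  qed
  finally show ?case by simp
qed simp

text \<open>
  The form \<open>exp (- K (\<sigma> / \<epsilon>) ^ 8)\<close> covers small and large \<open>\<epsilon>\<close> at once and turns products over the
  nodes of a tree into sums. For \<open>\<epsilon> \<ge> 2 \<sigma>\<close> it follows from the eighth moment, otherwise from the
  value of the density at distance \<open>2 \<sigma>\<close>.
\<close>

lemma normal_ball_lower_bound:
  fixes m \<sigma> \<epsilon> :: real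
  assumes "0 < \<sigma>" "0 < \<epsilon>"
  shows "exp (- (2560 * (\<sigma> / \<epsilon>) ^ 8)) \<le> (LINT y|lborel. normal_density m \<sigma> y * indicator {y. \<bar>y - m\<bar> \<le> \<epsilon>} y)"
proof -
  let ?I = "LINT y|lborel. normal_density m \<sigma> y * indicator {y. \<bar>y - m\<bar> \<le> \<epsilon>} y"
  have [measurable]: "{y. \<bar>y - m\<bar> \<le> \<epsilon>} \<in> sets borel" "{y. \<not> \<bar>y - m\<bar> \<le> \<epsilon>} \<in> sets borel"
    by measurable
  have int: "integrable lborel (\<lambda>y. normal_density m \<sigma> y * indicator A y)" if "A \<in> sets borel" for A
    using integrable_mult_indicator[OF _ integrable_normal_density[OF assms(1), of m], of A] that
    by (simp add: mult.commute)
  define u where "u = \<epsilon> / \<sigma>"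
  have u: "u > 0" using assms by (simp add: u_def)
  have inv: "(\<sigma> / \<epsilon>) ^ 8 = 1 / u ^ 8"
    by (simp add: u_def power_divide)
  show ?thesis
  proof (cases "u \<ge> 2")
    case True
    have "has_bochner_integral lborel (\<lambda>y. normal_density m \<sigma> y * (y - m) ^ 8) (105 * \<sigma> ^ 8)"
    proof -
      have "has_bochner_integral lborel (\<lambda>y. normal_density m \<sigma> y * (y - m) ^ (2 * 4)) (fact (2 * 4) / ((2 / \<sigma>\<^sup>2)^4 * fact 4))"
        by (rule normal_moment_even[OF assms(1)])
      moreover have "fact (2 * 4) / ((2 / \<sigma>\<^sup>2)^4 * fact 4) = 105 * \<sigma> ^ 8"
        using assms by (simp add: fact_numeral power_divide field_simps flip: power_mult)
      ultimately show ?thesis by simp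
    qed
    then have mom: "integrable lborel (\<lambda>y. normal_density m \<sigma> y * (y - m) ^ 8)"
        "(LINT y|lborel. normal_density m \<sigma> y * (y - m) ^ 8) = 105 * \<sigma> ^ 8"
      by (auto simp: has_bochner_integral_iff)
    have "(LINT y|lborel. normal_density m \<sigma> y * indicator {y. \<not> \<bar>y - m\<bar> \<le> \<epsilon>} y)
        \<le> (LINT y|lborel. normal_density m \<sigma> y * (y - m) ^ 8 / \<epsilon> ^ 8)"
    proof (rule integral_mono[OF int integrable_divide_zero[OF mom(1)]])
      fix y
      show "normal_density m \<sigma> y * indicator {y. \<not> \<bar>y - m\<bar> \<le> \<epsilon>} y \<le> normal_density m \<sigma> y * (y - m) ^ 8 / \<epsilon> ^ 8"
      proof (cases "\<bar>y - m\<bar> \<le> \<epsilon>")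
        case False
        then have "\<epsilon> ^ 8 \<le> \<bar>y - m\<bar> ^ 8"
          using assms by (intro power_mono) auto
        then have "1 \<le> (y - m) ^ 8 / \<epsilon> ^ 8"
          using assms by (simp add: power_even_abs)
        then have "normal_density m \<sigma> y * 1 \<le> normal_density m \<sigma> y * ((y - m) ^ 8 / \<epsilon> ^ 8)"
          by (intro mult_left_mono) auto
        then show ?thesis using False by simp
      qed (use assms in simp)
    qed simp
    also have "\<dots> = 105 / u ^ 8"
      using mom(2) by (simp add: u_def power_divide)
    finally have tail: "(LINT y|lborel. normal_density m \<sigma> y * indicator {y. \<not> \<bar>y - m\<bar> \<le> \<epsilon>} y) \<le> 105 / u ^ 8" .
    have "?I + (LINT y|lborel. normal_density m \<sigma> y * indicator {y. \<not> \<bar>y - m\<bar> \<le> \<epsilon>} y)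
        = (LINT y|lborel. normal_density m \<sigma> y)"
      by (subst Bochner_Integration.integral_add[symmetric, OF int int], measurable)
        (auto intro!: Bochner_Integration.integral_cong simp: indicator_def)
    then have I: "1 - 105 / u ^ 8 \<le> ?I"
      using tail assms(1) by simp
    have "2 ^ 8 \<le> u ^ 8"
      using True by (intro power_mono) auto
    then have v: "105 / u ^ 8 \<le> 1 / 2" "0 \<le> 105 / u ^ 8"
      using u by (auto simp: divide_le_eq)
    have "exp (- (2560 * (\<sigma> / \<epsilon>) ^ 8)) \<le> exp (- 2 * (105 / u ^ 8))"
      using u unfolding inv by (simp add: divide_right_mono)
    also have "\<dots> \<le> 1 - 105 / u ^ 8"
    proof -
      have "ln (1 - 105 / u ^ 8) \<ge> - (105 / u ^ 8) - 2 * (105 / u ^ 8)\<^sup>2"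
        by (rule ln_one_minus_pos_lower_bound) (use v in auto)
      moreover have "2 * (105 / u ^ 8)\<^sup>2 \<le> 105 / u ^ 8"
      proof -
        have "(105 / u ^ 8) * (105 / u ^ 8) \<le> (1/2) * (105 / u ^ 8)"
          using v by (intro mult_right_mono) auto
        then show ?thesis by (simp add: power2_eq_square)
      qed
      ultimately have "- 2 * (105 / u ^ 8) \<le> ln (1 - 105 / u ^ 8)"
        by simp
      then have "exp (- 2 * (105 / u ^ 8)) \<le> exp (ln (1 - 105 / u ^ 8))"
        by (simp only: exp_le_cancel_iff)
      then show ?thesis using v by simp
    qed
    finally show ?thesis using I by simp
  next
    case False
    then have u2: "u \<le> 2" by simp
    have lo: "exp (-2) / sqrt (2 * pi * \<sigma>\<^sup>2) \<le> normal_density m \<sigma> y" if "\<bar>y - m\<bar> \<le> \<epsilon>" for y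
    proof -
      have "\<bar>y - m\<bar> \<le> 2 * \<sigma>"
        using that u2 assms by (simp add: u_def pos_divide_le_eq)
      then have "(y - m)\<^sup>2 \<le> (2 * \<sigma>)\<^sup>2"
        by (metis abs_ge_zero power2_abs power_mono)
      then have "(y - m)\<^sup>2 / (2 * \<sigma>\<^sup>2) \<le> 2"
        using assms by (simp add: divide_le_eq power2_eq_square)
      then show ?thesis
        unfolding normal_density_def by (simp add: divide_right_mono)
    qed
    have "exp (2::real) = exp 1 * exp 1"
      by (simp flip: exp_add)
    also have "\<dots> \<le> 3 * 3"
      by (intro mult_mono exp_le) auto
    finally have e2: "1 / 9 \<le> exp (- 2 :: real)"
      by (simp add: exp_minus field_simps)
    have "sqrt (2 * pi) \<le> sqrt (3\<^sup>2)"
      using pi_less_4 by (intro real_sqrt_le_mono) simp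
    then have s3: "1 / 3 \<le> 1 / sqrt (2 * pi)"
      by (intro divide_left_mono) auto
    have "exp (- (2560 * (\<sigma> / \<epsilon>) ^ 8)) = 1 / exp (2560 / u ^ 8)"
      unfolding inv by (simp add: exp_minus field_simps)
    also have "\<dots> \<le> 1 / (2560 / u ^ 8)"
    proof (intro divide_left_mono)
      show "2560 / u ^ 8 \<le> exp (2560 / u ^ 8)"
        using exp_ge_add_one_self[of "2560 / u ^ 8"] by linarith
    qed (use u in auto)
    also have "\<dots> = u * u ^ 7 / 2560"
      by (simp flip: power_Suc)
    also have "\<dots> \<le> u * 2 ^ 7 / 2560"
      using u u2 by (intro divide_right_mono mult_left_mono power_mono) auto
    also have "\<dots> \<le> 2 * u * ((1 / 9) * (1 / 3))"
      using u by simp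
    also have "\<dots> \<le> 2 * u * (exp (- 2) * (1 / sqrt (2 * pi)))"
      using u e2 s3 by (intro mult_left_mono mult_mono) auto
    also have "\<dots> = exp (- 2) / sqrt (2 * pi * \<sigma>\<^sup>2) * (2 * \<epsilon>)"
      using assms by (simp add: u_def real_sqrt_mult mult_ac)
    also have "\<dots> = (LINT y|lborel. exp (- 2) / sqrt (2 * pi * \<sigma>\<^sup>2) * indicator {m - \<epsilon>..m + \<epsilon>} y)"
      using assms by simp
    also have "\<dots> \<le> ?I"
    proof (rule integral_mono)
      show "integrable lborel (\<lambda>y. exp (- 2) / sqrt (2 * pi * \<sigma>\<^sup>2) * indicator {m - \<epsilon>..m + \<epsilon>} y)"
        by (intro integrable_mult_right integrable_real_indicator) (auto simp: emeasure_lborel_Icc_eq)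
      fix y
      have "y \<in> {m - \<epsilon>..m + \<epsilon>} \<longleftrightarrow> \<bar>y - m\<bar> \<le> \<epsilon>" by auto
      then show "exp (- 2) / sqrt (2 * pi * \<sigma>\<^sup>2) * indicator {m - \<epsilon>..m + \<epsilon>} y
          \<le> normal_density m \<sigma> y * indicator {y. \<bar>y - m\<bar> \<le> \<epsilon>} y"
        using lo[of y] by (simp add: indicator_def)
    qed (rule int, measurable)
    finally show ?thesis .
  qed
qed

text \<open>
  Let every midpoint deviate from the mean of its neighbours by at most \<open>\<eta>\<close> times the fourth
  root of the length of its interval. These deviations form a geometric series along each branch, so
  the path stays in the band. The standard deviation at a midpoint is only of the order of the square
  root of the length, so that a node of length \<open>len\<close> contributes a factor \<open>exp (- const * len\<^sup>2)\<close>. The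
  sum of the squared lengths over all nodes converges, which is why the bound does not degenerate
  as the grid is refined.
\<close>

lemma gauss_tree_small_ball:
  fixes \<eta> :: real
  assumes "0 < \<eta>"
  defines "A \<equiv> 20 / \<eta> ^ 8"
  assumes mono: "strict_mono_on {..N} \<tau>" and "lo + 2 ^ l \<le> N" and "0 < d"
    and "\<And>j. j \<le> 2 ^ l \<Longrightarrow> \<tau> (lo + j) = \<tau> lo + j * d"
    and "\<bar>x\<bar> + 7 * \<eta> * sqrt (sqrt (2 ^ l * d)) \<le> b" "\<bar>z\<bar> + 7 * \<eta> * sqrt (sqrt (2 ^ l * d)) \<le> b"
  shows "exp (- (A * (2 ^ l * d)\<^sup>2)) \<le> gauss_tree \<tau> (\<lambda>_. 0) b l lo x z"
  using assms(4-)
proof (induction l arbitrary: lo x z)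
  case 0
  have "0 \<le> A" using assms(1) by (simp add: A_def)
  then show ?case by simp
next
  case (Suc l)
  define len where "len = 2 ^ Suc l * d"
  have len: "len > 0" "2 ^ l * d = len / 2"
    using Suc.prems(2) by (auto simp: len_def)
  have A: "A > 0" using assms(1) by (simp add: A_def)
  have tl: "\<tau> (lo + 2 ^ l) = \<tau> lo + len / 2" "\<tau> (lo + 2 ^ Suc l) = \<tau> lo + len"
    using Suc.prems(3)[of "2 ^ l"] Suc.prems(3)[of "2 ^ Suc l"] by (auto simp: len_def)
  have sp: "split_prop \<tau> l lo = 1 / 2"
    unfolding tl using len by simp
  have sd: "bridge_sd \<tau> l lo = sqrt len / 2"
    unfolding bridge_sd_def sp tl by (simp add: real_sqrt_divide)
  have mean: "bridge_mean \<tau> l lo x z = (x + z) / 2"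
    unfolding bridge_mean_def sp by (simp add: field_simps)
  \<comment> \<open>The deviation allowed at the midpoint.\<close>
  define e where "e = \<eta> * sqrt (sqrt len)"
  have e: "e > 0" using assms(1) len by (simp add: e_def)
  define q where "q = exp (- (A * (len / 2)\<^sup>2))"
  have ratio: "2560 * (sqrt len / 2 / e) ^ 8 = A / 2 * len\<^sup>2"
  proof -
    have "sqrt (sqrt len) ^ 8 = len\<^sup>2"
    proof -
      have "sqrt (sqrt len) ^ 8 = ((sqrt (sqrt len) ^ 2) ^ 2) ^ 2" by (simp flip: power_mult)
      then show ?thesis using len by simp
    qed
    moreover have "sqrt len ^ 8 = len ^ 4"
    proof -
      have "sqrt len ^ 8 = (sqrt len ^ 2) ^ 4" by (simp flip: power_mult)
      then show ?thesis using len by simp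
    qed
    ultimately have "(sqrt len / 2 / e) ^ 8 = len ^ 4 / (256 * (\<eta> ^ 8 * len\<^sup>2))"
      by (simp add: e_def power_divide power_mult_distrib)
    then show ?thesis
      using len assms(1) by (simp add: A_def field_simps power2_eq_square power4_eq_xxxx)
  qed
  \<comment> \<open>The factor 7 bounds the geometric series with ratio \<open>sqrt (sqrt (1 / 2))\<close>.\<close>
  have root: "1 + 7 * sqrt (sqrt (1 / 2)) \<le> (7 :: real)"
  proof -
    have "sqrt (sqrt (1 / 2)) \<le> sqrt (sqrt ((6 / 7) ^ 4))"
      by (intro real_sqrt_le_mono) (simp add: power4_eq_xxxx)
    also have "(6 / 7 :: real) ^ 4 = ((6 / 7)\<^sup>2)\<^sup>2" by (simp add: power2_eq_square power4_eq_xxxx)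
    also have "sqrt (sqrt (((6 / 7 :: real)\<^sup>2)\<^sup>2)) = 6 / 7" by (simp only: real_sqrt_abs) simp
    finally show ?thesis by simp
  qed
  have step: "e + 7 * \<eta> * sqrt (sqrt (len / 2)) \<le> 7 * \<eta> * sqrt (sqrt len)"
  proof -
    have "sqrt (sqrt (len / 2)) = sqrt (sqrt len) * sqrt (sqrt (1 / 2))"
      by (simp add: real_sqrt_mult[symmetric])
    then have "e + 7 * \<eta> * sqrt (sqrt (len / 2)) = e * (1 + 7 * sqrt (sqrt (1 / 2)))"
      by (simp add: e_def algebra_simps)
    also have "\<dots> \<le> e * 7" using root e by (intro mult_left_mono) auto
    finally show ?thesis by (simp add: e_def)
  qed
  have prems: "\<bar>x\<bar> + 7 * \<eta> * sqrt (sqrt len) \<le> b" "\<bar>z\<bar> + 7 * \<eta> * sqrt (sqrt len) \<le> b"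
    using Suc.prems(4,5) by (auto simp: len_def)
  have nn: "0 \<le> 7 * \<eta> * sqrt (sqrt (len / 2))"
    using assms(1) len by simp
  have sub: "q \<le> gauss_tree \<tau> (\<lambda>_. 0) b l lo x y" "q \<le> gauss_tree \<tau> (\<lambda>_. 0) b l (lo + 2 ^ l) y z" "\<bar>y\<bar> \<le> b"
    if "\<bar>y - (x + z) / 2\<bar> \<le> e" for y
  proof -
    have y: "\<bar>y\<bar> + 7 * \<eta> * sqrt (sqrt (len / 2)) \<le> b"
    proof -
      have "\<bar>y\<bar> \<le> e + (\<bar>x\<bar> + \<bar>z\<bar>) / 2"
      proof -
        have "\<bar>y\<bar> \<le> \<bar>y - (x + z) / 2\<bar> + \<bar>(x + z) / 2\<bar>"
          using abs_triangle_ineq[of "y - (x + z) / 2" "(x + z) / 2"] by simp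
        also have "\<dots> \<le> e + (\<bar>x\<bar> + \<bar>z\<bar>) / 2"
          using abs_triangle_ineq[of x z] by (intro add_mono that) (simp add: divide_right_mono)
        finally show ?thesis .
      qed
      moreover have "Y + s \<le> b" if "Y \<le> e + (X + Z) / 2" "X + t \<le> b" "Z + t \<le> b" "e + s \<le> t" for X Y Z s t :: real
        using that by argo
      ultimately show ?thesis
        using prems step by blast
    qed
    have x: "\<bar>x\<bar> + 7 * \<eta> * sqrt (sqrt (len / 2)) \<le> b" "\<bar>z\<bar> + 7 * \<eta> * sqrt (sqrt (len / 2)) \<le> b"
      using prems step e by linarith+
    show "\<bar>y\<bar> \<le> b" using y nn by linarith
    show "q \<le> gauss_tree \<tau> (\<lambda>_. 0) b l lo x y"
      using Suc.IH[of lo x y] Suc.prems(1,2,3) x y len by (simp add: q_def)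
    show "q \<le> gauss_tree \<tau> (\<lambda>_. 0) b l (lo + 2 ^ l) y z"
    proof -
      have "\<tau> (lo + 2 ^ l + j) = \<tau> (lo + 2 ^ l) + j * d" if "j \<le> 2 ^ l" for j
        using Suc.prems(3)[of "2 ^ l + j"] tl that len by (simp add: algebra_simps)
      then show ?thesis
        using Suc.IH[of "lo + 2 ^ l" y z] Suc.prems(1,2) x y len by (simp add: q_def)
    qed
  qed
  have q: "0 < q" by (simp add: q_def)
  have "exp (- (A * len\<^sup>2)) = exp (- (2560 * (sqrt len / 2 / e) ^ 8)) * (q * q)"
    unfolding ratio q_def by (simp add: power_divide flip: exp_add)
  also have "\<dots> \<le> (LINT y|lborel. normal_density ((x + z) / 2) (sqrt len / 2) y * indicator {y. \<bar>y - (x + z) / 2\<bar> \<le> e} y) * (q * q)"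
    using q by (intro mult_right_mono normal_ball_lower_bound e) (use len in auto)
  also have "\<dots> = (LINT y|lborel. normal_density ((x + z) / 2) (sqrt len / 2) y * indicator {y. \<bar>y - (x + z) / 2\<bar> \<le> e} y * (q * q))"
    by simp
  also have "\<dots> \<le> (LINT y|lborel. normal_density ((x + z) / 2) (sqrt len / 2) y * node_val \<tau> (\<lambda>_. 0) b l lo x z y)"
  proof (rule integral_mono)
    have "{y. \<bar>y - (x + z) / 2\<bar> \<le> e} \<in> sets borel" by measurable
    then show "integrable lborel (\<lambda>y. normal_density ((x + z) / 2) (sqrt len / 2) y * indicator {y. \<bar>y - (x + z) / 2\<bar> \<le> e} y * (q * q))"
      using integrable_mult_indicator[OF _ integrable_normal_density[of "sqrt len / 2" "(x + z) / 2"], of "{y. \<bar>y - (x + z) / 2\<bar> \<le> e}"] len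
      by (intro integrable_mult_left) (simp add: mult.commute)
    show "integrable lborel (\<lambda>y. normal_density ((x + z) / 2) (sqrt len / 2) y * node_val \<tau> (\<lambda>_. 0) b l lo x z y)"
      by (rule node_integrable[OF mono Suc.prems(1)]) (use len in simp)
    fix y
    show "normal_density ((x + z) / 2) (sqrt len / 2) y * indicator {y. \<bar>y - (x + z) / 2\<bar> \<le> e} y * (q * q)
        \<le> normal_density ((x + z) / 2) (sqrt len / 2) y * node_val \<tau> (\<lambda>_. 0) b l lo x z y"
    proof (cases "\<bar>y - (x + z) / 2\<bar> \<le> e")
      case True
      have "q * q \<le> gauss_tree \<tau> (\<lambda>_. 0) b l lo x y * gauss_tree \<tau> (\<lambda>_. 0) b l (lo + 2 ^ l) y z"
        using sub[OF True] q by (intro mult_mono) auto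
      then show ?thesis
        using True sub(3)[OF True] by (simp add: band_def mult_left_mono)
    next
      case False
      then show ?thesis
        using node_val_bounds(1)[OF mono Suc.prems(1), where c = "\<lambda>_. 0" and b = b and x = x and z = z and y = y]
        by (simp del: mult_eq_0_iff)
    qed
  qed
  finally show ?case
    by (simp add: mean sd len_def)
qed

section \<open>The strict gap between centred and shifted bands\<close>

text \<open>
  Compare \<open>f\<close> and \<open>k\<close> level by level. By convexity and evenness a superlevel set \<open>J\<close> of \<open>k\<close> is a
  centred interval, of half-length \<open>q\<close> say, and by \<open>mid\<close> the corresponding set \<open>I\<close> of \<open>f\<close> has diameter at
  most \<open>2 q\<close>, hence at most the measure of \<open>J\<close>. Exchanging mass outside \<open>[-q,q]\<close> for mass
  inside can only increase the Gaussian measure. Below the level \<open>p0\<close> there is a definite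
  increase: \<open>J\<close> contains the points between \<open>b - d\<close> and \<open>b - 3 * d / 4\<close>, and \<open>I\<close> does not.
\<close>

lemma gaussian_off_centre_gap:
  fixes f k :: "real \<Rightarrow> real"
  assumes \<sigma>: "0 < \<sigma>" and d: "0 < d" "d \<le> b"
  defines "\<rho> \<equiv> normal_density 0 \<sigma>"
  defines "\<kappa> \<equiv> d / 4 * (\<rho> (b - 3 * d / 4) - \<rho> (b - d / 2))"
  assumes [measurable]: "f \<in> borel_measurable borel" "k \<in> borel_measurable borel"
    and f01: "\<And>u. 0 \<le> f u" "\<And>u. f u \<le> 1" and k01: "\<And>u. 0 \<le> k u" "\<And>u. k u \<le> 1"
    and k_even: "\<And>u. k (- u) = k u"
    and k_convex: "\<And>l. 0 \<le> l \<Longrightarrow> convex {u. l < k u}"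
    and mid: "\<And>l u v. 0 \<le> l \<Longrightarrow> l < f u \<Longrightarrow> l < f v \<Longrightarrow> l < k ((u - v) / 2)"
    and f_supp: "\<And>u. b - d < u \<Longrightarrow> f u = 0" and k_supp: "\<And>u. b < \<bar>u\<bar> \<Longrightarrow> k u = 0"
    and k_low: "\<And>u. \<bar>u\<bar> \<le> b - d / 2 \<Longrightarrow> p0 \<le> k u" and p0: "0 \<le> p0"
  shows "(LINT u|lborel. \<rho> u * f u) + \<kappa> * p0 \<le> (LINT u|lborel. \<rho> u * k u) \<and> 0 < \<kappa>"
proof -
  have rho_anti: "\<rho> u \<le> \<rho> v" if "\<bar>v\<bar> \<le> \<bar>u\<bar>" for u v
  proof -
    have "v\<^sup>2 \<le> u\<^sup>2" using that by (simp add: abs_le_square_iff)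
    then show ?thesis
      unfolding \<rho>_def normal_density_def using \<sigma> by (intro mult_left_mono) (auto simp: divide_right_mono)
  qed
  have rho_strict: "\<rho> (b - d / 2) < \<rho> (b - 3 * d / 4)"
  proof -
    have "(b - 3 * d / 4)\<^sup>2 < (b - d / 2)\<^sup>2"
      using d by (intro power_strict_mono) auto
    then have "- (b - d / 2)\<^sup>2 / (2 * \<sigma>\<^sup>2) < - (b - 3 * d / 4)\<^sup>2 / (2 * \<sigma>\<^sup>2)"
      using \<sigma> by (intro divide_strict_right_mono) auto
    then show ?thesis
      unfolding \<rho>_def normal_density_def using \<sigma> by (intro mult_strict_left_mono) auto
  qed
  then have kpos: "0 < \<kappa>" using d by (simp add: \<kappa>_def)
  have [measurable]: "\<rho> \<in> borel_measurable borel" by (simp add: \<rho>_def)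
  have rho_int: "integrable lborel \<rho>" using \<sigma> by (simp add: \<rho>_def)
  have rho_nn: "0 \<le> \<rho> u" for u by (simp add: \<rho>_def)
  have level: "(LINT u|lborel. \<rho> u * indicator {u. l < f u} u) + (if l < p0 then \<kappa> else 0)
      \<le> (LINT u|lborel. \<rho> u * indicator {u. l < k u} u)" if l: "0 \<le> l" for l
  proof -
    define J where "J = {u. l < k u}"
    define I where "I = {u. l < f u}"
    have [measurable]: "J \<in> sets borel" "I \<in> sets borel"
      unfolding J_def I_def by measurable
    have intJ: "integrable lborel (\<lambda>u. \<rho> u * indicator J u)" "integrable lborel (\<lambda>u. \<rho> u * indicator I u)"
      using integrable_mult_indicator[OF _ rho_int, of J] integrable_mult_indicator[OF _ rho_int, of I]
      by (simp_all add: mult.commute)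
    have J_low: "u \<in> J" if "l < p0" "\<bar>u\<bar> \<le> b - d / 2" for u
      using k_low[OF that(2)] that(1) by (simp add: J_def)
    show ?thesis
    proof (cases "J = {}")
      case True
      then have "I = {}" using mid[OF l] by (auto simp: I_def J_def)
      moreover have "\<not> l < p0" using J_low[of 0] d True by auto
      ultimately show ?thesis using True by (simp add: I_def J_def)
    next
      case False
      have bdJ: "bdd_above J"
      proof (rule bdd_aboveI)
        fix u assume "u \<in> J"
        then have "\<not> b < \<bar>u\<bar>" using k_supp[of u] l by (auto simp: J_def)
        then show "u \<le> b" by simp
      qed
      define q where "q = Sup J"
      have symJ: "- u \<in> J \<longleftrightarrow> u \<in> J" for u by (simp add: J_def k_even)
      have Jq: "\<bar>u\<bar> \<le> q" if "u \<in> J" for u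
        using cSup_upper[OF that bdJ] cSup_upper[of "- u", OF _ bdJ] that symJ[of u]
        by (auto simp: q_def abs_le_iff)
      have qJ: "u \<in> J" if "\<bar>u\<bar> < q" for u
      proof -
        obtain v where v: "v \<in> J" "\<bar>u\<bar> < v"
          using less_cSup_iff[OF False bdJ] \<open>\<bar>u\<bar> < q\<close> by (auto simp: q_def)
        have "convex J" using k_convex[OF l] by (simp add: J_def)
        moreover have "u \<in> closed_segment (- v) v"
          using v(2) by (auto simp: closed_segment_eq_real_ivl)
        ultimately show ?thesis
          using v(1) symJ[of v] by (meson closed_segment_subset subsetD)
      qed
      have q0: "0 \<le> q"
        using False Jq abs_ge_zero order_trans by blast
      have fJ: "J \<in> fmeasurable lborel"
      proof (intro fmeasurableI emeasure_bounded_finite)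
        show "bounded J" using Jq by (auto simp: bounded_iff)
      qed auto
      have lenJ: "2 * q \<le> measure lborel J"
      proof -
        have "measure lborel {-q<..<q} \<le> measure lborel J"
          by (intro measure_mono_fmeasurable fJ) (auto intro!: qJ)
        then show ?thesis using q0 by simp
      qed
      have diam: "u - v \<le> 2 * q" if "u \<in> I" "v \<in> I" for u v
        using Jq[of "(u - v) / 2"] mid[OF l, of u v] that by (auto simp: I_def J_def)
      have fI: "I \<in> fmeasurable lborel \<and> measure lborel I \<le> 2 * q"
      proof (cases "I = {}")
        case True then show ?thesis using q0 by simp
      next
        case False
        then obtain w where w: "w \<in> I" by auto
        have bl: "bdd_below I" using diam[OF w] by (intro bdd_belowI[of _ "w - 2 * q"]) (smt (verit))
        define p where "p = Inf I"
        have sub: "I \<subseteq> {p..p + 2 * q}"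
        proof
          fix u assume u: "u \<in> I"
          have "u - 2 * q \<le> p"
            unfolding p_def by (rule cInf_greatest[OF False]) (use diam[OF u] in \<open>smt (verit)\<close>)
          then show "u \<in> {p..p + 2 * q}"
            using cInf_lower[OF u bl] by (auto simp: p_def)
        qed
        have "bounded I"
          by (rule bounded_subset[OF bounded_closed_interval sub])
        moreover have "measure lborel I \<le> measure lborel {p..p + 2 * q}"
          by (rule measure_mono_fmeasurable[OF sub]) (auto simp: fmeasurable_compact)
        ultimately show ?thesis
          using q0 by (auto intro!: fmeasurableI emeasure_bounded_finite)
      qed
      have intI: "integrable lborel (indicator J :: real \<Rightarrow> real)" "integrable lborel (indicator I :: real \<Rightarrow> real)"
        using fJ fI by (auto simp: fmeasurable_def)
      define S where "S = {b - d..b - 3 * d / 4} - {b - d}"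
      have [measurable]: "S \<in> sets borel" by (simp add: S_def)
      have S: "measure lborel S = d / 4" "integrable lborel (indicator S :: real \<Rightarrow> real)"
        using d by (auto simp: S_def measure_Diff emeasure_lborel_Icc_eq emeasure_Diff)
      let ?\<delta> = "\<rho> (b - 3 * d / 4) - \<rho> (b - d / 2)"
      \<comment> \<open>Both factors on the right have the same sign, since \<open>\<rho>\<close> is at least \<open>\<rho> q\<close> exactly on \<open>[-q,q]\<close>.
        Subtracting \<open>\<rho> q\<close> is harmless because the measure of \<open>I\<close> is at most that of \<open>J\<close>.\<close>
      have pw: "(if l < p0 then ?\<delta> else 0) * indicator S u \<le> (indicator J u - indicator I u) * (\<rho> u - \<rho> q)" for u
      proof -
        have nonneg: "0 \<le> (indicator J u - indicator I u :: real) * (\<rho> u - \<rho> q)"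
        proof (cases "u \<in> J")
          case True
          then have "\<rho> q \<le> \<rho> u" using Jq[OF True] q0 by (intro rho_anti) auto
          then show ?thesis using True by (auto simp: indicator_def)
        next
          case False
          then have "q \<le> \<bar>u\<bar>" using qJ[of u] by force
          then have "\<rho> u \<le> \<rho> q" using q0 by (intro rho_anti) auto
          then show ?thesis using False by (auto simp: indicator_def)
        qed
        show ?thesis
        proof (cases "l < p0 \<and> u \<in> S")
          case True
          then have u: "b - d < u" "u \<le> b - 3 * d / 4" by (auto simp: S_def)
          have "u \<in> J" using u d True by (intro J_low) auto
          moreover have "u \<notin> I" using f_supp[OF u(1)] l by (simp add: I_def)
          moreover have "b - d / 2 \<le> q"
            using Jq[OF J_low[of "b - d / 2"]] True d by auto
          then have "\<rho> q \<le> \<rho> (b - d / 2)" using d by (intro rho_anti) auto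
          moreover have "\<rho> (b - 3 * d / 4) \<le> \<rho> u" using u d by (intro rho_anti) auto
          ultimately show ?thesis using True by simp
        next
          case False
          then show ?thesis using nonneg by auto
        qed
      qed
      have "(if l < p0 then \<kappa> else 0) = (LINT u|lborel. (if l < p0 then ?\<delta> else 0) * indicator S u)"
        using S by (simp add: \<kappa>_def)
      also have "\<dots> \<le> (LINT u|lborel. (indicator J u - indicator I u) * (\<rho> u - \<rho> q))"
      proof (intro integral_mono pw)
        show "integrable lborel (\<lambda>u. (if l < p0 then ?\<delta> else 0) * indicator S u)"
          using S by (intro integrable_mult_right) auto
        show "integrable lborel (\<lambda>u. (indicator J u - indicator I u) * (\<rho> u - \<rho> q))"
          using intI intJ by (simp add: algebra_simps)
      qed
      also have "\<dots> = (LINT u|lborel. \<rho> u * indicator J u) - (LINT u|lborel. \<rho> u * indicator I u)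
          - \<rho> q * (measure lborel J - measure lborel I)"
      proof -
        have "(LINT u|lborel. (indicator J u - indicator I u) * (\<rho> u - \<rho> q))
          = (LINT u|lborel. (\<rho> u * indicator J u - \<rho> u * indicator I u) - \<rho> q * (indicator J u - indicator I u))"
          by (intro Bochner_Integration.integral_cong) (auto simp: algebra_simps)
        also have "\<dots> = (LINT u|lborel. \<rho> u * indicator J u - \<rho> u * indicator I u) - (LINT u|lborel. \<rho> q * (indicator J u - indicator I u))"
          using intI intJ by (intro Bochner_Integration.integral_diff integrable_mult_right Bochner_Integration.integrable_diff)
        also have "(LINT u|lborel. \<rho> u * indicator J u - \<rho> u * indicator I u) = (LINT u|lborel. \<rho> u * indicator J u) - (LINT u|lborel. \<rho> u * indicator I u)"
          using intJ by (intro Bochner_Integration.integral_diff)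
        also have "(LINT u|lborel. \<rho> q * (indicator J u - indicator I u)) = \<rho> q * (measure lborel J - measure lborel I)"
          using intI by simp
        finally show ?thesis .
      qed
      also have "\<dots> \<le> (LINT u|lborel. \<rho> u * indicator J u) - (LINT u|lborel. \<rho> u * indicator I u)"
        using fI lenJ rho_nn[of q] by simp
      finally show ?thesis by (simp add: I_def J_def)
    qed
  qed
  define M where "M = density lborel (\<lambda>u. ennreal (\<rho> u))"
  have M_prob: "prob_space M"
    unfolding M_def \<rho>_def using \<sigma> by (rule prob_space_normal_density)
  interpret M: prob_space M by (rule M_prob)
  have sM[simp, measurable_cong]: "sets M = sets borel" by (simp add: M_def)
  have spM[simp]: "space M = UNIV" by (simp add: M_def)
  have emM: "emeasure M A = ennreal (LINT u|lborel. \<rho> u * indicator A u)" if [measurable]: "A \<in> sets borel" for A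
  proof -
    have "emeasure M A = (\<integral>\<^sup>+u. ennreal (\<rho> u * indicator A u) \<partial>lborel)"
      unfolding M_def by (subst emeasure_density) (auto simp: ennreal_mult' ennreal_indicator rho_nn)
    also have "\<dots> = ennreal (LINT u|lborel. \<rho> u * indicator A u)"
      using integrable_mult_indicator[OF _ rho_int, of A]
      by (intro nn_integral_eq_integral) (auto simp: mult.commute rho_nn)
    finally show ?thesis .
  qed
  have lay: "(\<integral>\<^sup>+u. ennreal (g u) \<partial>M) = (\<integral>\<^sup>+l\<in>{0..}. emeasure M {u. l < g u} \<partial>lborel)"
    if "g \<in> borel_measurable borel" for g
    using nn_integral_layer_cake[OF M.sigma_finite_measure_axioms, of g] that
    by (simp add: measurable_cong_sets[OF sM])
  have meas: "(\<lambda>l. emeasure M {u. l < g u}) \<in> borel_measurable borel" if "g \<in> borel_measurable borel" for g :: "real \<Rightarrow> real"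
    using level_measure_measurable[OF M.sigma_finite_measure_axioms, of g] that
    by (simp add: measurable_cong_sets[OF sM])
  note [measurable] = meas[of f] meas[of k]
  have "(\<integral>\<^sup>+u. ennreal (f u) \<partial>M) + ennreal (\<kappa> * p0)
      = (\<integral>\<^sup>+l\<in>{0..}. emeasure M {u. l < f u} \<partial>lborel) + (\<integral>\<^sup>+l. ennreal \<kappa> * indicator {0..<p0} l \<partial>lborel)"
    using kpos p0 by (simp add: lay nn_integral_cmult ennreal_mult')
  also have "\<dots> = (\<integral>\<^sup>+l. emeasure M {u. l < f u} * indicator {0..} l + ennreal \<kappa> * indicator {0..<p0} l \<partial>lborel)"
    by (intro nn_integral_add[symmetric]) auto
  also have "\<dots> \<le> (\<integral>\<^sup>+l\<in>{0..}. emeasure M {u. l < k u} \<partial>lborel)"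
  proof (intro nn_integral_mono)
    fix l :: real
    show "emeasure M {u. l < f u} * indicator {0..} l + ennreal \<kappa> * indicator {0..<p0} l
        \<le> emeasure M {u. l < k u} * indicator {0..} l"
    proof (cases "0 \<le> l")
      case True
      have n: "0 \<le> (LINT u|lborel. \<rho> u * indicator {u. l < f u} u)"
        using rho_nn by (intro Bochner_Integration.integral_nonneg) auto
      have "emeasure M {u. l < f u} + ennreal (if l < p0 then \<kappa> else 0)
        = ennreal ((LINT u|lborel. \<rho> u * indicator {u. l < f u} u) + (if l < p0 then \<kappa> else 0))"
        using kpos n by (subst emM) (auto simp: ennreal_plus)
      also have "\<dots> \<le> emeasure M {u. l < k u}"
        using level[OF True] by (subst emM) (auto intro: ennreal_leI)
      finally show ?thesis using True by (auto simp: indicator_def split: if_splits)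
    qed auto
  qed
  also have "\<dots> = (\<integral>\<^sup>+u. ennreal (k u) \<partial>M)"
    by (simp add: lay)
  finally have *: "(\<integral>\<^sup>+u. ennreal (f u) \<partial>M) + ennreal (\<kappa> * p0) \<le> (\<integral>\<^sup>+u. ennreal (k u) \<partial>M)" .
  have conv: "(\<integral>\<^sup>+u. ennreal (g u) \<partial>M) = ennreal (LINT u|lborel. \<rho> u * g u)" "0 \<le> (LINT u|lborel. \<rho> u * g u)"
    if [measurable]: "g \<in> borel_measurable borel" and "\<And>u. 0 \<le> g u" "\<And>u. g u \<le> 1" for g
  proof -
    have "(\<integral>\<^sup>+u. ennreal (g u) \<partial>M) = (\<integral>\<^sup>+u. ennreal (\<rho> u * g u) \<partial>lborel)"
      unfolding M_def by (subst nn_integral_density) (auto simp: ennreal_mult' rho_nn)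
    also have "integrable lborel (\<lambda>u. \<rho> u * g u)"
      by (rule Bochner_Integration.integrable_bound[OF rho_int])
        (use that rho_nn in \<open>auto simp: abs_mult intro!: mult_left_le\<close>)
    then have "(\<integral>\<^sup>+u. ennreal (\<rho> u * g u) \<partial>lborel) = ennreal (LINT u|lborel. \<rho> u * g u)"
      using that rho_nn by (intro nn_integral_eq_integral) auto
    finally show "(\<integral>\<^sup>+u. ennreal (g u) \<partial>M) = ennreal (LINT u|lborel. \<rho> u * g u)" .
    show "0 \<le> (LINT u|lborel. \<rho> u * g u)"
      using that rho_nn by (intro Bochner_Integration.integral_nonneg) auto
  qed
  have "ennreal ((LINT u|lborel. \<rho> u * f u) + \<kappa> * p0) \<le> ennreal (LINT u|lborel. \<rho> u * k u)"
    using * conv[of f] conv[of k] f01 k01 kpos p0 by (simp add: ennreal_plus)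
  then show ?thesis
    using conv(2)[of k] k01 kpos by (subst (asm) ennreal_le_iff) auto
qed

lemma powr_mean_greater:
  fixes a b l t :: real
  assumes "0 \<le> l" "l < a" "l < b" "0 < t" "t < 1"
  shows "l < a powr (1 - t) * b powr t"
proof -
  have "l = l powr (1 - t) * l powr t"
    using assms by (cases "l = 0") (auto simp: powr_add[symmetric])
  also have "\<dots> < a powr (1 - t) * b powr t"
  proof (intro mult_strict_mono powr_less_mono2)
    show "0 < a powr (1 - t)" using assms by simp
  qed (use assms in auto)
  finally show ?thesis .
qed

text \<open>
  The grid of \<open>2 ^ Suc l + 1\<close> points that has \<open>x\<close> in the middle and is equidistant on both sides
  of \<open>x\<close>.
\<close>

definition split_grid :: "real \<Rightarrow> nat \<Rightarrow> nat \<Rightarrow> real" where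
  "split_grid x l j =
     (if j \<le> 2 ^ l then x * real j / 2 ^ l else x + (1 - x) * (real j - 2 ^ l) / 2 ^ l)"

lemma split_grid_simps [simp]:
  "split_grid x l 0 = 0" "split_grid x l (2 ^ l) = x" "split_grid x l (2 * 2 ^ l) = 1"
  by (auto simp: split_grid_def)

lemma split_grid_strict_mono:
  assumes "0 < x" "x < 1"
  shows "strict_mono (split_grid x l)"
proof (rule strict_monoI)
  fix i j :: nat assume ij: "i < j"
  consider "j \<le> 2 ^ l" | "i \<le> 2 ^ l" "2 ^ l < j" | "2 ^ l < i" by linarith
  then show "split_grid x l i < split_grid x l j"
  proof cases
    case 1 then show ?thesis using ij assms by (simp add: split_grid_def divide_strict_right_mono)
  next
    case 2
    then have "split_grid x l i \<le> x"
      using assms by (simp add: split_grid_def divide_le_eq)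
    moreover have "2 ^ l < real j" using 2(2) by (metis of_nat_less_iff of_nat_numeral of_nat_power)
    then have "0 < (1 - x) * (real j - 2 ^ l) / 2 ^ l"
      using assms by simp
    ultimately show ?thesis using 2 by (simp add: split_grid_def)
  next
    case 3 then show ?thesis using ij assms by (simp add: split_grid_def divide_strict_right_mono)
  qed
qed

lemma split_grid_mono_on: "0 < x \<Longrightarrow> x < 1 \<Longrightarrow> strict_mono_on A (split_grid x l)"
  using split_grid_strict_mono[of x l] by (simp add: strict_mono_on_def strict_mono_def)

lemma split_grid_left: "j \<le> 2 ^ l \<Longrightarrow> split_grid x l (0 + j) = split_grid x l 0 + real j * (x / 2 ^ l)"
  by (simp add: split_grid_def)

lemma split_grid_right: "j \<le> 2 ^ l \<Longrightarrow>
    split_grid x l (2 ^ l + j) = split_grid x l (2 ^ l) + real j * ((1 - x) / 2 ^ l)"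
  by (auto simp: split_grid_def)

lemma split_grid_bridge:
  "bridge_mean (split_grid x l) l 0 0 0 = 0" "bridge_sd (split_grid x l) l 0 = sqrt (x * (1 - x))"
  by (simp_all add: bridge_mean_def bridge_sd_def)

text \<open>
  The probability for a Brownian bridge from 0 to 0 over \<open>[0,1]\<close>.
\<close>

definition grid_prob :: "real \<Rightarrow> real \<Rightarrow> nat \<Rightarrow> (nat \<Rightarrow> real) \<Rightarrow> real" where
  "grid_prob x b l c = gauss_tree (split_grid x l) c b (Suc l) 0 0 0"

lemma grid_prob_eq:
  "grid_prob x b l c = (LINT u|lborel. normal_density 0 (sqrt (x * (1 - x))) u *
      node_val (split_grid x l) c b l 0 0 0 u)"
  unfolding grid_prob_def gauss_tree.simps split_grid_bridge by simp

lemma grid_prob_bounds: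
  assumes "0 < x" "x < 1"
  shows "0 \<le> grid_prob x b l c" "grid_prob x b l c \<le> 1"
  using gauss_tree_bounds[OF split_grid_mono_on[OF assms], of 0 "Suc l" "2 ^ Suc l"]
  by (auto simp: grid_prob_def)

text \<open>
  The product of the small-ball bounds for the two halves of the bridge, with \<open>\<eta> = r / 7\<close> and
  lengths at most 1.
\<close>

definition bridge_floor :: "real \<Rightarrow> real" where
  "bridge_floor r = exp (- (40 / (r / 7) ^ 8))"

lemma bridge_floor_pos: "0 < bridge_floor r"
  by (simp add: bridge_floor_def)

text \<open>
  Each half of the bridge runs between end values of modulus at most \<open>\<bar>u\<bar>\<close> and thus stays in the
  band if it deviates by at most \<open>r\<close>. The bound is the same for all \<open>l\<close>.
\<close>

lemma split_grid_node_lower_bound: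
  assumes x: "0 < x" "x < 1" and r: "0 < r" "\<bar>u\<bar> + r \<le> b"
  shows "bridge_floor r \<le> node_val (split_grid x l) (\<lambda>_. 0) b l 0 0 0 u"
proof -
  let ?\<tau> = "split_grid x l"
  define A where "A = 20 / (r / 7) ^ 8"
  have A: "A > 0" using r by (simp add: A_def)
  have mono: "strict_mono_on {..2 ^ Suc l} ?\<tau>" by (rule split_grid_mono_on[OF x])
  have half: "exp (- A) \<le> gauss_tree ?\<tau> (\<lambda>_. 0) b l lo w z"
    if "lo + 2 ^ l \<le> 2 ^ Suc l" "0 < w'" "w' \<le> 1" "\<And>j. j \<le> 2 ^ l \<Longrightarrow> ?\<tau> (lo + j) = ?\<tau> lo + real j * (w' / 2 ^ l)"
      "\<bar>w\<bar> + r \<le> b" "\<bar>z\<bar> + r \<le> b" for lo w z w'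
  proof -
    have "sqrt (sqrt w') \<le> 1" using that by simp
    then have "r * sqrt (sqrt w') \<le> r * 1" using r by (intro mult_left_mono) auto
    then have s: "\<bar>w\<bar> + 7 * (r / 7) * sqrt (sqrt (2 ^ l * (w' / 2 ^ l))) \<le> b"
        "\<bar>z\<bar> + 7 * (r / 7) * sqrt (sqrt (2 ^ l * (w' / 2 ^ l))) \<le> b"
      using that(5,6) by auto
    have "exp (- (20 / (r / 7) ^ 8 * (2 ^ l * (w' / 2 ^ l))\<^sup>2)) \<le> gauss_tree ?\<tau> (\<lambda>_. 0) b l lo w z"
      by (rule gauss_tree_small_ball[OF _ mono that(1) _ that(4) s]) (use r that in auto)
    moreover have "A * w'\<^sup>2 \<le> A * 1"
      using A that by (intro mult_left_mono) (auto simp: power_le_one)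
    ultimately show ?thesis
      by (smt (verit, best) A_def exp_le_cancel_iff mult_cancel_left1 nonzero_mult_div_cancel_left times_divide_eq_right zero_less_power zero_less_numeral)
  qed
  have "exp (- A) \<le> gauss_tree ?\<tau> (\<lambda>_. 0) b l 0 0 u"
    using x r by (intro half[of 0 x] split_grid_left) auto
  moreover have "exp (- A) \<le> gauss_tree ?\<tau> (\<lambda>_. 0) b l (2 ^ l) u 0"
    using x r by (intro half[of "2 ^ l" "1 - x"] split_grid_right) auto
  ultimately have "exp (- A) * exp (- A) \<le> gauss_tree ?\<tau> (\<lambda>_. 0) b l 0 0 u * gauss_tree ?\<tau> (\<lambda>_. 0) b l (2 ^ l) u 0"
    by (intro mult_mono) (auto intro: order_trans[OF exp_ge_zero])
  moreover have "u \<in> band 0 b" using r by (simp add: band_def)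
  moreover have "bridge_floor r = exp (- A) * exp (- A)"
    by (simp add: bridge_floor_def A_def flip: exp_add)
  ultimately show ?thesis by simp
qed

text \<open>
  Anderson's inequality with a gap. The constant depends on \<open>x\<close>, \<open>b\<close> and the size of the shift at
  the single point \<open>x\<close>, but on nothing else about the shift and not on the fineness of the grid.
\<close>

theorem grid_prob_gap:
  assumes x: "0 < x" "x < 1" and d: "0 < d" "d \<le> b"
  obtains \<kappa> where "0 < \<kappa>"
    "\<And>l c. d \<le> \<bar>c (2 ^ l)\<bar> \<Longrightarrow> grid_prob x b l c + \<kappa> \<le> grid_prob x b l (\<lambda>_. 0)"
proof -
  define \<sigma> where "\<sigma> = sqrt (x * (1 - x))"
  have \<sigma>: "0 < \<sigma>" using x by (simp add: \<sigma>_def)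
  define \<kappa> where "\<kappa> = d / 4 * (normal_density 0 \<sigma> (b - 3 * d / 4) - normal_density 0 \<sigma> (b - d / 2))"
  have main: "grid_prob x b l c + \<kappa> * bridge_floor (d / 2) \<le> grid_prob x b l (\<lambda>_. 0) \<and> 0 < \<kappa>" if c: "d \<le> c (2 ^ l)" for l c
  proof -
    let ?\<tau> = "split_grid x l"
    have mono: "strict_mono_on {..2 ^ Suc l} ?\<tau>" by (rule split_grid_mono_on[OF x])
    have le: "0 + 2 ^ Suc l \<le> (2 ^ Suc l :: nat)" by simp
    note nb = node_val_bounds[OF mono le]
    define f where "f = node_val ?\<tau> c b l 0 0 0"
    define k where "k = node_val ?\<tau> (\<lambda>_. 0) b l 0 0 0"
    \<comment> \<open>Reflecting the second argument turns midpoints into half-differences and cancels the shift.\<close>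
    have f_neg: "f v = node_val ?\<tau> (\<lambda>i. - c i) b l 0 0 0 (- v)" for v
    proof -
      have "v \<in> band (c (2 ^ l)) b \<longleftrightarrow> - v \<in> band (- c (2 ^ l)) b" by (auto simp: band_def)
      then show ?thesis
        using gauss_tree_uminus[of ?\<tau> c b l 0 0 v] gauss_tree_uminus[of ?\<tau> c b l "2 ^ l" v 0]
        by (simp add: f_def indicator_def)
    qed
    have logc: "node_val ?\<tau> c1 b l 0 0 0 y1 powr (1 - t) * node_val ?\<tau> c2 b l 0 0 0 y2 powr t
     \<le> node_val ?\<tau> (\<lambda>i. (1 - t) * c1 i + t * c2 i) b l 0 0 0 ((1 - t) * y1 + t * y2)" if "0 < t" "t < 1" for c1 c2 y1 y2 t
    proof -
      have "(1 - t) * b + t * b = b" by (simp add: algebra_simps)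
      then show ?thesis
        using node_val_log_concave[OF mono le that, where ?c1.0 = c1 and ?c2.0 = c2 and ?b1.0 = b and ?b2.0 = b
            and ?x1.0 = 0 and ?x2.0 = 0 and ?z1.0 = 0 and ?z2.0 = 0 and ?y1.0 = y1 and ?y2.0 = y2]
        by (simp only: mult_zero_right add_0)
    qed
    have res: "(LINT u|lborel. normal_density 0 \<sigma> u * f u) + \<kappa> * bridge_floor (d / 2) \<le> (LINT u|lborel. normal_density 0 \<sigma> u * k u) \<and> 0 < \<kappa>"
      unfolding \<kappa>_def
    proof (rule gaussian_off_centre_gap[OF \<sigma> d])
      show "f \<in> borel_measurable borel" "k \<in> borel_measurable borel"
        unfolding f_def k_def by measurable
      show "0 \<le> f u" "f u \<le> 1" "0 \<le> k u" "k u \<le> 1" for u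
        unfolding f_def k_def using nb by auto
      show "k (- u) = k u" for u
      proof -
        have "- u \<in> band 0 b \<longleftrightarrow> u \<in> band 0 b" by (auto simp: band_def)
        then show ?thesis
          using gauss_tree_uminus[of ?\<tau> "\<lambda>_. 0" b l 0 0 u] gauss_tree_uminus[of ?\<tau> "\<lambda>_. 0" b l "2 ^ l" u 0]
          by (simp add: k_def indicator_def)
      qed
      show "convex {u. s < k u}" if s: "0 \<le> s" for s
        unfolding convex_alt
      proof (intro ballI allI impI, elim conjE)
        fix u v t :: real assume uv: "u \<in> {u. s < k u}" "v \<in> {u. s < k u}" and t: "0 \<le> t" "t \<le> 1"
        show "(1 - t) *\<^sub>R u + t *\<^sub>R v \<in> {u. s < k u}"
        proof (cases "t = 0 \<or> t = 1")
          case False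
          then have t: "0 < t" "t < 1" using t by auto
          have "s < k u powr (1 - t) * k v powr t"
            using uv s t by (intro powr_mean_greater) auto
          also have "\<dots> \<le> k ((1 - t) * u + t * v)"
            using logc[OF t, of "\<lambda>_. 0" u "\<lambda>_. 0" v] by (simp add: k_def)
          finally show ?thesis by simp
        qed (use uv in auto)
      qed
      show "s < k ((u - v) / 2)" if s: "0 \<le> s" "s < f u" "s < f v" for s u v
      proof -
        have "s < f u powr (1 - 1 / 2) * f v powr (1 / 2)"
          using s by (intro powr_mean_greater) auto
        also have "\<dots> \<le> k ((u - v) / 2)"
          using logc[of "1 / 2" c u "\<lambda>i. - c i" "- v"] unfolding f_neg[of v] by (simp add: f_def k_def algebra_simps diff_divide_distrib)
        finally show ?thesis .
      qed
      show "f u = 0" if "b - d < u" for u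
      proof -
        have "u \<notin> band (c (2 ^ l)) b" using that c by (auto simp: band_def)
        then show ?thesis by (simp add: f_def)
      qed
      show "k u = 0" if "b < \<bar>u\<bar>" for u
      proof -
        have "u \<notin> band 0 b" using that by (auto simp: band_def)
        then show ?thesis by (simp add: k_def)
      qed
      show "bridge_floor (d / 2) \<le> k u" if "\<bar>u\<bar> \<le> b - d / 2" for u
        unfolding k_def using that d by (intro split_grid_node_lower_bound x) auto
      show "0 \<le> bridge_floor (d / 2)" using bridge_floor_pos less_imp_le by blast
    qed
    then show ?thesis
      unfolding grid_prob_eq f_def k_def \<sigma>_def by simp
  qed
  have neg: "grid_prob x b l (\<lambda>i. - c i) = grid_prob x b l c" for l c
    using gauss_tree_uminus[of "split_grid x l" c b "Suc l" 0 0 0] by (simp only: grid_prob_def minus_zero)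
  show ?thesis
  proof (rule that[of "\<kappa> * bridge_floor (d / 2)"])
    show "0 < \<kappa> * bridge_floor (d / 2)"
      using main[of "\<lambda>_. d" 0] bridge_floor_pos by simp
    fix l and c :: "nat \<Rightarrow> real" assume "d \<le> \<bar>c (2 ^ l)\<bar>"
    then consider "d \<le> c (2 ^ l)" | "d \<le> - c (2 ^ l)" by linarith
    then show "grid_prob x b l c + \<kappa> * bridge_floor (d / 2) \<le> grid_prob x b l (\<lambda>_. 0)"
      using main[where c=c] main[of "\<lambda>i. - c i" l] neg[of l c] by cases auto
  qed
qed

lemma grid_prob_lower_bound:
  assumes x: "0 < x" "x < 1" and b: "0 < b"
  shows "exp (- (2560 / (b / 2) ^ 8)) * bridge_floor (b / 2) \<le> grid_prob x b l (\<lambda>_. 0)"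
proof -
  let ?\<sigma> = "sqrt (x * (1 - x))" and ?k = "node_val (split_grid x l) (\<lambda>_. 0) b l 0 0 0"
  let ?I = "{y. \<bar>y - 0\<bar> \<le> b / 2}"
  have [measurable]: "?I \<in> sets borel" by measurable
  have \<sigma>: "0 < ?\<sigma>" "?\<sigma> \<le> 1"
    using x by (auto simp: mult_le_one)
  have mono: "strict_mono_on {..2 ^ Suc l} (split_grid x l)" by (rule split_grid_mono_on[OF x])
  have le: "0 + 2 ^ Suc l \<le> (2 ^ Suc l :: nat)" by simp
  have "2560 * (?\<sigma> / (b / 2)) ^ 8 \<le> 2560 * (1 / (b / 2)) ^ 8"
    using \<sigma> b by (intro mult_left_mono power_mono divide_right_mono) auto
  then have "exp (- (2560 / (b / 2) ^ 8)) \<le> exp (- (2560 * (?\<sigma> / (b / 2)) ^ 8))"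
    by (simp add: power_divide)
  also have "\<dots> \<le> (LINT y|lborel. normal_density 0 ?\<sigma> y * indicator ?I y)"
    using b by (intro normal_ball_lower_bound \<sigma>) auto
  finally have "exp (- (2560 / (b / 2) ^ 8)) * bridge_floor (b / 2)
      \<le> (LINT y|lborel. normal_density 0 ?\<sigma> y * indicator ?I y) * bridge_floor (b / 2)"
    using bridge_floor_pos[of "b / 2"] by (intro mult_right_mono) auto
  also have "\<dots> = (LINT y|lborel. normal_density 0 ?\<sigma> y * indicator ?I y * bridge_floor (b / 2))"
    by simp
  also have "\<dots> \<le> (LINT y|lborel. normal_density 0 ?\<sigma> y * ?k y)"
  proof (rule integral_mono)
    show "integrable lborel (\<lambda>y. normal_density 0 ?\<sigma> y * indicator ?I y * bridge_floor (b / 2))"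
      using integrable_mult_indicator[OF _ integrable_normal_density[OF \<sigma>(1), of 0], of ?I]
      by (intro integrable_mult_left) (simp add: mult.commute)
    show "integrable lborel (\<lambda>y. normal_density 0 ?\<sigma> y * ?k y)"
      by (rule node_integrable[OF mono le \<sigma>(1)])
    fix y
    show "normal_density 0 ?\<sigma> y * indicator ?I y * bridge_floor (b / 2) \<le> normal_density 0 ?\<sigma> y * ?k y"
    proof (cases "y \<in> ?I")
      case True
      then have "bridge_floor (b / 2) \<le> ?k y"
        using b by (intro split_grid_node_lower_bound x) auto
      then show ?thesis using True by (simp add: mult_left_mono)
    next
      case False
      then have "indicator ?I y = (0 :: real)" by simp
      moreover have "0 \<le> normal_density 0 ?\<sigma> y * ?k y"
        by (intro mult_nonneg_nonneg[OF normal_density_nonneg] node_val_bounds(1)[OF mono le])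
      ultimately show ?thesis by (simp only: mult_zero_right mult_zero_left)
    qed
  qed
  finally show ?thesis unfolding grid_prob_eq .
qed

text \<open>
  Log-concavity in the half-width compares \<open>b - \<epsilon>\<close>, a convex combination of \<open>b\<close> and \<open>b / 2\<close>, with
  these two values; the factor that is lost is a small power of the small-ball bound for \<open>b / 2\<close>.
\<close>

lemma grid_prob_uniform_continuity:
  assumes x: "0 < x" "x < 1" and b: "0 < b" and e: "0 < e"
  obtains \<epsilon> where "0 < \<epsilon>" "\<epsilon> < b" "\<And>l. grid_prob x b l (\<lambda>_. 0) \<le> grid_prob x (b - \<epsilon>) l (\<lambda>_. 0) + e"
proof -
  define p where "p = exp (- (2560 / (b / 2 / 2) ^ 8)) * bridge_floor (b / 2 / 2)"
  have p: "0 < p" using bridge_floor_pos by (simp add: p_def)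
  have "((\<lambda>t. p powr t) \<longlongrightarrow> p powr 0) (at_right 0)"
    using p by (intro tendsto_intros) auto
  then have "eventually (\<lambda>t. 1 - e < p powr t) (at_right 0)"
    using p e by (intro order_tendstoD) auto
  moreover have "eventually (\<lambda>t::real. 0 < t \<and> t < 1) (at_right 0)"
    by (simp add: eventually_at_right_field) (auto intro: exI[of _ 1])
  ultimately have "\<exists>t. 1 - e < p powr t \<and> 0 < t \<and> t < 1"
    by (rule eventually_happens'[OF _ eventually_conj, rotated]) simp
  then obtain t where t: "1 - e < p powr t" "0 < t" "t < 1" by blast
  show ?thesis
  proof (rule that[of "t * (b / 2)"])
    show "0 < t * (b / 2)" using t b by simp
    show "t * (b / 2) < b" using t b mult_strict_right_mono[of t 1 "b / 2"] by simp
    fix l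
    let ?P = "\<lambda>b. grid_prob x b l (\<lambda>_. 0)"
    have P: "0 \<le> ?P b" "?P b \<le> 1" using grid_prob_bounds[OF x] by auto
    have "gauss_tree (split_grid x l) (\<lambda>_. 0) b (Suc l) 0 0 0 powr (1 - t) * gauss_tree (split_grid x l) (\<lambda>_. 0) (b / 2) (Suc l) 0 0 0 powr t
      \<le> gauss_tree (split_grid x l) (\<lambda>i. (1 - t) * 0 + t * 0) ((1 - t) * b + t * (b / 2)) (Suc l) 0 ((1 - t) * 0 + t * 0) ((1 - t) * 0 + t * 0)"
      by (rule gauss_tree_log_concave[OF split_grid_mono_on[OF x], of _ _ "2 ^ Suc l"]) (use t in auto)
    moreover have "(1 - t) * b + t * (b / 2) = b - t * (b / 2)" by (simp add: algebra_simps)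
    ultimately have le: "?P b powr (1 - t) * ?P (b / 2) powr t \<le> ?P (b - t * (b / 2))"
      unfolding grid_prob_def by (simp only: mult_zero_right add_0)
    have "?P b * p powr t \<le> ?P b powr (1 - t) * ?P (b / 2) powr t"
    proof (intro mult_mono)
      show "?P b \<le> ?P b powr (1 - t)"
        using P t powr_mono'[of "1 - t" 1 "?P b"] by (cases "?P b = 0") auto
      show "p powr t \<le> ?P (b / 2) powr t"
        using p t grid_prob_lower_bound[OF x, of "b / 2" l] b by (intro powr_mono2) (auto simp: p_def)
    qed auto
    with le have "?P b * p powr t \<le> ?P (b - t * (b / 2))" by simp
    moreover have "?P b * (1 - e) \<le> ?P b * p powr t"
      using t P by (intro mult_left_mono) auto
    moreover have "?P b * e \<le> 1 * e" using P e by (intro mult_right_mono) auto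
    ultimately show "?P b \<le> ?P (b - t * (b / 2)) + e"
      by (simp add: algebra_simps)
  qed
qed

section \<open>Binomial trees and their Gaussian limits\<close>

text \<open>
  An extended continuous mapping theorem: the integrands may vary with \<open>n\<close> and need to converge
  only along sequences in the supports \<open>S n\<close>. Skorohod's representation turns it into dominated
  convergence.
\<close>

lemma integral_tendsto_of_continuous_convergence:
  fixes \<mu> :: "nat \<Rightarrow> real measure" and h :: "nat \<Rightarrow> real \<Rightarrow> real"
  assumes \<mu>: "\<And>n. real_distribution (\<mu> n)" and M: "real_distribution M" and conv: "weak_conv_m \<mu> M"
    and [measurable]: "\<And>n. h n \<in> borel_measurable borel" "g \<in> borel_measurable borel"
    and bd: "\<And>n x. \<bar>h n x\<bar> \<le> B"
    and S: "\<And>n. AE x in \<mu> n. x \<in> S n"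
    and cc: "AE x in M. \<forall>xs. (\<forall>n. xs n \<in> S n) \<longrightarrow> xs \<longlonglongrightarrow> x \<longrightarrow> (\<lambda>n. h n (xs n)) \<longlonglongrightarrow> g x"
  shows "(\<lambda>n. integral\<^sup>L (\<mu> n) (h n)) \<longlonglongrightarrow> integral\<^sup>L M g"
proof -
  obtain \<Omega> :: "real measure" and Y_seq :: "nat \<Rightarrow> real \<Rightarrow> real" and Y where
    ps: "prob_space \<Omega>" and
    Y_seq_measurable [measurable]: "\<And>n. Y_seq n \<in> borel_measurable \<Omega>" and
    distr_Y_seq: "\<And>n. distr \<Omega> borel (Y_seq n) = \<mu> n" and
    Y_measurable [measurable]: "Y \<in> borel_measurable \<Omega>" and
    distr_Y: "distr \<Omega> borel Y = M" and
    YnY: "\<And>x. x \<in> space \<Omega> \<Longrightarrow> (\<lambda>n. Y_seq n x) \<longlonglongrightarrow> Y x"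
    using Skorohod[OF \<mu> M conv] by force
  interpret prob_space \<Omega> by fact
  have 1: "AE x in \<Omega>. \<forall>n. Y_seq n x \<in> S n"
    unfolding AE_all_countable
  proof
    fix n
    show "AE x in \<Omega>. Y_seq n x \<in> S n"
      using S[of n] unfolding distr_Y_seq[symmetric] by (rule AE_distrD[rotated]) simp
  qed
  have 2: "AE x in \<Omega>. \<forall>xs. (\<forall>n. xs n \<in> S n) \<longrightarrow> xs \<longlonglongrightarrow> Y x \<longrightarrow> (\<lambda>n. h n (xs n)) \<longlonglongrightarrow> g (Y x)"
    using cc unfolding distr_Y[symmetric] by (rule AE_distrD[rotated]) simp
  have 3: "AE x in \<Omega>. (\<lambda>n. h n (Y_seq n x)) \<longlonglongrightarrow> g (Y x)"
    using 1 2 AE_space by eventually_elim (auto intro: YnY)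
  show ?thesis
    unfolding distr_Y[symmetric] distr_Y_seq[symmetric]
    by (simp add: integral_distr)
       (rule integral_dominated_convergence[where w="\<lambda>_. B"], use 3 bd in auto)
qed

lemma char_scaled_binomial:
  assumes p: "p \<in> {0..1}"
  shows "char (distr (measure_pmf (binomial_pmf k p)) borel (\<lambda>j. a + real j * s)) t
    = iexp (t * (a + real k * p * s)) * (of_real (1 - p) * iexp (- (t * s * p)) + of_real p * iexp (t * s * (1 - p))) ^ k"
proof -
  have "char (distr (measure_pmf (binomial_pmf k p)) borel (\<lambda>j. a + real j * s)) t
      = measure_pmf.expectation (binomial_pmf k p) (\<lambda>j. iexp (t * (a + real j * s)))"
    unfolding char_def by (subst integral_distr) auto
  also have "\<dots> = (\<Sum>j\<le>k. of_nat (k choose j) * (of_real p * iexp (t * s)) ^ j * of_real (1 - p) ^ (k - j)) * iexp (t * a)"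
    unfolding expectation_binomial_pmf'[OF p] sum_distrib_right
  proof (rule sum.cong)
    fix j
    have "iexp (t * (a + real j * s)) = iexp (t * s) ^ j * iexp (t * a)"
      by (simp add: exp_of_nat_mult[symmetric] exp_add[symmetric] algebra_simps)
    then show "(real (k choose j) * p ^ j * (1 - p) ^ (k - j)) *\<^sub>R iexp (t * (a + real j * s))
        = of_nat (k choose j) * (of_real p * iexp (t * s)) ^ j * of_real (1 - p) ^ (k - j) * iexp (t * a)"
      by (simp add: scaleR_conv_of_real power_mult_distrib)
  qed simp
  also have "(\<Sum>j\<le>k. of_nat (k choose j) * (of_real p * iexp (t * s)) ^ j * of_real (1 - p) ^ (k - j))
      = (of_real p * iexp (t * s) + of_real (1 - p)) ^ k"
    by (rule binomial_ring[symmetric])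
  also have "of_real p * iexp (t * s) + of_real (1 - p)
      = iexp (t * s * p) * (of_real (1 - p) * iexp (- (t * s * p)) + of_real p * iexp (t * s * (1 - p)))"
    by (simp add: distrib_left mult.left_commute[of "exp _"] exp_add[symmetric] algebra_simps)
  also have "(\<dots>) ^ k = iexp (t * real k * p * s) * (of_real (1 - p) * iexp (- (t * s * p)) + of_real p * iexp (t * s * (1 - p))) ^ k"
    by (simp add: power_mult_distrib exp_of_nat_mult[symmetric] mult_ac)
  finally show ?thesis
    by (simp add: exp_add[symmetric] algebra_simps)
qed

lemma exp_le_quadratic:
  fixes x :: real
  assumes "x \<le> 1"
  shows "exp x \<le> 1 + x + x\<^sup>2"
proof (cases "0 \<le> x")
  case True
  then show ?thesis using exp_bound[of x] assms by simp
next
  case False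
  define w where "w = - x"
  have w: "0 \<le> w" using False by (simp add: w_def)
  have "exp (- w) * (1 + w) \<le> exp (- w) * exp w"
    using exp_ge_add_one_self[of w] by (intro mult_left_mono) auto
  then have "exp (- w) * (1 + w) \<le> 1" by (simp flip: exp_add)
  also have "1 \<le> (1 - w + w\<^sup>2) * (1 + w)"
    using w by (simp add: power2_eq_square algebra_simps)
  finally show ?thesis using w by (simp add: mult_le_cancel_right w_def)
qed

text \<open>
  A second-order Taylor expansion of the characteristic function of a centred Bernoulli variable,
  with an error that does not depend on \<open>p\<close>; the powers of \<open>A\<close> and of the Gaussian factor can then
  be compared for varying success probabilities.
\<close>

lemma centred_bernoulli_char_approx:
  assumes p: "p \<in> {0..1}"
  defines "A \<equiv> \<lambda>v. of_real (1 - p) * iexp (- (v * p)) + of_real p * iexp (v * (1 - p))"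
  shows "cmod (A v) \<le> 1"
    and "cmod (A v - of_real (exp (- (p * (1 - p) * v\<^sup>2 / 2)))) \<le> \<bar>v\<bar> ^ 3 + v ^ 4"
proof -
  have c1: "cmod (iexp u) = 1" for u by simp
  have "cmod (A v) \<le> (1 - p) * 1 + p * 1"
    unfolding A_def using p by (intro norm_triangle_le add_mono) (auto simp only: norm_mult norm_of_real c1 abs_of_nonneg atLeastAtMost_iff diff_ge_0_iff_ge order_refl)
  then show "cmod (A v) \<le> 1" by simp
  define T where "T u = (\<Sum>k\<le>2. (\<i> * complex_of_real u)^k / fact k)" for u :: real
  have T: "T u = 1 + \<i> * of_real u - of_real (u\<^sup>2 / 2)" for u
    by (simp add: T_def numeral_2_eq_2 power2_eq_square algebra_simps)
  have ap: "cmod (iexp u - T u) \<le> \<bar>v\<bar> ^ 3 / 6" if "\<bar>u\<bar> \<le> \<bar>v\<bar>" for u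
  proof -
    have "cmod (iexp u - T u) \<le> \<bar>u\<bar> ^ Suc 2 / fact (Suc 2)"
      unfolding T_def by (rule iexp_approx1)
    also have "\<dots> = \<bar>u\<bar> ^ 3 / 6" by (simp add: fact_numeral numeral_3_eq_3 numeral_2_eq_2)
    also have "\<dots> \<le> \<bar>v\<bar> ^ 3 / 6" using that by (intro divide_right_mono power_mono) auto
    finally show ?thesis .
  qed
  define w where "w = p * (1 - p) * v\<^sup>2 / 2"
  have pp: "0 \<le> p * (1 - p)" "p * (1 - p) \<le> 1" using p by (auto simp: mult_le_one)
  have w: "0 \<le> w" "w \<le> v\<^sup>2"
    using pp mult_right_mono[OF pp(2), of "v\<^sup>2"] zero_le_power2[of v] unfolding w_def by (simp, linarith)
  have lin: "of_real (1 - p) * T (- (v * p)) + of_real p * T (v * (1 - p)) = of_real (1 - w)"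
    unfolding T w_def by (simp add: power2_eq_square algebra_simps) (simp add: field_simps)
  have "A v - of_real (1 - w) = of_real (1 - p) * (iexp (- (v * p)) - T (- (v * p))) + of_real p * (iexp (v * (1 - p)) - T (v * (1 - p)))"
    unfolding lin[symmetric] A_def by (simp add: algebra_simps)
  also have "cmod \<dots> \<le> (1 - p) * (\<bar>v\<bar> ^ 3 / 6) + p * (\<bar>v\<bar> ^ 3 / 6)"
  proof (intro norm_triangle_le add_mono)
    have np: "cmod (of_real (1 - p)) = 1 - p" "cmod (of_real p) = p"
      using p by (simp_all only: norm_of_real) auto
    have u: "\<bar>- (v * p)\<bar> \<le> \<bar>v\<bar>" "\<bar>v * (1 - p)\<bar> \<le> \<bar>v\<bar>"
      using p by (auto simp: abs_mult mult_left_le)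
    show "cmod (of_real (1 - p) * (iexp (- (v * p)) - T (- (v * p)))) \<le> (1 - p) * (\<bar>v\<bar> ^ 3 / 6)"
      unfolding norm_mult np using p by (intro mult_left_mono ap u) auto
    show "cmod (of_real p * (iexp (v * (1 - p)) - T (v * (1 - p)))) \<le> p * (\<bar>v\<bar> ^ 3 / 6)"
      unfolding norm_mult np using p by (intro mult_left_mono ap u) auto
  qed
  also have "\<dots> = \<bar>v\<bar> ^ 3 / 6"
    by (simp add: field_simps)
  also have "\<dots> \<le> \<bar>v\<bar> ^ 3"
    by simp
  finally have 1: "cmod (A v - of_real (1 - w)) \<le> \<bar>v\<bar> ^ 3" .
  have "\<bar>exp (- w) - (1 - w)\<bar> \<le> w\<^sup>2"
  proof -
    have "1 - w \<le> exp (- w)" using exp_ge_add_one_self[of "- w"] by simp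
    moreover have "exp (- w) \<le> 1 - w + w\<^sup>2" using exp_le_quadratic[of "- w"] w by simp
    ultimately show ?thesis by auto
  qed
  also have "w\<^sup>2 \<le> (v\<^sup>2)\<^sup>2" using w by (intro power_mono) auto
  finally have 2: "\<bar>exp (- w) - (1 - w)\<bar> \<le> v ^ 4" by (simp flip: power_mult)
  have "A v - of_real (exp (- w)) = (A v - of_real (1 - w)) - of_real (exp (- w) - (1 - w))"
    by simp
  also have "cmod \<dots> \<le> \<bar>v\<bar> ^ 3 + v ^ 4"
    by (rule order_trans[OF norm_triangle_ineq4]) (intro add_mono 1, use 2 in \<open>simp only: norm_of_real\<close>)
  finally show "cmod (A v - of_real (exp (- (p * (1 - p) * v\<^sup>2 / 2)))) \<le> \<bar>v\<bar> ^ 3 + v ^ 4"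
    by (simp add: w_def)
qed

text \<open>
  A de Moivre-Laplace theorem for triangular arrays: the number of trials and the success
  probability both vary, as they do when one conditions on the counts at coarser grid points.
\<close>

theorem scaled_binomial_weak_conv:
  fixes k :: "nat \<Rightarrow> nat" and p a s :: "nat \<Rightarrow> real"
  assumes p: "\<And>n. p n \<in> {0..1}" and s: "s \<longlonglongrightarrow> 0"
    and ks: "(\<lambda>n. real (k n) * (s n)\<^sup>2) \<longlonglongrightarrow> K"
    and var: "(\<lambda>n. real (k n) * (s n)\<^sup>2 * (p n * (1 - p n))) \<longlonglongrightarrow> 1"
    and mean: "(\<lambda>n. a n + real (k n) * p n * s n) \<longlonglongrightarrow> 0"
  shows "weak_conv_m (\<lambda>n. distr (measure_pmf (binomial_pmf (k n) (p n))) borel (\<lambda>j. a n + real j * s n)) std_normal_distribution"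
proof (rule levy_continuity)
  show "real_distribution (distr (measure_pmf (binomial_pmf (k n) (p n))) borel (\<lambda>j. a n + real j * s n))" for n
    by (intro prob_space.real_distribution_distr[OF measure_pmf.prob_space_axioms]) auto
  show "real_distribution std_normal_distribution"
    by (rule real_dist_normal_dist)
  fix t
  define v where "v n = t * s n" for n
  define A where "A n = of_real (1 - p n) * iexp (- (v n * p n)) + of_real (p n) * iexp (v n * (1 - p n))" for n
  define B where "B n = complex_of_real (exp (- (p n * (1 - p n) * (v n)\<^sup>2 / 2)))" for n
  have B1: "cmod (B n) \<le> 1" for n
    using p[of n] by (simp add: B_def)
  have "(\<lambda>n. A n ^ k n - B n ^ k n) \<longlonglongrightarrow> 0"
  proof (rule Lim_null_comparison)
    show "\<forall>\<^sub>F n in sequentially. norm (A n ^ k n - B n ^ k n)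
        \<le> (real (k n) * (s n)\<^sup>2) * (\<bar>t\<bar> ^ 3 * \<bar>s n\<bar> + t ^ 4 * (s n)\<^sup>2)"
    proof (rule always_eventually, rule allI)
      fix n
      have "norm (A n ^ k n - B n ^ k n) \<le> k n * norm (A n - B n)"
        using centred_bernoulli_char_approx(1)[OF p[of n], of "v n"] B1[of n] by (intro norm_power_diff) (auto simp: A_def)
      also have "\<dots> \<le> k n * (\<bar>v n\<bar> ^ 3 + v n ^ 4)"
        using centred_bernoulli_char_approx(2)[OF p[of n], of "v n"] by (intro mult_left_mono) (auto simp: A_def B_def)
      also have "\<dots> = (real (k n) * (s n)\<^sup>2) * (\<bar>t\<bar> ^ 3 * \<bar>s n\<bar> + t ^ 4 * (s n)\<^sup>2)"
      proof -
        have "\<bar>s n\<bar> ^ 3 = (s n)\<^sup>2 * \<bar>s n\<bar>" "s n ^ 4 = (s n)\<^sup>2 * (s n)\<^sup>2"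
          by (simp_all add: power3_eq_cube power2_eq_square power4_eq_xxxx abs_mult[symmetric])
        then show ?thesis
          by (simp add: v_def abs_mult power_mult_distrib algebra_simps)
      qed
      finally show "norm (A n ^ k n - B n ^ k n) \<le> (real (k n) * (s n)\<^sup>2) * (\<bar>t\<bar> ^ 3 * \<bar>s n\<bar> + t ^ 4 * (s n)\<^sup>2)" .
    qed
    have "(\<lambda>n. (real (k n) * (s n)\<^sup>2) * (\<bar>t\<bar> ^ 3 * \<bar>s n\<bar> + t ^ 4 * (s n)\<^sup>2)) \<longlonglongrightarrow> K * (\<bar>t\<bar> ^ 3 * \<bar>0\<bar> + t ^ 4 * 0\<^sup>2)"
      by (intro tendsto_intros ks s)
    then show "(\<lambda>n. (real (k n) * (s n)\<^sup>2) * (\<bar>t\<bar> ^ 3 * \<bar>s n\<bar> + t ^ 4 * (s n)\<^sup>2)) \<longlonglongrightarrow> 0" by simp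
  qed
  moreover have "(\<lambda>n. B n ^ k n) \<longlonglongrightarrow> of_real (exp (- (1 * t\<^sup>2 / 2)))"
  proof -
    have "B n ^ k n = of_real (exp (- ((real (k n) * (s n)\<^sup>2 * (p n * (1 - p n))) * t\<^sup>2 / 2)))" for n
      unfolding B_def of_real_power[symmetric] exp_of_nat_mult[symmetric] v_def
      by (simp add: power_mult_distrib mult_ac)
    then show ?thesis
      by (simp only:) (intro tendsto_intros var, simp)
  qed
  ultimately have "(\<lambda>n. (A n ^ k n - B n ^ k n) + B n ^ k n) \<longlonglongrightarrow> 0 + of_real (exp (- (1 * t\<^sup>2 / 2)))"
    by (rule tendsto_add)
  then have "(\<lambda>n. A n ^ k n) \<longlonglongrightarrow> of_real (exp (- t\<^sup>2 / 2))"
    by simp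
  moreover have "(\<lambda>n. iexp (t * (a n + real (k n) * p n * s n))) \<longlonglongrightarrow> iexp (t * 0)"
    by (intro tendsto_intros mean)
  ultimately have "(\<lambda>n. iexp (t * (a n + real (k n) * p n * s n)) * A n ^ k n) \<longlonglongrightarrow> iexp (t * 0) * of_real (exp (- t\<^sup>2 / 2))"
    by (intro tendsto_mult)
  then show "(\<lambda>n. char (distr (measure_pmf (binomial_pmf (k n) (p n))) borel (\<lambda>j. a n + real j * s n)) t)
      \<longlonglongrightarrow> char std_normal_distribution t"
    by (simp add: char_scaled_binomial[OF p] char_std_normal_distribution A_def v_def)
qed

text \<open>
  The discrete counterpart of \<open>gauss_tree\<close>: of the \<open>k\<close> sample points in a node, preceded by \<open>m\<close>
  points to its left, a binomial number falls into the left child. \<open>A i j\<close> is the constraint that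
  the number \<open>j\<close> of points up to grid point \<open>i\<close> has to satisfy.
\<close>

fun binom_tree :: "(nat \<Rightarrow> real) \<Rightarrow> (nat \<Rightarrow> nat \<Rightarrow> bool) \<Rightarrow> nat \<Rightarrow> nat \<Rightarrow> nat \<Rightarrow> nat \<Rightarrow> real" where
  "binom_tree q A 0 lo m k = 1"
| "binom_tree q A (Suc l) lo m k =
     measure_pmf.expectation (binomial_pmf k (split_prop q l lo))
       (\<lambda>j. of_bool (A (lo + 2 ^ l) (m + j)) * (binom_tree q A l lo m j * binom_tree q A l (lo + 2 ^ l) (m + j) (k - j)))"

lemma split_prop_in_unit:
  assumes "mono_on {..N} q" "lo + 2 ^ Suc l \<le> N"
  shows "split_prop q l lo \<in> {0..1}"
proof -
  have "q lo \<le> q (lo + 2 ^ l)" "q (lo + 2 ^ l) \<le> q (lo + 2 ^ Suc l)"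
    using assms by (auto intro!: mono_onD[OF assms(1)])
  then show ?thesis by (auto simp: divide_le_eq)
qed

lemma binom_tree_bounds:
  assumes "mono_on {..N} q" "lo + 2 ^ l \<le> N"
  shows "0 \<le> binom_tree q A l lo m k \<and> binom_tree q A l lo m k \<le> 1"
  using assms(2)
proof (induction l arbitrary: lo m k)
  case (Suc l)
  let ?f = "\<lambda>j. of_bool (A (lo + 2 ^ l) (m + j)) * (binom_tree q A l lo m j * binom_tree q A l (lo + 2 ^ l) (m + j) (k - j))"
  have f: "0 \<le> ?f j \<and> ?f j \<le> 1" for j
    using Suc.IH[of lo m j] Suc.IH[of "lo + 2 ^ l" "m + j" "k - j"] Suc.prems by (auto intro!: mult_le_one)
  have p: "split_prop q l lo \<in> {0..1}" by (rule split_prop_in_unit[OF assms(1) Suc.prems])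
  have "measure_pmf.expectation (binomial_pmf k (split_prop q l lo)) ?f \<le> measure_pmf.expectation (binomial_pmf k (split_prop q l lo)) (\<lambda>_. 1)"
    using f by (intro integral_mono integrable_binomial_pmf p) auto
  moreover have "0 \<le> measure_pmf.expectation (binomial_pmf k (split_prop q l lo)) ?f"
    using f by (intro Bochner_Integration.integral_nonneg) auto
  ultimately show ?case by simp
qed simp

lemma gauss_tree_std:
  assumes "0 < bridge_sd \<tau> l lo"
  shows "gauss_tree \<tau> c b (Suc l) lo x z =
    (LINT w|std_normal_distribution. node_val \<tau> c b l lo x z (bridge_mean \<tau> l lo x z + bridge_sd \<tau> l lo * w))"
proof -
  let ?m = "bridge_mean \<tau> l lo x z" and ?sd = "bridge_sd \<tau> l lo"
  have [measurable]: "(\<lambda>w. node_val \<tau> c b l lo x z (?m + ?sd * w)) \<in> borel_measurable borel"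
    by (rule measurable_compose[OF _ node_val_measurable]) simp
  have "gauss_tree \<tau> c b (Suc l) lo x z = (LINT y|lborel. normal_density ?m ?sd y * node_val \<tau> c b l lo x z y)"
    by simp
  also have "\<dots> = ?sd * (LINT w|lborel. normal_density ?m ?sd (?m + ?sd * w) * node_val \<tau> c b l lo x z (?m + ?sd * w))"
    using lborel_integral_real_affine[of ?sd "\<lambda>y. normal_density ?m ?sd y * node_val \<tau> c b l lo x z y" ?m] assms by simp
  also have "\<dots> = (LINT w|lborel. std_normal_density w * node_val \<tau> c b l lo x z (?m + ?sd * w))"
  proof -
    have "?sd * normal_density ?m ?sd (?m + ?sd * w) = std_normal_density w" for w
      using assms by (simp add: normal_density_def std_normal_density_def real_sqrt_mult power_mult_distrib)
    then show ?thesis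
      by (subst integral_mult_right_zero[symmetric]) (simp only: mult.assoc[symmetric])
  qed
  also have "\<dots> = (LINT w|std_normal_distribution. node_val \<tau> c b l lo x z (?m + ?sd * w))"
    by (subst integral_density) auto
  finally show ?thesis .
qed

text \<open>
  The induction needs convergence along arbitrary sequences of counts whose rescaled deviations
  converge to \<open>x\<close> and \<open>z\<close>. At a node, the count at the splitting point is binomial, and its
  deviation is asymptotically normal with the mean and variance of the bridge; the children converge
  along every sequence of such counts by the induction hypothesis.
\<close>

theorem binom_tree_tendsto_gauss_tree:
  fixes N :: "nat \<Rightarrow> nat" and q :: "nat \<Rightarrow> nat \<Rightarrow> real" and c :: "nat \<Rightarrow> nat \<Rightarrow> real" and b :: "nat \<Rightarrow> real"
  assumes N: "filterlim N at_top sequentially" "\<And>n. 0 < N n"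
    and qmono: "\<And>n. mono_on {..L} (q n)" and \<tau>: "strict_mono_on {..L} \<tau>"
    and q: "\<And>i. i \<le> L \<Longrightarrow> (\<lambda>n. q n i) \<longlonglongrightarrow> \<tau> i"
    and c: "\<And>i. i < L \<Longrightarrow> 0 < i \<Longrightarrow> (\<lambda>n. c n i) \<longlonglongrightarrow> c' i" and b: "b \<longlonglongrightarrow> b'"
  defines "dev \<equiv> \<lambda>n i m. (real m - real (N n) * q n i) / sqrt (N n)"
  defines "A \<equiv> \<lambda>n i m. dev n i m \<in> band (c n i) (b n)"
  assumes "lo + 2 ^ l \<le> L"
    and "(\<lambda>n. dev n lo (m n)) \<longlonglongrightarrow> x" and "(\<lambda>n. dev n (lo + 2 ^ l) (m n + k n)) \<longlonglongrightarrow> z"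
  shows "(\<lambda>n. binom_tree (q n) (A n) l lo (m n) (k n)) \<longlonglongrightarrow> gauss_tree \<tau> c' b' l lo x z"
  using assms(10-)
proof (induction l arbitrary: lo m k x z)
  case 0
  then show ?case by simp
next
  case (Suc l)
  define mid where "mid = lo + 2 ^ l"
  define hi where "hi = lo + 2 ^ Suc l"
  have idx: "lo < mid" "mid < hi" "hi \<le> L" "hi = mid + 2 ^ l"
    using Suc.prems(1) by (auto simp: mid_def hi_def)
  define pr where "pr n = split_prop (q n) l lo" for n
  define \<sigma> where "\<sigma> = bridge_sd \<tau> l lo"
  define \<mu> where "\<mu> = bridge_mean \<tau> l lo x z"
  define pl where "pl = split_prop \<tau> l lo"
  have \<sigma>: "0 < \<sigma>" and pl: "0 < pl" "pl < 1"
    using split_prop_bounds[OF \<tau> Suc.prems(1)] by (auto simp: \<sigma>_def pl_def)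
  have pr01: "pr n \<in> {0..1}" for n
    unfolding pr_def by (rule split_prop_in_unit[OF qmono Suc.prems(1)])
  have \<tau>lt: "\<tau> lo < \<tau> mid" "\<tau> mid < \<tau> hi" "\<tau> lo < \<tau> hi"
    using idx by (auto intro!: strict_mono_onD[OF \<tau>])
  have q3: "(\<lambda>n. q n lo) \<longlonglongrightarrow> \<tau> lo" "(\<lambda>n. q n mid) \<longlonglongrightarrow> \<tau> mid" "(\<lambda>n. q n hi) \<longlonglongrightarrow> \<tau> hi"
    using idx by (auto intro!: q)
  have pr_lim: "pr \<longlonglongrightarrow> pl"
    unfolding pr_def pl_def using q3 \<tau>lt by (intro tendsto_intros) (auto simp: mid_def hi_def)
  define rN where "rN n = sqrt (real (N n))" for n
  have rN: "0 < rN n" "rN n * rN n = real (N n)" for n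
    using N(2)[of n] by (auto simp: rN_def)
  have rN_lim: "filterlim rN at_top sequentially"
    unfolding rN_def by (intro filterlim_compose[OF sqrt_at_top] filterlim_compose[OF filterlim_real_sequentially] N)
  have inv_lim: "(\<lambda>n. 1 / rN n) \<longlonglongrightarrow> 0"
    using tendsto_divide_0[OF tendsto_const, of rN sequentially 1] filterlim_at_top_imp_at_infinity[OF rN_lim] by simp
  define xn where "xn n = dev n lo (m n)" for n
  define zn where "zn n = dev n hi (m n + k n)" for n
  have xz: "xn \<longlonglongrightarrow> x" "zn \<longlonglongrightarrow> z"
    using Suc.prems(2,3) by (auto simp: xn_def[abs_def] zn_def[abs_def] hi_def)
  have dev_eq: "real w = real (N n) * q n i + rN n * dev n i w" for w n i
    using rN[of n] by (simp add: dev_def rN_def)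
  have k_eq: "real (k n) = real (N n) * (q n hi - q n lo) + rN n * (zn n - xn n)" for n
    using dev_eq[of "m n + k n" n hi] dev_eq[of "m n" n lo] by (simp add: xn_def zn_def algebra_simps)
  have k_lim: "(\<lambda>n. real (k n) / real (N n)) \<longlonglongrightarrow> \<tau> hi - \<tau> lo"
  proof -
    have "real (k n) / real (N n) = (q n hi - q n lo) + (1 / rN n) * (zn n - xn n)" for n
      unfolding k_eq rN(2)[symmetric] using rN(1)[of n] by (simp add: field_simps)
    then have "(\<lambda>n. real (k n) / real (N n)) = (\<lambda>n. (q n hi - q n lo) + (1 / rN n) * (zn n - xn n))" by simp
    moreover have "(\<lambda>n. (q n hi - q n lo) + (1 / rN n) * (zn n - xn n)) \<longlonglongrightarrow> (\<tau> hi - \<tau> lo) + 0 * (z - x)"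
      by (intro tendsto_intros q3 inv_lim xz)
    ultimately show ?thesis by simp
  qed
  define s where "s n = 1 / (rN n * \<sigma>)" for n
  define a where "a n = ((real (m n) - real (N n) * q n mid) / rN n - \<mu>) / \<sigma>" for n
  have point: "a n + real j * s n = (dev n mid (m n + j) - \<mu>) / \<sigma>" for n j
    using \<sigma> rN(1)[of n] by (simp add: a_def s_def dev_def rN_def[symmetric] field_simps)
  have sq: "(s n)\<^sup>2 = 1 / real (N n) / \<sigma>\<^sup>2" for n
    unfolding s_def rN(2)[symmetric] by (simp add: power2_eq_square)
  have \<sigma>2: "\<sigma>\<^sup>2 = (\<tau> hi - \<tau> lo) * (pl * (1 - pl))"
  proof -
    have "0 \<le> (\<tau> hi - \<tau> lo) * pl * (1 - pl)"
      using \<tau>lt pl by simp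
    moreover have "\<sigma> = sqrt ((\<tau> hi - \<tau> lo) * pl * (1 - pl))"
      by (simp add: \<sigma>_def bridge_sd_def pl_def hi_def)
    ultimately show ?thesis by (simp add: mult.assoc)
  qed
  have wc: "weak_conv_m (\<lambda>n. distr (measure_pmf (binomial_pmf (k n) (pr n))) borel (\<lambda>j. a n + real j * s n)) std_normal_distribution"
  proof (rule scaled_binomial_weak_conv[OF pr01])
    have "(\<lambda>n. (1 / rN n) * (1 / \<sigma>)) \<longlonglongrightarrow> 0 * (1 / \<sigma>)"
      by (intro tendsto_intros inv_lim)
    then show "s \<longlonglongrightarrow> 0" by (simp add: s_def[abs_def])
    have "(\<lambda>n. real (k n) / real (N n) / \<sigma>\<^sup>2) \<longlonglongrightarrow> (\<tau> hi - \<tau> lo) / \<sigma>\<^sup>2"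
      using \<sigma> by (intro tendsto_intros k_lim) auto
    then show ks: "(\<lambda>n. real (k n) * (s n)\<^sup>2) \<longlonglongrightarrow> (\<tau> hi - \<tau> lo) / \<sigma>\<^sup>2" by (simp add: sq)
    have "(\<lambda>n. real (k n) * (s n)\<^sup>2 * (pr n * (1 - pr n))) \<longlonglongrightarrow> (\<tau> hi - \<tau> lo) / \<sigma>\<^sup>2 * (pl * (1 - pl))"
      by (intro tendsto_intros ks pr_lim)
    moreover have "(\<tau> hi - \<tau> lo) / \<sigma>\<^sup>2 * (pl * (1 - pl)) = 1"
      unfolding \<sigma>2 using pl \<tau>lt by simp
    ultimately show "(\<lambda>n. real (k n) * (s n)\<^sup>2 * (pr n * (1 - pr n))) \<longlonglongrightarrow> 1" by (simp only:)
    have "\<forall>\<^sub>F n in sequentially. 0 < q n hi - q n lo"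
      by (rule order_tendstoD(1)[of _ "\<tau> hi - \<tau> lo"]) (use \<tau>lt q3 in \<open>auto intro!: tendsto_intros\<close>)
    then have ev: "\<forall>\<^sub>F n in sequentially. (xn n + pr n * (zn n - xn n) - \<mu>) / \<sigma> = a n + real (k n) * pr n * s n"
    proof eventually_elim
      case (elim n)
      have prq: "pr n * (q n hi - q n lo) = q n mid - q n lo"
        using elim by (simp add: pr_def mid_def hi_def)
      have "real (m n) + real (k n) * pr n - real (N n) * q n mid
        = real (N n) * (q n lo + pr n * (q n hi - q n lo) - q n mid) + rN n * (xn n + pr n * (zn n - xn n))"
        unfolding k_eq dev_eq[of "m n" n lo] xn_def[symmetric] by (simp add: algebra_simps)
      also have "\<dots> = rN n * (xn n + pr n * (zn n - xn n))" unfolding prq by simp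
      finally have e: "real (m n) - real (N n) * q n mid = rN n * (xn n + pr n * (zn n - xn n)) - real (k n) * pr n" by simp
      show ?case
        unfolding a_def s_def e using rN(1)[of n] \<sigma> by (simp add: field_simps)
    qed
    have "(\<lambda>n. (xn n + pr n * (zn n - xn n) - \<mu>) / \<sigma>) \<longlonglongrightarrow> (x + pl * (z - x) - \<mu>) / \<sigma>"
      using \<sigma> by (intro tendsto_intros xz pr_lim) auto
    moreover have "x + pl * (z - x) - \<mu> = 0" by (simp add: \<mu>_def pl_def bridge_mean_def)
    ultimately show "(\<lambda>n. a n + real (k n) * pr n * s n) \<longlonglongrightarrow> 0"
      using Lim_transform_eventually[OF _ ev] by simp
  qed
  \<comment> \<open>Recovers the binomial count from the standardised value; off the lattice the result is arbitrary.\<close>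
  define jj where "jj n w = nat (round ((w - a n) / s n))" for n and w :: real
  have s_pos: "0 < s n" for n using rN(1)[of n] \<sigma> by (simp add: s_def)
  have jj: "jj n (a n + real j * s n) = j" for n j
    using s_pos[of n] by (simp add: jj_def)
  define g where "g n j = of_bool (A n mid (m n + j)) * (binom_tree (q n) (A n) l lo (m n) j * binom_tree (q n) (A n) l mid (m n + j) (k n - j))" for n j
  have g01: "\<bar>g n j\<bar> \<le> 1" for n j
    using binom_tree_bounds[OF qmono[of n], of lo l "A n" "m n" j] binom_tree_bounds[OF qmono[of n], of mid l "A n" "m n + j" "k n - j"] idx
    by (auto simp: g_def abs_mult intro!: mult_le_one)
  have "(\<lambda>n. integral\<^sup>L (distr (measure_pmf (binomial_pmf (k n) (pr n))) borel (\<lambda>j. a n + real j * s n)) (\<lambda>w. g n (jj n w)))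
    \<longlonglongrightarrow> (LINT w|std_normal_distribution. node_val \<tau> c' b' l lo x z (\<mu> + \<sigma> * w))"
  proof (rule integral_tendsto_of_continuous_convergence[OF _ real_dist_normal_dist wc, where S = "\<lambda>n. (\<lambda>j. a n + real j * s n) ` {..k n}" and B = 1])
    show "real_distribution (distr (measure_pmf (binomial_pmf (k n) (pr n))) borel (\<lambda>j. a n + real j * s n))" for n
      by (intro prob_space.real_distribution_distr[OF measure_pmf.prob_space_axioms]) auto
    show "(\<lambda>w. g n (jj n w)) \<in> borel_measurable borel" for n
    proof -
      have "jj n \<in> measurable borel (count_space UNIV)"
        unfolding jj_def[abs_def] round_def by measurable
      then show ?thesis by (rule measurable_compose) simp
    qed
    show "(\<lambda>w. node_val \<tau> c' b' l lo x z (\<mu> + \<sigma> * w)) \<in> borel_measurable borel"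
      by (rule measurable_compose[OF _ node_val_measurable]) simp
    show "\<bar>g n (jj n w)\<bar> \<le> 1" for n w by (rule g01)
    show "AE w in distr (measure_pmf (binomial_pmf (k n) (pr n))) borel (\<lambda>j. a n + real j * s n). w \<in> (\<lambda>j. a n + real j * s n) ` {..k n}" for n
    proof (subst AE_distr_iff)
      show "AE j in measure_pmf (binomial_pmf (k n) (pr n)). a n + real j * s n \<in> (\<lambda>j. a n + real j * s n) ` {..k n}"
        using set_pmf_binomial_eq[of "pr n" "k n"] pr01[of n] by (auto simp: AE_measure_pmf_iff split: if_splits)
      show "{w \<in> space borel. w \<in> (\<lambda>j. a n + real j * s n) ` {..k n}} \<in> sets borel"
        by (simp add: borel_closed finite_imp_closed)
    qed simp
    \<comment> \<open>The limit of the indicators may fail only at the two boundary points of the band.\<close>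
    have "AE w in lborel. w \<noteq> (b' - c' mid - \<mu>) / \<sigma> \<and> w \<noteq> (- b' - c' mid - \<mu>) / \<sigma>"
      using AE_lborel_singleton[of "(b' - c' mid - \<mu>) / \<sigma>"] AE_lborel_singleton[of "(- b' - c' mid - \<mu>) / \<sigma>"]
      by eventually_elim auto
    then have "AE w in std_normal_distribution. w \<noteq> (b' - c' mid - \<mu>) / \<sigma> \<and> w \<noteq> (- b' - c' mid - \<mu>) / \<sigma>"
      by (subst AE_density) auto
    then show "AE w in std_normal_distribution. \<forall>ws. (\<forall>n. ws n \<in> (\<lambda>j. a n + real j * s n) ` {..k n}) \<longrightarrow> ws \<longlonglongrightarrow> w \<longrightarrow>
        (\<lambda>n. g n (jj n (ws n))) \<longlonglongrightarrow> node_val \<tau> c' b' l lo x z (\<mu> + \<sigma> * w)"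
    proof (eventually_elim, intro allI impI)
      fix w ws assume w: "w \<noteq> (b' - c' mid - \<mu>) / \<sigma> \<and> w \<noteq> (- b' - c' mid - \<mu>) / \<sigma>"
        and ws: "\<forall>n. ws n \<in> (\<lambda>j. a n + real j * s n) ` {..k n}" "ws \<longlonglongrightarrow> w"
      define j where "j n = jj n (ws n)" for n
      have j: "j n \<le> k n" "ws n = a n + real (j n) * s n" for n
      proof -
        obtain i where "i \<le> k n" "ws n = a n + real i * s n"
          using ws(1) by blast
        then show "j n \<le> k n" "ws n = a n + real (j n) * s n"
          using jj[of n i] by (simp_all add: j_def)
      qed
      define y where "y = \<mu> + \<sigma> * w"
      have "dev n mid (m n + j n) = \<mu> + \<sigma> * ws n" for n
        using j(2)[of n] point[of n "j n"] \<sigma> by (simp add: field_simps)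
      then have ylim: "(\<lambda>n. dev n mid (m n + j n)) \<longlonglongrightarrow> y"
        unfolding y_def by (simp only:) (intro tendsto_intros ws)
      have L: "(\<lambda>n. binom_tree (q n) (A n) l lo (m n) (j n)) \<longlonglongrightarrow> gauss_tree \<tau> c' b' l lo x y"
        using Suc.prems idx ylim by (intro Suc.IH) (auto simp: mid_def)
      have R: "(\<lambda>n. binom_tree (q n) (A n) l mid (m n + j n) (k n - j n)) \<longlonglongrightarrow> gauss_tree \<tau> c' b' l mid y z"
      proof (rule Suc.IH)
        show "mid + 2 ^ l \<le> L" using idx by simp
        show "(\<lambda>n. dev n mid (m n + j n)) \<longlonglongrightarrow> y" by (rule ylim)
        have "(\<lambda>n. dev n (mid + 2 ^ l) (m n + k n)) \<longlonglongrightarrow> z"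
          using Suc.prems(3) unfolding hi_def[symmetric] idx(4) .
        then show "(\<lambda>n. dev n (mid + 2 ^ l) (m n + j n + (k n - j n))) \<longlonglongrightarrow> z"
          using j(1) by simp
      qed
      have cl: "(\<lambda>n. \<bar>dev n mid (m n + j n) + c n mid\<bar> - b n) \<longlonglongrightarrow> \<bar>y + c' mid\<bar> - b'"
        using idx(1-3) by (intro tendsto_intros ylim c b) auto
      have ne: "\<bar>y + c' mid\<bar> \<noteq> b'"
      proof
        assume "\<bar>y + c' mid\<bar> = b'"
        then have "y + c' mid = b' \<or> y + c' mid = - b'" by linarith
        then show False using w \<sigma> by (auto simp: y_def field_simps)
      qed
      have I: "(\<lambda>n. of_bool (A n mid (m n + j n)) :: real) \<longlonglongrightarrow> indicator (band (c' mid) b') y"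
      proof (cases "\<bar>y + c' mid\<bar> < b'")
        case True
        then have "\<forall>\<^sub>F n in sequentially. \<bar>dev n mid (m n + j n) + c n mid\<bar> - b n < 0"
          using order_tendstoD(2)[OF cl, of 0] by simp
        then have "\<forall>\<^sub>F n in sequentially. of_bool (A n mid (m n + j n)) = (1 :: real)"
          by eventually_elim (auto simp: A_def band_def)
        then show ?thesis using True by (simp add: band_def tendsto_eventually)
      next
        case False
        then have "\<forall>\<^sub>F n in sequentially. 0 < \<bar>dev n mid (m n + j n) + c n mid\<bar> - b n"
          using order_tendstoD(1)[OF cl, of 0] ne by simp
        then have "\<forall>\<^sub>F n in sequentially. of_bool (A n mid (m n + j n)) = (0 :: real)"
          by eventually_elim (auto simp: A_def band_def)
        then show ?thesis using False ne by (simp add: band_def tendsto_eventually)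
      qed
      show "(\<lambda>n. g n (jj n (ws n))) \<longlonglongrightarrow> node_val \<tau> c' b' l lo x z (\<mu> + \<sigma> * w)"
        unfolding g_def j_def[symmetric] y_def[symmetric] mid_def[symmetric]
        by (intro tendsto_mult I L R)
    qed
  qed
  moreover have "integral\<^sup>L (distr (measure_pmf (binomial_pmf (k n) (pr n))) borel (\<lambda>j. a n + real j * s n)) (\<lambda>w. g n (jj n w))
      = binom_tree (q n) (A n) (Suc l) lo (m n) (k n)" for n
  proof -
    have "jj n \<in> measurable borel (count_space UNIV)"
      unfolding jj_def[abs_def] round_def by measurable
    then have "(\<lambda>w. g n (jj n w)) \<in> borel_measurable borel" by (rule measurable_compose) simp
    then show ?thesis
      by (subst integral_distr) (auto simp: jj g_def pr_def mid_def)
  qed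
  ultimately show ?case
    using gauss_tree_std[of \<tau> l lo c' b' x z] \<sigma> by (simp only: \<sigma>_def \<mu>_def)
qed

section \<open>Grid counts of a sample as a binomial tree\<close>

lemma sum_Pow_by_card:
  fixes \<phi> :: "nat \<Rightarrow> real"
  assumes "finite J"
  shows "(\<Sum>S\<in>Pow J. \<phi> (card S)) = (\<Sum>j\<le>card J. real (card J choose j) * \<phi> j)"
proof -
  have "(\<Sum>S\<in>Pow J. \<phi> (card S)) = (\<Sum>j\<in>{..card J}. \<Sum>S\<in>{S \<in> Pow J. card S = j}. \<phi> (card S))"
    using assms by (intro sum.group[symmetric]) (auto intro: card_mono)
  also have "\<dots> = (\<Sum>j\<le>card J. real (card J choose j) * \<phi> j)"
  proof (intro sum.cong refl)
    fix j
    have "{S \<in> Pow J. card S = j} = {S. S \<subseteq> J \<and> card S = j}" by auto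
    then show "(\<Sum>S\<in>{S \<in> Pow J. card S = j}. \<phi> (card S)) = real (card J choose j) * \<phi> j"
      using n_subsets[OF assms, of j] by simp
  qed
  finally show ?thesis .
qed

text \<open>
  The sum runs over all assignments of the sample points in \<open>J\<close> to the leaves of a node; \<open>w\<close> gives
  the probabilities of the leaves, not normalised to the node.
\<close>

definition cell_sum :: "(nat \<Rightarrow> real) \<Rightarrow> (nat \<Rightarrow> nat \<Rightarrow> bool) \<Rightarrow> nat \<Rightarrow> nat \<Rightarrow> nat \<Rightarrow> 'a set \<Rightarrow> real" where
  "cell_sum w A l lo m J =
     (\<Sum>f\<in>(J \<rightarrow>\<^sub>E {lo..<lo + 2 ^ l}).
        of_bool (\<forall>i\<in>{lo<..<lo + 2 ^ l}. A i (m + card {x \<in> J. f x < i})) * (\<Prod>x\<in>J. w (f x)))"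

text \<open>
  An assignment is determined by the set \<open>S\<close> of points in the left child together with an
  assignment of \<open>S\<close> to the left leaves and one of \<open>J - S\<close> to the right leaves.
\<close>

lemma cell_sum_Suc:
  assumes "finite J"
  shows "cell_sum w A (Suc l) lo m J =
    (\<Sum>S\<in>Pow J. of_bool (A (lo + 2 ^ l) (m + card S)) *
       (cell_sum w A l lo m S * cell_sum w A l (lo + 2 ^ l) (m + card S) (J - S)))"
proof -
  define mid where "mid = lo + 2 ^ l"
  define hi where "hi = lo + 2 ^ Suc l"
  have ord: "lo < mid" "mid < hi" "hi = mid + 2 ^ l" by (auto simp: mid_def hi_def)
  define W where "W f = of_bool (\<forall>i\<in>{lo<..<hi}. A i (m + card {x \<in> J. f x < i})) * (\<Prod>x\<in>J. w (f x))" for f :: "'a \<Rightarrow> nat"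
  have fin: "finite (J \<rightarrow>\<^sub>E {lo..<hi})" using assms by (intro finite_PiE) auto
  have "cell_sum w A (Suc l) lo m J = sum W (J \<rightarrow>\<^sub>E {lo..<hi})"
    by (simp add: cell_sum_def W_def hi_def)
  also have "\<dots> = (\<Sum>S\<in>Pow J. \<Sum>f\<in>{f \<in> J \<rightarrow>\<^sub>E {lo..<hi}. {x \<in> J. f x < mid} = S}. W f)"
    using fin assms by (intro sum.group[symmetric]) auto
  also have "\<dots> = (\<Sum>S\<in>Pow J. of_bool (A mid (m + card S)) * (cell_sum w A l lo m S * cell_sum w A l mid (m + card S) (J - S)))"
  proof (intro sum.cong refl)
    fix S assume "S \<in> Pow J"
    then have S: "S \<subseteq> J" "finite S" "finite (J - S)" using assms finite_subset by auto
    define W1 where "W1 f = of_bool (\<forall>i\<in>{lo<..<mid}. A i (m + card {x \<in> S. f x < i})) * (\<Prod>x\<in>S. w (f x))" for f :: "'a \<Rightarrow> nat"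
    define W2 where "W2 f = of_bool (\<forall>i\<in>{mid<..<hi}. A i (m + card S + card {x \<in> J - S. f x < i})) * (\<Prod>x\<in>J - S. w (f x))" for f :: "'a \<Rightarrow> nat"
    have "(\<Sum>f\<in>{f \<in> J \<rightarrow>\<^sub>E {lo..<hi}. {x \<in> J. f x < mid} = S}. W f)
      = (\<Sum>(f, g)\<in>(S \<rightarrow>\<^sub>E {lo..<mid}) \<times> ((J - S) \<rightarrow>\<^sub>E {mid..<hi}). of_bool (A mid (m + card S)) * (W1 f * W2 g))"
    proof (rule sum.reindex_bij_witness[where i = "\<lambda>(f, g) x. if x \<in> S then f x else g x" and j = "\<lambda>f. (restrict f S, restrict f (J - S))"])
      fix f assume f: "f \<in> {f \<in> J \<rightarrow>\<^sub>E {lo..<hi}. {x \<in> J. f x < mid} = S}"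
      then have lt: "x \<in> S \<longleftrightarrow> x \<in> J \<and> f x < mid" for x by auto
      show "(case (restrict f S, restrict f (J - S)) of (f, g) \<Rightarrow> \<lambda>x. if x \<in> S then f x else g x) = f"
        using f S(1) by (auto simp: fun_eq_iff PiE_def extensional_def)
      show "(restrict f S, restrict f (J - S)) \<in> (S \<rightarrow>\<^sub>E {lo..<mid}) \<times> ((J - S) \<rightarrow>\<^sub>E {mid..<hi})"
        using f lt S(1) by (auto simp: PiE_def Pi_def not_less) 
      have split: "card {x \<in> J. f x < i} = card {x \<in> S. f x < i} + card {x \<in> J - S. f x < i}" for i
      proof -
        have "{x \<in> J. f x < i} = {x \<in> S. f x < i} \<union> {x \<in> J - S. f x < i}" using S(1) by auto
        then show ?thesis using S by (simp add: card_Un_disjoint disjoint_iff)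
      qed
      have c1: "card {x \<in> J. f x < i} = card {x \<in> S. f x < i}" if "i \<le> mid" for i
      proof -
        have "\<not> f x < i" if "x \<in> J - S" for x
          using that lt[of x] \<open>i \<le> mid\<close> by simp linarith
        then have "{x \<in> J - S. f x < i} = {}" by blast
        then show ?thesis using split[of i] by (simp only: card.empty add_0_right)
      qed
      have c2: "card {x \<in> J. f x < i} = card S + card {x \<in> J - S. f x < i}" if "mid \<le> i" for i
      proof -
        have "{x \<in> S. f x < i} = S"
        proof (intro set_eqI iffI)
          fix x assume "x \<in> S"
          then have "f x < mid" using lt by blast
          then show "x \<in> {x \<in> S. f x < i}" using \<open>x \<in> S\<close> that by simp
        qed simp
        then show ?thesis using split[of i] by simp
      qed
      have c3: "card {x \<in> J. f x < mid} = card S" using f by simp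
      have cond: "(\<forall>i\<in>{lo<..<hi}. A i (m + card {x \<in> J. f x < i})) \<longleftrightarrow>
         A mid (m + card S) \<and> (\<forall>i\<in>{lo<..<mid}. A i (m + card {x \<in> S. f x < i})) \<and>
         (\<forall>i\<in>{mid<..<hi}. A i (m + card S + card {x \<in> J - S. f x < i}))" (is "?L \<longleftrightarrow> ?R")
      proof -
        have sets: "{lo<..<hi} = insert mid ({lo<..<mid} \<union> {mid<..<hi})" using ord(1,2) by auto
        have "?L \<longleftrightarrow> A mid (m + card {x \<in> J. f x < mid}) \<and> (\<forall>i\<in>{lo<..<mid}. A i (m + card {x \<in> J. f x < i})) \<and>
         (\<forall>i\<in>{mid<..<hi}. A i (m + card {x \<in> J. f x < i}))"
          unfolding sets by blast
        then show ?thesis by (simp add: c1 c2 c3 add.assoc)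
      qed
      have pr: "(\<Prod>x\<in>J. w (f x)) = (\<Prod>x\<in>S. w (f x)) * (\<Prod>x\<in>J - S. w (f x))"
        using prod.subset_diff[OF S(1) assms, of "\<lambda>x. w (f x)"] by (simp add: mult.commute)
      have r1: "{x \<in> S. restrict f S x < i} = {x \<in> S. f x < i}" for i by auto
      have r2: "{x \<in> J - S. restrict f (J - S) x < i} = {x \<in> J - S. f x < i}" for i by auto
      have e1: "W1 (restrict f S) = W1 f"
        unfolding W1_def r1 by simp
      have e2: "W2 (restrict f (J - S)) = W2 f"
        unfolding W2_def r2 by simp
      show "(case (restrict f S, restrict f (J - S)) of (f, g) \<Rightarrow> of_bool (A mid (m + card S)) * (W1 f * W2 g)) = W f"
        by (simp only: prod.case e1 e2) (simp add: W_def W1_def W2_def cond pr)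
    next
      fix h assume "h \<in> (S \<rightarrow>\<^sub>E {lo..<mid}) \<times> ((J - S) \<rightarrow>\<^sub>E {mid..<hi})"
      then obtain f g where h: "h = (f, g)" and f: "f \<in> S \<rightarrow>\<^sub>E {lo..<mid}" and g: "g \<in> (J - S) \<rightarrow>\<^sub>E {mid..<hi}" by auto
      show "(restrict (case h of (f, g) \<Rightarrow> \<lambda>x. if x \<in> S then f x else g x) S,
          restrict (case h of (f, g) \<Rightarrow> \<lambda>x. if x \<in> S then f x else g x) (J - S)) = h"
        using f g by (auto simp: h fun_eq_iff PiE_def extensional_def)
      have F: "f x \<in> {lo..<mid}" if "x \<in> S" for x using f that by auto
      have G: "g x \<in> {mid..<hi}" if "x \<in> J" "x \<notin> S" for x using g that by auto
      have "{x \<in> J. (if x \<in> S then f x else g x) < mid} = S"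
      proof (intro set_eqI iffI)
        fix x assume "x \<in> {x \<in> J. (if x \<in> S then f x else g x) < mid}"
        then show "x \<in> S" using G[of x] by (auto split: if_splits)
      next
        fix x assume "x \<in> S"
        then show "x \<in> {x \<in> J. (if x \<in> S then f x else g x) < mid}" using F[of x] S(1) by auto
      qed
      moreover have "(\<lambda>x. if x \<in> S then f x else g x) \<in> J \<rightarrow>\<^sub>E {lo..<hi}"
      proof (rule PiE_I)
        fix x assume "x \<in> J"
        then show "(if x \<in> S then f x else g x) \<in> {lo..<hi}" using F[of x] G[of x] ord(1,2) by auto
      next
        fix x assume "x \<notin> J"
        then show "(if x \<in> S then f x else g x) = undefined" using S(1) g by (auto simp: PiE_def extensional_def)
      qed
      ultimately show "(case h of (f, g) \<Rightarrow> \<lambda>x. if x \<in> S then f x else g x) \<in> {f \<in> J \<rightarrow>\<^sub>E {lo..<hi}. {x \<in> J. f x < mid} = S}"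
        by (simp add: h)
    qed
    also have "\<dots> = of_bool (A mid (m + card S)) * (sum W1 (S \<rightarrow>\<^sub>E {lo..<mid}) * sum W2 ((J - S) \<rightarrow>\<^sub>E {mid..<hi}))"
      by (simp only: sum.cartesian_product[symmetric] sum_distrib_left[symmetric] sum_distrib_right[symmetric])
    also have "\<dots> = of_bool (A mid (m + card S)) * (cell_sum w A l lo m S * cell_sum w A l mid (m + card S) (J - S))"
      unfolding cell_sum_def W1_def W2_def mid_def[symmetric] ord(3)[symmetric] by simp
    finally show "(\<Sum>f\<in>{f \<in> J \<rightarrow>\<^sub>E {lo..<hi}. {x \<in> J. f x < mid} = S}. W f)
      = of_bool (A mid (m + card S)) * (cell_sum w A l lo m S * cell_sum w A l mid (m + card S) (J - S))" .
  qed
  finally show ?thesis by (simp add: mid_def)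
qed

text \<open>
  The summand for \<open>S\<close> depends on \<open>card S\<close> only, so the sum over \<open>S\<close> becomes a binomial expectation
  once the probabilities of the children are normalised by that of the node.
\<close>

lemma cell_sum_eq_binom_tree:
  assumes "finite J" and w: "\<And>j. 0 \<le> w j" and q: "\<And>i. i < N \<Longrightarrow> q (Suc i) = q i + w i" and "lo + 2 ^ l \<le> N"
  shows "cell_sum w A l lo m J = (q (lo + 2 ^ l) - q lo) ^ card J * binom_tree q A l lo m (card J)"
  using assms(1,4)
proof (induction l arbitrary: lo m J)
  case 0
  have s: "J \<rightarrow>\<^sub>E {lo} = {restrict (\<lambda>_. lo) J}"
    by (auto simp: PiE_def extensional_def fun_eq_iff)
  have "{lo..<Suc lo} = {lo}" "{lo<..<Suc lo} = {}" by auto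
  then have "cell_sum w A 0 lo m J = (\<Prod>x\<in>J. w lo)"
    by (simp add: cell_sum_def s)
  then show ?case using q[of lo] 0 by simp
next
  case (Suc l)
  define mid where "mid = lo + 2 ^ l"
  define hi where "hi = lo + 2 ^ Suc l"
  have ord: "hi = mid + 2 ^ l" "hi \<le> N" "mid \<le> N" using Suc.prems by (auto simp: mid_def hi_def)
  have qmono: "q i \<le> q (i + d)" if "i + d \<le> N" for i d
    using that
  proof (induction d)
    case (Suc d)
    then show ?case using q[of "i + d"] w[of "i + d"] by simp
  qed simp
  define a where "a = q mid - q lo"
  define c where "c = q hi - q mid"
  have ac: "0 \<le> a" "0 \<le> c" "q hi - q lo = a + c"
    using qmono[of lo "2 ^ l"] qmono[of mid "2 ^ l"] ord by (auto simp: a_def c_def mid_def)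
  define k where "k = card J"
  define G where "G j = of_bool (A mid (m + j)) * (binom_tree q A l lo m j * binom_tree q A l mid (m + j) (k - j))" for j
  have "cell_sum w A (Suc l) lo m J = (\<Sum>S\<in>Pow J. a ^ card S * c ^ (k - card S) * G (card S))"
    unfolding cell_sum_Suc[OF Suc.prems(1)] mid_def[symmetric]
  proof (intro sum.cong refl)
    fix S assume S: "S \<in> Pow J"
    then have fS: "finite S" "finite (J - S)"
      using Suc.prems(1) finite_subset by auto
    have fS3: "card (J - S) = k - card S"
      using card_Diff_subset[OF fS(1)] S by (simp add: k_def)
    have "cell_sum w A l lo m S = a ^ card S * binom_tree q A l lo m (card S)"
      using Suc.IH[OF fS(1), of lo m] ord by (simp add: a_def mid_def)
    moreover have "cell_sum w A l mid (m + card S) (J - S) = c ^ (k - card S) * binom_tree q A l mid (m + card S) (k - card S)"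
      using Suc.IH[OF fS(2), of mid "m + card S"] ord by (simp add: c_def fS3)
    ultimately show "of_bool (A mid (m + card S)) * (cell_sum w A l lo m S * cell_sum w A l mid (m + card S) (J - S)) =
         a ^ card S * c ^ (k - card S) * G (card S)"
      by (simp add: G_def)
  qed
  also have "\<dots> = (\<Sum>j\<le>k. real (k choose j) * (a ^ j * c ^ (k - j) * G j))"
    unfolding k_def by (rule sum_Pow_by_card[OF Suc.prems(1)])
  \<comment> \<open>In a node of probability 0 the fraction is 0 by convention; then both sides vanish unless \<open>k = 0\<close>.\<close>
  also have "\<dots> = (a + c) ^ k * (\<Sum>j\<le>k. real (k choose j) * (a / (a + c)) ^ j * (1 - a / (a + c)) ^ (k - j) * G j)"
  proof (cases "a + c = 0")
    case True
    then have "a = 0" "c = 0" using ac by auto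
    then show ?thesis
      by (cases "k = 0") (auto intro!: sum.neutral simp: power_0_left)
  next
    case False
    have "1 - a / (a + c) = c / (a + c)" using False by (simp add: field_simps)
    then show ?thesis
      unfolding sum_distrib_left
    proof (intro sum.cong refl)
      fix j assume "1 - a / (a + c) = c / (a + c)" "j \<in> {..k}"
      then have "(a + c) ^ k = (a + c) ^ j * (a + c) ^ (k - j)" by (simp flip: power_add)
      then have "(a + c) ^ k * ((a / (a + c)) ^ j * (c / (a + c)) ^ (k - j)) = a ^ j * c ^ (k - j)"
        using False by (simp add: power_divide)
      then show "real (k choose j) * (a ^ j * c ^ (k - j) * G j) = (a + c) ^ k * (real (k choose j) * (a / (a + c)) ^ j * (1 - a / (a + c)) ^ (k - j) * G j)"
        unfolding \<open>1 - a / (a + c) = c / (a + c)\<close> by (simp add: mult_ac)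
    qed
  qed
  also have "\<dots> = (q hi - q lo) ^ k * binom_tree q A (Suc l) lo m k"
  proof -
    have sp: "split_prop q l lo = a / (a + c)" using ac(3) by (simp add: a_def mid_def hi_def)
    have p: "a / (a + c) \<in> {0..1}" using ac by (auto simp: divide_le_eq)
    have "binom_tree q A (Suc l) lo m k = measure_pmf.expectation (binomial_pmf k (a / (a + c))) G"
      by (simp only: binom_tree.simps sp) (simp only: G_def[abs_def] mid_def)
    then show ?thesis
      using expectation_binomial_pmf'[OF p, of k G] ac(3) by simp
  qed
  finally show ?case by (simp add: hi_def k_def)
qed

text \<open>
  The counts at the grid points depend on the sample only through the cells into which its points
  fall, and these are independent. The value of \<open>q\<close> at index 0 is 0 even if the law has mass below
  or at the first grid point: the first cell extends to minus infinity, and the last one to plus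
  infinity.
\<close>

theorem grid_event_prob_eq_binom_tree:
  fixes \<mu> :: "real measure" and t :: "nat \<Rightarrow> real" and n L :: nat
  assumes \<mu>: "real_distribution \<mu>" and t: "strict_mono_on {0<..<2 ^ L} t"
  defines "q \<equiv> \<lambda>i. if i = 0 then 0 else if i < 2 ^ L then cdf \<mu> (t i) else 1"
  shows "measure (\<Pi>\<^sub>M i\<in>{1..n}. \<mu>) {X \<in> space (\<Pi>\<^sub>M i\<in>{1..n}. \<mu>). \<forall>i\<in>{0<..<2 ^ L}. A i (card {k \<in> {1..n}. X k \<le> t i})}
    = binom_tree q A L 0 0 n"
proof -
  interpret real_distribution \<mu> by fact
  interpret P: product_prob_space "\<lambda>_::nat. \<mu>" "{1..n}" by unfold_locales
  define M :: nat where "M = 2 ^ L"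
  define cell where "cell x = card {i \<in> {0<..<M}. t i < x}" for x
  have cell_less: "cell x < M" for x
  proof -
    have "cell x \<le> card {0<..<M}" unfolding cell_def by (intro card_mono) auto
    then have "cell x \<le> M - 1" by simp
    moreover have "0 < M" by (simp add: M_def)
    ultimately show ?thesis by linarith
  qed
  have cell_iff: "cell x < i \<longleftrightarrow> x \<le> t i" if i: "i \<in> {0<..<M}" for x i
  proof
    assume "x \<le> t i"
    have "{j \<in> {0<..<M}. t j < x} \<subseteq> {0<..<i}"
    proof
      fix j assume "j \<in> {j \<in> {0<..<M}. t j < x}"
      then have "j \<in> {0<..<M}" "t j < t i" using \<open>x \<le> t i\<close> by auto
      then show "j \<in> {0<..<i}" using strict_mono_on_less[OF t, of j i] i by (auto simp: M_def)
    qed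
    then have "cell x \<le> card {0<..<i}" unfolding cell_def by (intro card_mono) auto
    also have "\<dots> < i" using i by simp
    finally show "cell x < i" .
  next
    assume "cell x < i"
    show "x \<le> t i"
    proof (rule ccontr)
      assume "\<not> x \<le> t i"
      have "{0<..i} \<subseteq> {j \<in> {0<..<M}. t j < x}"
      proof
        fix j assume j: "j \<in> {0<..i}"
        then have "t j \<le> t i" using strict_mono_on_leD[OF t, of j i] i by (auto simp: M_def)
        then show "j \<in> {j \<in> {0<..<M}. t j < x}" using \<open>\<not> x \<le> t i\<close> i j by auto
      qed
      then have "card {0<..i} \<le> cell x" unfolding cell_def by (intro card_mono) auto
      then show False using \<open>cell x < i\<close> by simp
    qed
  qed
  have cell_meas[measurable, simp]: "{x. cell x = j} \<in> sets borel" for j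
  proof -
    have "cell \<in> measurable borel (count_space UNIV)"
      unfolding cell_def[abs_def] by (rule measurable_card) auto
    then show ?thesis using measurable_sets[of cell borel "count_space UNIV" "{j}"] by (simp add: vimage_def)
  qed
  define w where "w j = prob {x. cell x = j}" for j
  have qsum: "q i = (\<Sum>j<i. w j)" if le: "i \<le> M" for i
  proof -
    have "prob {x. cell x < i} = (\<Sum>j<i. w j)"
    proof -
      have "{x. cell x < i} = (\<Union>j\<in>{..<i}. {x. cell x = j})" by auto
      then show ?thesis unfolding w_def
        by (simp only:) (rule finite_measure_finite_Union, auto simp: disjoint_family_on_def)
    qed
    moreover have "prob {x. cell x < i} = q i"
    proof -
      consider "i = 0" | "i \<in> {0<..<M}" | "i = M"
        using le by (cases "i = 0"; cases "i = M") auto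
      then show ?thesis
      proof cases
        case 2
        then have "{x. cell x < i} = {..t i}" using cell_iff by auto
        then show ?thesis using 2 by (simp add: q_def cdf_def M_def)
      next
        case 3
        then have "{x. cell x < i} = space \<mu>" using cell_less by auto
        then show ?thesis using 3 by (simp only: prob_space) (simp add: q_def M_def)
      qed (simp add: q_def)
    qed
    ultimately show ?thesis by simp
  qed
  let ?P = "\<Pi>\<^sub>M i\<in>{1..n}. \<mu>"
  let ?C = "\<lambda>f. \<forall>i\<in>{0<..<M}. A i (card {k \<in> {1..n}. f k < i})"
  let ?F = "{f \<in> {1..n} \<rightarrow>\<^sub>E {0..<M}. ?C f}"
  have ev: "{X \<in> space ?P. \<forall>i\<in>{0<..<M}. A i (card {k \<in> {1..n}. X k \<le> t i})}
     = (\<Union>f\<in>?F. (\<Pi>\<^sub>E k\<in>{1..n}. {x. cell x = f k}))"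
  proof (intro set_eqI iffI)
    fix X assume "X \<in> {X \<in> space ?P. \<forall>i\<in>{0<..<M}. A i (card {k \<in> {1..n}. X k \<le> t i})}"
    then have X: "X \<in> extensional {1..n}" "\<forall>i\<in>{0<..<M}. A i (card {k \<in> {1..n}. X k \<le> t i})"
      by (auto simp: space_PiM PiE_def)
    define f where "f = restrict (\<lambda>k. cell (X k)) {1..n}"
    have "{k \<in> {1..n}. f k < i} = {k \<in> {1..n}. X k \<le> t i}" if "i \<in> {0<..<M}" for i
      using cell_iff[OF that] by (auto simp: f_def)
    then have "f \<in> ?F" using X(2) cell_less by (auto simp: f_def)
    moreover have "X \<in> (\<Pi>\<^sub>E k\<in>{1..n}. {x. cell x = f k})" using X(1) by (auto simp: f_def PiE_def)
    ultimately show "X \<in> (\<Union>f\<in>?F. (\<Pi>\<^sub>E k\<in>{1..n}. {x. cell x = f k}))" by blast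
  next
    fix X assume "X \<in> (\<Union>f\<in>?F. (\<Pi>\<^sub>E k\<in>{1..n}. {x. cell x = f k}))"
    then obtain f where f: "f \<in> ?F" "X \<in> (\<Pi>\<^sub>E k\<in>{1..n}. {x. cell x = f k})" by blast
    have "cell (X k) = f k" if "k \<in> {1..n}" for k
      using PiE_mem[OF f(2) that] by simp
    then have "{k \<in> {1..n}. f k < i} = {k \<in> {1..n}. X k \<le> t i}" if "i \<in> {0<..<M}" for i
      using cell_iff[OF that] by (metis (mono_tags, lifting))
    then show "X \<in> {X \<in> space ?P. \<forall>i\<in>{0<..<M}. A i (card {k \<in> {1..n}. X k \<le> t i})}"
      using f by (auto simp: space_PiM PiE_def)
  qed
  have box: "measure ?P (\<Pi>\<^sub>E k\<in>{1..n}. {x. cell x = f k}) = (\<Prod>k\<in>{1..n}. w (f k))"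
      "(\<Pi>\<^sub>E k\<in>{1..n}. {x. cell x = f k}) \<in> sets ?P" for f
  proof -
    have "emeasure ?P (\<Pi>\<^sub>E k\<in>{1..n}. {x. cell x = f k}) = (\<Prod>k\<in>{1..n}. emeasure \<mu> {x. cell x = f k})"
      by (rule P.emeasure_PiM) auto
    also have "\<dots> = ennreal (\<Prod>k\<in>{1..n}. w (f k))"
      by (simp add: w_def emeasure_eq_measure prod_ennreal)
    finally show "measure ?P (\<Pi>\<^sub>E k\<in>{1..n}. {x. cell x = f k}) = (\<Prod>k\<in>{1..n}. w (f k))"
      by (simp add: measure_def w_def prod_nonneg)
    show "(\<Pi>\<^sub>E k\<in>{1..n}. {x. cell x = f k}) \<in> sets ?P"
      by (intro sets_PiM_I_finite) auto
  qed
  have finF: "finite ({1..n} \<rightarrow>\<^sub>E {0..<M})" by (intro finite_PiE) auto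
  have disj: "disjoint_family_on (\<lambda>f. \<Pi>\<^sub>E k\<in>{1..n}. {x. cell x = f k}) ?F"
  proof (unfold disjoint_family_on_def, intro ballI impI)
    fix f g assume fg: "f \<in> ?F" "g \<in> ?F" "f \<noteq> g"
    then obtain k where k: "k \<in> {1..n}" "f k \<noteq> g k" by (metis (mono_tags, lifting) PiE_ext mem_Collect_eq)
    show "(\<Pi>\<^sub>E k\<in>{1..n}. {x. cell x = f k}) \<inter> (\<Pi>\<^sub>E k\<in>{1..n}. {x. cell x = g k}) = {}"
      using k by (auto simp: PiE_def Pi_def)
  qed
  have "measure ?P {X \<in> space ?P. \<forall>i\<in>{0<..<M}. A i (card {k \<in> {1..n}. X k \<le> t i})} = (\<Sum>f\<in>?F. \<Prod>k\<in>{1..n}. w (f k))"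
    unfolding ev box(1)[symmetric]
    by (rule P.P.finite_measure_finite_Union[OF _ _ disj]) (use finF box(2) in auto)
  also have "\<dots> = cell_sum w A L 0 0 {1..n}"
    unfolding cell_sum_def using finF
    by (simp add: M_def sum.inter_filter of_bool_def if_distrib[of "\<lambda>x. x * _"] cong: if_cong)
  also have "\<dots> = (q (0 + 2 ^ L) - q 0) ^ card {1..n} * binom_tree q A L 0 0 (card {1..n})"
  proof (rule cell_sum_eq_binom_tree)
    show "q (Suc i) = q i + w i" if "i < M" for i
      using qsum[of i] qsum[of "Suc i"] that by simp
    show "0 + 2 ^ L \<le> M" by (simp add: M_def)
  qed (auto simp: w_def)
  also have "\<dots> = binom_tree q A L 0 0 n"
    by (simp add: q_def)
  finally show ?thesis by (simp add: M_def)
qed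

section \<open>Oscillation of the uniform empirical process\<close>

abbreviation uniform01 :: "real measure" where "uniform01 \<equiv> interval_measure F0"

abbreviation uniform_sample :: "nat \<Rightarrow> (nat \<Rightarrow> real) measure" where
  "uniform_sample n \<equiv> \<Pi>\<^sub>M k\<in>{1..n}. uniform01"

lemma uniform01: "real_distribution uniform01" "cdf uniform01 = F0"
  using cdfs01_interval_measure[OF F0_in_cdfs01] by auto

lemma measure_uniform01_Ioc:
  assumes "0 \<le> u" "u \<le> v" "v \<le> 1"
  shows "measure uniform01 {u<..v} = v - u"
proof -
  interpret real_distribution uniform01 by (rule uniform01)
  have "measure uniform01 {u<..v} = F0 v - F0 u"
    using cdf_diff_eq[of u v] uniform01(2) assms(2) by (cases "u = v") auto
  then show ?thesis using assms by (simp add: F0_def)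
qed

definition count_le :: "nat \<Rightarrow> (nat \<Rightarrow> real) \<Rightarrow> real \<Rightarrow> nat" where
  "count_le n X t = card {k \<in> {1..n}. X k \<le> t}"

lemma count_le_mono: "s \<le> t \<Longrightarrow> count_le n X s \<le> count_le n X t"
  unfolding count_le_def by (intro card_mono) auto

lemma count_le_diff:
  assumes "u \<le> v"
  shows "real (count_le n X v) - real (count_le n X u) = (\<Sum>k\<in>{1..n}. indicator {u<..v} (X k))"
proof -
  have "{k \<in> {1..n}. X k \<le> v} = {k \<in> {1..n}. X k \<le> u} \<union> {k \<in> {1..n}. X k \<in> {u<..v}}"
    using assms by auto
  then have "card {k \<in> {1..n}. X k \<le> v} = card {k \<in> {1..n}. X k \<le> u} + card {k \<in> {1..n}. X k \<in> {u<..v}}"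
    by (simp add: card_Un_disjoint disjoint_iff)
  moreover have "(\<Sum>k\<in>{1..n}. indicator {u<..v} (X k)) = real (card {k \<in> {1..n}. X k \<in> {u<..v}})"
    by (simp add: indicator_def sum.If_cases Int_def)
  ultimately show ?thesis by (simp add: count_le_def)
qed

definition emp_dev :: "nat \<Rightarrow> (nat \<Rightarrow> real) \<Rightarrow> real \<Rightarrow> real" where
  "emp_dev n X t = (real (count_le n X t) - real n * t) / sqrt (real n)"

lemma count_le_measurable [measurable]:
  "(\<lambda>X. count_le n X t) \<in> measurable (uniform_sample n) (count_space UNIV)"
  unfolding count_le_def by measurable

lemma emp_dev_measurable [measurable]:
  "(\<lambda>X. emp_dev n X t) \<in> borel_measurable (uniform_sample n)"
proof -
  have "(\<lambda>X. real (count_le n X t)) \<in> borel_measurable (uniform_sample n)"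
    by (rule measurable_compose[OF count_le_measurable]) simp
  then show ?thesis unfolding emp_dev_def by measurable
qed

text \<open>
  Chernoff's bound. For a cell of probability \<open>d\<close> with \<open>n d \<ge> 1\<close> the count has variance at most
  \<open>n d\<close>, and its tails decay at least exponentially on the scale \<open>sqrt (n d)\<close>. Bounds on the scale
  \<open>sqrt n\<close>, such as Hoeffding's, would be too weak for the chaining argument.
\<close>

lemma emp_dev_increment_tail:
  assumes n: "0 < n" and uv: "0 \<le> u" "v \<le> 1" and d: "1 / real n \<le> v - u"
  shows "measure (uniform_sample n) {X \<in> space (uniform_sample n). e < \<bar>emp_dev n X v - emp_dev n X u\<bar>}
     \<le> 2 * exp (1 - e / sqrt (v - u))"
proof -
  interpret U: real_distribution uniform01 by (rule uniform01)
  interpret P: product_prob_space "\<lambda>_::nat. uniform01" "{1..n}" by unfold_locales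
  let ?P = "uniform_sample n"
  define d where "d = v - u"
  have d: "1 / real n \<le> d" "0 < d"
  proof -
    have "0 < 1 / real n" using n by simp
    then show "1 / real n \<le> d" "0 < d" using assms(4) unfolding d_def by linarith+
  qed
  have uv': "u \<le> v" using d by (simp add: d_def)
  define inc where "inc X = emp_dev n X v - emp_dev n X u" for X
  have [measurable]: "inc \<in> borel_measurable ?P" unfolding inc_def by measurable
  \<comment> \<open>The exponent for which the quadratic term of the bound below equals 1.\<close>
  define lam where "lam = 1 / sqrt (real n * d)"
  have nd: "1 \<le> real n * d" using d n by (simp add: field_simps)
  have lam: "0 < lam" "lam \<le> 1" using nd by (auto simp: lam_def)
  have lam2: "real n * d * lam\<^sup>2 = 1"
    using n d by (simp add: lam_def power_divide)
  have ls: "lam * sqrt (real n) = 1 / sqrt d"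
    using n d by (simp add: lam_def real_sqrt_mult)
  have one: "emeasure ?P {X \<in> space ?P. e < s * inc X} \<le> ennreal (exp (1 - e / sqrt d))" if s: "s = 1 \<or> s = -1" for s
  proof -
    define th where "th = s * lam"
    have th: "\<bar>th\<bar> \<le> 1" "th\<^sup>2 = lam\<^sup>2" using lam s by (auto simp: th_def)
    let ?f = "\<lambda>x. ennreal (exp (th * indicator {u<..v} x))"
    have mgf: "(\<integral>\<^sup>+x. ?f x \<partial>uniform01) = ennreal (1 + d * (exp th - 1))"
    proof -
      have "(\<integral>\<^sup>+x. ?f x \<partial>uniform01) = (\<integral>\<^sup>+x. ennreal (1 + (exp th - 1) * indicator {u<..v} x) \<partial>uniform01)"
        by (intro nn_integral_cong arg_cong[where f = ennreal]) (simp add: indicator_def)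
      also have "\<dots> = ennreal (LINT x|uniform01. 1 + (exp th - 1) * indicator {u<..v} x)"
      proof (rule nn_integral_eq_integral)
        show "integrable uniform01 (\<lambda>x. 1 + (exp th - 1) * indicator {u<..v} x)"
          by (intro Bochner_Integration.integrable_add integrable_mult_right integrable_real_indicator) (auto simp: U.emeasure_eq_measure)
        show "AE x in uniform01. 0 \<le> 1 + (exp th - 1) * indicator {u<..v} x"
          by (intro AE_I2) (auto simp: indicator_def)
      qed
      also have "(LINT x|uniform01. 1 + (exp th - 1) * indicator {u<..v} x) = 1 + (exp th - 1) * measure uniform01 {u<..v}"
        by (subst Bochner_Integration.integral_add) (auto simp: U.emeasure_eq_measure U.prob_space[simplified])
      also have "measure uniform01 {u<..v} = d"
        using measure_uniform01_Ioc[OF uv(1) uv' uv(2)] by (simp add: d_def)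
      finally show ?thesis by (simp add: mult.commute)
    qed
    have pos: "0 \<le> 1 + d * (exp th - 1)"
    proof -
      have "1 + d * (exp th - 1) = (1 - d) + d * exp th" by (simp add: algebra_simps)
      moreover have "0 \<le> d * exp th" "d \<le> 1" using d uv by (auto simp: d_def)
      ultimately show ?thesis by linarith
    qed
    have le: "1 + d * (exp th - 1) \<le> exp (d * (th + lam\<^sup>2))"
    proof -
      have "d * (exp th - 1) \<le> d * (th + lam\<^sup>2)"
        using exp_le_quadratic[OF abs_le_D1[OF th(1)]] d th(2) by (intro mult_left_mono) auto
      then show ?thesis using exp_ge_add_one_self[of "d * (th + lam\<^sup>2)"] by linarith
    qed
    define a where "a = - (th * real n * d + lam * sqrt (real n) * e)"
    have sinc: "lam * sqrt (real n) * (s * inc X) = th * (\<Sum>k\<in>{1..n}. indicator {u<..v} (X k)) - th * real n * d" for X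
    proof -
      have "sqrt (real n) * inc X = (real (count_le n X v) - real (count_le n X u)) - real n * d"
      proof -
        have "sqrt (real n) * emp_dev n X t = real (count_le n X t) - real n * t" for t
          using n by (simp add: emp_dev_def)
        then show ?thesis by (simp add: inc_def d_def right_diff_distrib)
      qed
      then have e: "(\<Sum>k\<in>{1..n}. indicator {u<..v} (X k)) = sqrt (real n) * inc X + real n * d"
        unfolding count_le_diff[OF uv'] by simp
      show ?thesis
        unfolding e th_def by (simp add: algebra_simps)
    qed
    have "emeasure ?P {X \<in> space ?P. e < s * inc X} \<le> (\<integral>\<^sup>+X. (\<Prod>k\<in>{1..n}. ?f (X k)) * ennreal (exp a) \<partial>?P)"
    proof -
      have "emeasure ?P {X \<in> space ?P. e < s * inc X} = (\<integral>\<^sup>+X. indicator {X \<in> space ?P. e < s * inc X} X \<partial>?P)"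
        by (rule nn_integral_indicator[symmetric]) measurable
      also have "\<dots> \<le> (\<integral>\<^sup>+X. (\<Prod>k\<in>{1..n}. ?f (X k)) * ennreal (exp a) \<partial>?P)"
      proof (rule nn_integral_mono)
        fix X
        have "(\<Prod>k\<in>{1..n}. ?f (X k)) * ennreal (exp a) = ennreal (exp (lam * sqrt (real n) * (s * inc X - e)))"
        proof -
          have "(\<Prod>k\<in>{1..n}. ?f (X k)) = ennreal (exp (th * (\<Sum>k\<in>{1..n}. indicator {u<..v} (X k))))"
          proof -
            have "(\<Prod>k\<in>{1..n}. ?f (X k)) = ennreal (\<Prod>k\<in>{1..n}. exp (th * indicator {u<..v} (X k)))"
              by (rule prod_ennreal) auto
            also have "(\<Prod>k\<in>{1..n}. exp (th * indicator {u<..v} (X k))) = exp (\<Sum>k\<in>{1..n}. th * indicator {u<..v} (X k))"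
              by (rule exp_sum[symmetric]) simp
            finally show ?thesis by (simp only: sum_distrib_left)
          qed
          moreover have "lam * sqrt (real n) * (s * inc X - e) = th * (\<Sum>k\<in>{1..n}. indicator {u<..v} (X k)) + a"
            using sinc[of X] by (simp add: a_def algebra_simps)
          ultimately show ?thesis by (simp add: ennreal_mult'[symmetric] exp_add)
        qed
        moreover have "1 \<le> exp (lam * sqrt (real n) * (s * inc X - e))" if "e < s * inc X"
          using that lam by simp
        ultimately show "indicator {X \<in> space ?P. e < s * inc X} X \<le> (\<Prod>k\<in>{1..n}. ?f (X k)) * ennreal (exp a)"
          by (auto simp: indicator_def)
      qed
      finally show ?thesis .
    qed
    also have "\<dots> = (\<integral>\<^sup>+X. (\<Prod>k\<in>{1..n}. ?f (X k)) \<partial>?P) * ennreal (exp a)"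
      by (intro nn_integral_multc) measurable
    also have "(\<integral>\<^sup>+X. (\<Prod>k\<in>{1..n}. ?f (X k)) \<partial>?P) = (\<Prod>k\<in>{1..n}. (\<integral>\<^sup>+x. ?f x \<partial>uniform01))"
      by (rule P.product_nn_integral_prod) auto
    also have "\<dots> = ennreal ((1 + d * (exp th - 1)) ^ n)"
      unfolding mgf using pos by (simp add: ennreal_power)
    also have "\<dots> * ennreal (exp a) = ennreal ((1 + d * (exp th - 1)) ^ n * exp a)"
      using pos by (simp add: ennreal_mult')
    also have "\<dots> \<le> ennreal (exp (d * (th + lam\<^sup>2)) ^ n * exp a)"
      using le pos by (intro ennreal_leI mult_right_mono power_mono) auto
    also have "exp (d * (th + lam\<^sup>2)) ^ n * exp a = exp (real n * d * lam\<^sup>2 - lam * sqrt (real n) * e)"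
      by (simp add: exp_of_nat_mult[symmetric] exp_add[symmetric] a_def algebra_simps)
    also have "\<dots> = exp (1 - e / sqrt d)"
      unfolding lam2 ls by simp
    finally show ?thesis .
  qed
  have "{X \<in> space ?P. e < \<bar>inc X\<bar>} = {X \<in> space ?P. e < 1 * inc X} \<union> {X \<in> space ?P. e < (-1) * inc X}"
    by auto
  then have "emeasure ?P {X \<in> space ?P. e < \<bar>inc X\<bar>} \<le> emeasure ?P {X \<in> space ?P. e < 1 * inc X} + emeasure ?P {X \<in> space ?P. e < (-1) * inc X}"
    by (simp only:) (rule emeasure_subadditive, measurable)
  also have "\<dots> \<le> ennreal (exp (1 - e / sqrt d)) + ennreal (exp (1 - e / sqrt d))"
    by (intro add_mono one) auto
  also have "\<dots> = ennreal (2 * exp (1 - e / sqrt d))"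
    by (simp flip: ennreal_plus)
  finally have "measure ?P {X \<in> space ?P. e < \<bar>inc X\<bar>} \<le> 2 * exp (1 - e / sqrt d)"
    unfolding measure_def by (intro enn2real_leI) auto
  then show ?thesis by (simp only: inc_def d_def)
qed

lemma exp_minus_le_power:
  fixes x :: real
  assumes "0 < x"
  shows "exp (- x) \<le> (8 / x) ^ 8"
proof -
  have "x / 8 \<le> exp (x / 8)" using exp_ge_add_one_self[of "x / 8"] by linarith
  then have "(x / 8) ^ 8 \<le> exp (x / 8) ^ 8" using assms by (intro power_mono) auto
  also have "exp (x / 8) ^ 8 = exp x" by (simp flip: exp_of_nat_mult)
  finally have "1 / exp x \<le> 1 / (x / 8) ^ 8" using assms by (intro divide_left_mono) auto
  then show ?thesis by (simp add: exp_minus inverse_eq_divide power_divide)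
qed

text \<open>
  A dyadic point of level \<open>Suc K\<close> is a point of level \<open>K\<close> or the right neighbour of one.
\<close>

lemma dyadic_chaining:
  fixes z :: "real \<Rightarrow> real" and e :: "nat \<Rightarrow> real"
  assumes "\<And>k i. k \<le> K \<Longrightarrow> i < 2 ^ k \<Longrightarrow> \<bar>z (s + real (i + 1) * len / 2 ^ k) - z (s + real i * len / 2 ^ k)\<bar> \<le> e k"
    and "i \<le> 2 ^ K"
  shows "\<bar>z (s + real i * len / 2 ^ K) - z s\<bar> \<le> (\<Sum>k\<le>K. e k)"
  using assms
proof (induction K arbitrary: i)
  case 0
  then consider "i = 0" | "i = 1" by fastforce
  moreover have "0 \<le> e 0" using 0(1)[of 0 0] by (auto intro: order_trans[OF abs_ge_zero])
  ultimately show ?case using 0(1)[of 0 0] by cases auto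
next
  case (Suc K)
  have IH: "\<bar>z (s + real j * len / 2 ^ K) - z s\<bar> \<le> (\<Sum>k\<le>K. e k)" if "j \<le> 2 ^ K" for j
    using Suc.prems(1) that by (intro Suc.IH) auto
  have e: "0 \<le> e (Suc K)"
    using Suc.prems(1)[of "Suc K" 0] by (auto intro: order_trans[OF abs_ge_zero])
  show ?case
  proof (cases "even i")
    case True
    then obtain j where j: "i = 2 * j" by (elim evenE)
    then have "j \<le> 2 ^ K" using Suc.prems(2) by simp
    moreover have "s + real i * len / 2 ^ Suc K = s + real j * len / 2 ^ K" by (simp add: j)
    ultimately show ?thesis using IH[of j] e by simp
  next
    case False
    then obtain j where j: "i = 2 * j + 1" by (elim oddE)
    then have "j \<le> 2 ^ K" "2 * j < 2 ^ Suc K" using Suc.prems(2) by auto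
    moreover have "s + real (2 * j) * len / 2 ^ Suc K = s + real j * len / 2 ^ K" by simp
    moreover have "\<bar>z (s + real i * len / 2 ^ Suc K) - z (s + real (2 * j) * len / 2 ^ Suc K)\<bar> \<le> e (Suc K)"
      using Suc.prems(1)[of "Suc K" "2 * j"] j calculation(2) by simp
    ultimately show ?thesis using IH[of j] by simp
  qed
qed

definition osc_const :: real where "osc_const = 4 * exp 1 * 8 ^ 8"

text \<open>
  Chaining over the dyadic subintervals of \<open>[s, s + len]\<close> down to length about \<open>1 / n\<close>. At level
  \<open>k\<close> increments up to \<open>\<eta> * r ^ k\<close> with \<open>r = 2 powr (-1/4)\<close> are allowed; the exceptional probabilities
  at that level add up to a multiple of \<open>len ^ 4 / \<eta> ^ 8 * (1 / 2) ^ k\<close>. Between neighbouring points of the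
  last level, monotonicity of the counts leaves an error \<open>2 / sqrt n\<close>. The fourth power of
  \<open>len\<close> beats the number of cells of a fine grid.
\<close>

lemma emp_dev_oscillation:
  assumes n: "0 < n" and s: "0 \<le> s" "s + len \<le> 1" and len: "1 / real n \<le> len" and \<eta>: "0 < \<eta>"
  obtains B where "B \<in> sets (uniform_sample n)"
    "measure (uniform_sample n) B \<le> osc_const * len ^ 4 / \<eta> ^ 8"
    "\<And>X t. X \<in> space (uniform_sample n) \<Longrightarrow> X \<notin> B \<Longrightarrow> s \<le> t \<Longrightarrow> t \<le> s + len \<Longrightarrow>
        \<bar>emp_dev n X t - emp_dev n X s\<bar> \<le> 7 * \<eta> + 2 / sqrt (real n)"
proof -
  interpret U: real_distribution uniform01 by (rule uniform01)
  interpret P: product_prob_space "\<lambda>_::nat. uniform01" "{1..n}" by unfold_locales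
  let ?P = "uniform_sample n"
  have lpos: "0 < len" using len n by (auto intro: less_le_trans[of 0 "1 / real n"])
  have nl: "1 \<le> real n * len" using len n by (simp add: field_simps)
  \<comment> \<open>The last level, at which the subintervals are between \<open>1 / n\<close> and \<open>2 / n\<close> long.\<close>
  obtain K where K: "2 ^ K \<le> real n * len" "real n * len < 2 ^ Suc K"
  proof -
    have "\<exists>K. real n * len < 2 ^ Suc K"
      using real_arch_pow[of 2 "real n * len"] by (metis one_less_numeral_iff power_Suc0_right power_increasing_iff less_le_trans le_SucI order_refl semiring_norm(76))
    then obtain K where K: "real n * len < 2 ^ Suc K" "\<And>J. J < K \<Longrightarrow> \<not> real n * len < 2 ^ Suc J"
      using exists_least_iff[of "\<lambda>K. real n * len < 2 ^ Suc K"] by blast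
    have "2 ^ K \<le> real n * len"
      using K(2)[of "K - 1"] nl by (cases K) (auto simp: not_less)
    then show ?thesis using K(1) that by blast
  qed
  define r :: real where "r = 1 / sqrt (sqrt 2)"
  have r: "0 < r" "r \<le> 6 / 7" "r ^ 8 = 1 / 4"
  proof -
    show "0 < r" by (simp add: r_def)
    have "sqrt (sqrt (((7 / 6)\<^sup>2)\<^sup>2)) \<le> sqrt (sqrt 2)" by (intro real_sqrt_le_mono) (simp add: power2_eq_square)
    then have "7 / 6 \<le> sqrt (sqrt 2)" by (simp only: real_sqrt_abs) simp
    then show "r \<le> 6 / 7" by (simp add: r_def field_simps)
    have "sqrt (sqrt 2) ^ 8 = ((sqrt (sqrt 2) ^ 2) ^ 2) ^ (2 :: nat)" by (simp only: power_mult[symmetric]) simp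
    also have "\<dots> = 4" by simp
    finally have "sqrt (sqrt 2) ^ 8 = (4 :: real)" .
    then show "r ^ 8 = 1 / 4" by (simp add: r_def power_divide)
  qed
  define e where "e k = \<eta> * r ^ k" for k
  define pt where "pt k i = s + real i * len / 2 ^ k" for k i
  define E where "E k i = {X \<in> space ?P. e k < \<bar>emp_dev n X (pt k (i + 1)) - emp_dev n X (pt k i)\<bar>}" for k i
  define B where "B = (\<Union>k\<in>{..K}. \<Union>i\<in>{..<2 ^ k}. E k i)"
  have E_meas: "E k i \<in> sets ?P" for k i unfolding E_def by measurable
  show ?thesis
  proof (rule that[of B])
    show "B \<in> sets ?P" unfolding B_def using E_meas by auto
    have Eb: "measure ?P (E k i) \<le> 2 * exp 1 * 8 ^ 8 * len ^ 4 / \<eta> ^ 8 * (1 / 4) ^ k" if "k \<le> K" "i < 2 ^ k" for k i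
    proof -
      have i1: "real i + 1 \<le> 2 ^ k" using that(2) by (metis Suc_leI of_nat_Suc of_nat_le_iff of_nat_numeral of_nat_power add.commute)
      have diff: "pt k (i + 1) - pt k i = len / 2 ^ k" by (simp add: pt_def field_simps)
      have "(real i + 1) * len / 2 ^ k \<le> 2 ^ k * len / 2 ^ k"
        using i1 lpos by (intro divide_right_mono mult_right_mono) auto
      then have b: "0 \<le> pt k i" "pt k (i + 1) \<le> 1"
        using s lpos by (auto simp: pt_def add.commute)
      have "(2::real) ^ k \<le> 2 ^ K" using that by simp
      then have "2 ^ k \<le> real n * len" using K(1) by (rule order_trans)
      then have "1 / real n \<le> pt k (i + 1) - pt k i"
        unfolding diff using n by (simp add: field_simps)
      then have "measure ?P (E k i) \<le> 2 * exp (1 - e k / sqrt (len / 2 ^ k))"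
        unfolding E_def using emp_dev_increment_tail[OF n b(1) b(2), of "e k"] diff by simp
      also have "\<dots> = 2 * exp 1 * exp (- (e k / sqrt (len / 2 ^ k)))"
        by (simp add: exp_diff exp_minus field_simps)
      also have "\<dots> \<le> 2 * exp 1 * (8 / (e k / sqrt (len / 2 ^ k))) ^ 8"
        using \<eta> r lpos by (intro mult_left_mono exp_minus_le_power) (auto simp: e_def)
      also have "(8 / (e k / sqrt (len / 2 ^ k))) ^ 8 = 8 ^ 8 * len ^ 4 / \<eta> ^ 8 * (1 / 4) ^ k"
      proof -
        have "sqrt (len / 2 ^ k) ^ 8 = ((sqrt (len / 2 ^ k))\<^sup>2) ^ 4" by (simp flip: power_mult)
        then have s8: "sqrt (len / 2 ^ k) ^ 8 = len ^ 4 / 16 ^ k"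
          using lpos by (simp add: power_divide power_mult[symmetric] mult.commute[of k]) (simp add: power_mult)
        have "(r ^ k) ^ 8 = (1 / 4) ^ k" using r(3) by (metis power_mult mult.commute)
        then have e8: "e k ^ 8 = \<eta> ^ 8 * (1 / 4) ^ k" by (simp add: e_def power_mult_distrib)
        have "(16 :: real) ^ k = 4 ^ k * 4 ^ k" by (simp flip: power_mult_distrib)
        then show ?thesis
          using \<eta> by (simp add: power_divide power_mult_distrib s8 e8)
      qed
      finally show ?thesis by (simp add: mult.assoc)
    qed
    define C where "C = 2 * exp 1 * 8 ^ 8 * len ^ 4 / \<eta> ^ 8"
    have C: "0 \<le> C" using lpos \<eta> by (simp add: C_def)
    have "measure ?P B \<le> (\<Sum>k\<le>K. measure ?P (\<Union>i\<in>{..<2 ^ k}. E k i))"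
      unfolding B_def by (intro P.P.finite_measure_subadditive_finite) (use E_meas in auto)
    also have "\<dots> \<le> (\<Sum>k\<le>K. \<Sum>i<2 ^ k. measure ?P (E k i))"
      by (intro sum_mono P.P.finite_measure_subadditive_finite) (use E_meas in auto)
    also have "\<dots> \<le> (\<Sum>k\<le>K. \<Sum>i<(2 ^ k :: nat). C * (1 / 4) ^ k)"
      using Eb by (intro sum_mono) (auto simp: C_def)
    also have "\<dots> = C * (\<Sum>k\<le>K. (1 / 2) ^ k)"
    proof -
      have "(\<Sum>i<(2 ^ k :: nat). C * (1 / 4) ^ k) = C * (1 / 2) ^ k" for k
      proof -
        have "(2 :: real) ^ k * (1 / 4) ^ k = (2 * (1 / 4)) ^ k" by (rule power_mult_distrib[symmetric])
        then show ?thesis by simp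
      qed
      then show ?thesis by (simp only: sum_distrib_left)
    qed
    also have "\<dots> \<le> C * 2"
    proof (intro mult_left_mono C)
      have "(\<Sum>k\<le>K. (1 / 2 :: real) ^ k) = 2 - (1 / 2) ^ K"
        by (induction K) (auto simp: field_simps)
      then show "(\<Sum>k\<le>K. (1 / 2 :: real) ^ k) \<le> 2" by simp
    qed
    finally show "measure ?P B \<le> osc_const * len ^ 4 / \<eta> ^ 8"
      by (simp add: C_def osc_const_def)
    fix X t assume X: "X \<in> space ?P" "X \<notin> B" and t: "s \<le> t" "t \<le> s + len"
    let ?z = "emp_dev n X"
    have sum_e: "(\<Sum>k\<le>K. e k) \<le> 7 * \<eta>"
    proof -
      have "(\<Sum>k\<le>K. r ^ k) \<le> 1 / (1 - r)"
        using r sum_gp_basic[of r K] by (simp add: pos_le_divide_eq mult.commute)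
      also have "\<dots> \<le> 7" using r by (simp add: field_simps)
      finally show ?thesis using \<eta> by (simp add: e_def sum_distrib_left[symmetric] mult.commute)
    qed
    have near: "\<bar>?z (pt K i) - ?z s\<bar> \<le> 7 * \<eta>" if "i \<le> 2 ^ K" for i
    proof -
      have "\<bar>?z (s + real i * len / 2 ^ K) - ?z s\<bar> \<le> (\<Sum>k\<le>K. e k)"
      proof (rule dyadic_chaining[OF _ that])
        fix k i :: nat assume ki: "k \<le> K" "i < 2 ^ k"
        then have "X \<notin> E k i" using X by (auto simp: B_def)
        then show "\<bar>?z (s + real (i + 1) * len / 2 ^ k) - ?z (s + real i * len / 2 ^ k)\<bar> \<le> e k"
          using X(1) by (auto simp: E_def pt_def not_less)
      qed
      then show ?thesis using sum_e by (simp add: pt_def)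
    qed
    define h where "h = len / 2 ^ K"
    have h: "0 < h" "sqrt (real n) * h \<le> 2 / sqrt (real n)"
    proof -
      show "0 < h" using lpos by (simp add: h_def)
      have "sqrt (real n) * (sqrt (real n) * h) \<le> 2" using K(2) by (simp add: h_def field_simps)
      then show "sqrt (real n) * h \<le> 2 / sqrt (real n)" using n by (simp add: pos_le_divide_eq mult.commute)
    qed
    obtain i where i: "i < 2 ^ K" "pt K i \<le> t" "t \<le> pt K (i + 1)"
    proof (cases "t = s + len")
      case True
      then show ?thesis
        using lpos by (intro that[of "2 ^ K - 1"]) (auto simp: pt_def of_nat_diff field_simps)
    next
      case False
      define w where "w = (t - s) / h"
      have w: "0 \<le> w" "w < 2 ^ K" "t = s + w * h"
      proof -
        have "2 ^ K * h = len" by (simp add: h_def)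
        then show "0 \<le> w" "w < 2 ^ K" "t = s + w * h"
          using h(1) t False by (auto simp: w_def pos_divide_less_eq)
      qed
      define i where "i = nat \<lfloor>w\<rfloor>"
      have iw: "real i \<le> w" "w \<le> real i + 1" using w(1) by (auto simp: i_def)
      have "real i < 2 ^ K" using iw w by linarith
      then have "i < 2 ^ K" by (metis of_nat_less_iff of_nat_numeral of_nat_power)
      moreover have "real i * h \<le> w * h" "w * h \<le> (real i + 1) * h"
        using iw h(1) by (auto intro!: mult_right_mono)
      ultimately show ?thesis
        using w(3) by (intro that[of i]) (auto simp: pt_def h_def add.commute)
    qed
    have step: "pt K (i + 1) - pt K i = h" by (simp add: pt_def h_def field_simps)
    have lo: "?z (pt K i) - sqrt (real n) * h \<le> ?z t"
    proof -
      have "real (count_le n X (pt K i)) \<le> real (count_le n X t)" using count_le_mono[OF i(2)] by simp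
      moreover have "real n * t \<le> real n * (pt K i + h)" using i(3) step by (intro mult_left_mono) auto
      ultimately have "(real (count_le n X (pt K i)) - real n * pt K i - real n * h) / sqrt (real n) \<le> ?z t"
        unfolding emp_dev_def by (intro divide_right_mono) (auto simp: algebra_simps)
      moreover have "real n * h / sqrt (real n) = sqrt (real n) * h" using n by (simp add: real_div_sqrt flip: times_divide_eq_left)
      ultimately show ?thesis by (simp add: emp_dev_def diff_divide_distrib)
    qed
    have hi: "?z t \<le> ?z (pt K (i + 1)) + sqrt (real n) * h"
    proof -
      have "real (count_le n X t) \<le> real (count_le n X (pt K (i + 1)))" using count_le_mono[OF i(3)] by simp
      moreover have "real n * (pt K (i + 1) - h) \<le> real n * t" using i(2) step by (intro mult_left_mono) auto
      ultimately have "?z t \<le> (real (count_le n X (pt K (i + 1))) - real n * pt K (i + 1) + real n * h) / sqrt (real n)"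
        unfolding emp_dev_def by (intro divide_right_mono) (auto simp: algebra_simps)
      moreover have "real n * h / sqrt (real n) = sqrt (real n) * h" using n by (simp add: real_div_sqrt flip: times_divide_eq_left)
      ultimately show ?thesis by (simp add: emp_dev_def add_divide_distrib)
    qed
    show "\<bar>?z t - ?z s\<bar> \<le> 7 * \<eta> + 2 / sqrt (real n)"
      using lo hi h(2) near[of i] near[of "i + 1"] i(1) by (simp add: abs_le_iff)
  qed
qed

section \<open>Error probabilities of the test and the alternatives\<close>

text \<open>
  The fundamental theorem of calculus for the Henstock-Kurzweil integral applies to every
  differentiable function, without continuity of the derivative; square-integrability then gives
  the Hoelder bound, by integrating \<open>2 \<bar>g\<bar> \<le> r g\<^sup>2 + 1 / r\<close> with a suitable weight \<open>r\<close>.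
\<close>

lemma L2_bounded_imp_holder:
  assumes "G differentiable_on {0..1}" and sq: "deriv01 G \<in> square_integrable01"
    and C: "(LINT x|leb01. (deriv01 G x)\<^sup>2) \<le> C" and xy: "0 \<le> x" "x \<le> y" "y \<le> 1"
  shows "\<bar>G y - G x\<bar> \<le> (C + 1) / 2 * sqrt (y - x)"
proof (cases "x = y")
  case False
  \<comment> \<open>The weight that balances the two terms of the bound.\<close>
  define r where "r = sqrt (y - x)"
  have r: "0 < r" "r * r = y - x" using False xy by (auto simp: r_def)
  let ?g = "deriv01 G"
  have sub: "{x..y} \<subseteq> {0..1}" using xy by auto
  have g2: "integrable leb01 (\<lambda>t. (?g t)\<^sup>2)" using sq by (simp add: square_integrable01_def)
  have g2_on: "(\<lambda>t. (?g t)\<^sup>2) integrable_on {0..1}"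
    by (rule integrable_on_lebesgue_on[OF g2]) simp
  have g2_int: "integral {0..1} (\<lambda>t. (?g t)\<^sup>2) \<le> C"
    using lebesgue_integral_eq_integral[OF g2] C by simp
  have g2_sub: "(\<lambda>t. (?g t)\<^sup>2) integrable_on {x..y}"
    by (rule integrable_on_subinterval[OF g2_on sub])
  have "(?g has_integral (G y - G x)) {x..y}"
  proof (rule fundamental_theorem_of_calculus[OF xy(2)])
    fix t assume t: "t \<in> {x..y}"
    then have "G differentiable (at t within {0..1})"
      using assms(1) sub by (auto simp: differentiable_on_def)
    then have "(G has_vector_derivative ?g t) (at t within {0..1})"
      unfolding deriv01_def using vector_derivative_works by blast
    then show "(G has_vector_derivative ?g t) (at t within {x..y})"
      using sub by (rule has_vector_derivative_within_subset)
  qed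
  then have G: "G y - G x = integral {x..y} ?g" "?g integrable_on {x..y}"
    by (auto simp: integral_unique has_integral_integrable)
  let ?h = "\<lambda>t. (r / 2) * (?g t)\<^sup>2 + 1 / (2 * r)"
  have i1: "(\<lambda>t. (r / 2) * (?g t)\<^sup>2) integrable_on {x..y}"
    using integrable_on_cmult_left[OF g2_sub, of "r / 2"] by simp
  have h_on: "?h integrable_on {x..y}"
    by (intro integrable_add i1 integrable_const_ivl)
  have "norm (integral {x..y} ?g) \<le> integral {x..y} ?h"
  proof (rule integral_norm_bound_integral[OF G(2) h_on])
    fix t
    have "0 \<le> (r * \<bar>?g t\<bar> - 1)\<^sup>2" by simp
    then have "2 * (r * \<bar>?g t\<bar>) \<le> r\<^sup>2 * (?g t)\<^sup>2 + 1"
      by (simp add: power2_diff power_mult_distrib)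
    then have "\<bar>?g t\<bar> \<le> (r\<^sup>2 * (?g t)\<^sup>2 + 1) / (2 * r)"
      using r by (simp add: pos_le_divide_eq mult_ac)
    also have "\<dots> = ?h t" using r by (simp add: field_simps power2_eq_square)
    finally show "norm (?g t) \<le> ?h t" by simp
  qed
  also have "integral {x..y} ?h = (r / 2) * integral {x..y} (\<lambda>t. (?g t)\<^sup>2) + (y - x) * (1 / (2 * r))"
    using xy integral_add[OF i1 integrable_const_ivl[of "1 / (2 * r)"]] by simp
  also have "integral {x..y} (\<lambda>t. (?g t)\<^sup>2) \<le> C"
    using integral_subset_le[OF sub g2_sub g2_on] g2_int by simp
  then have "(r / 2) * integral {x..y} (\<lambda>t. (?g t)\<^sup>2) + (y - x) * (1 / (2 * r)) \<le> (r / 2) * C + (y - x) * (1 / (2 * r))"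
    using r by (intro add_right_mono mult_left_mono) auto
  also have "\<dots> = (C + 1) / 2 * r" using r(1) by (simp add: r(2)[symmetric] field_simps)
  finally show ?thesis using G(1) by (simp add: r_def)
qed simp

text \<open>
  A compact set of derivatives is bounded in \<open>L2\<close>. Its members are classes of square-integrable
  functions because the class of any other function is empty.
\<close>

lemma L2_compact_derivatives_holder:
  assumes "L2_compact_derivatives I1"
  obtains C where "0 \<le> C" "\<And>G x y. G \<in> I1 \<Longrightarrow> 0 \<le> x \<Longrightarrow> x \<le> 1 \<Longrightarrow> 0 \<le> y \<Longrightarrow> y \<le> 1 \<Longrightarrow> \<bar>G x - G y\<bar> \<le> C * sqrt \<bar>x - y\<bar>"
proof -
  let ?D = "(\<lambda>G. L2_class (deriv01 G)) ` I1"
  have I1: "G differentiable_on {0..1}" if "G \<in> I1" for G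
    using assms that by (auto simp: L2_compact_derivatives_def)
  have comp: "compactin L2.mtopology ?D"
    using assms by (simp add: L2_compact_derivatives_def)
  have zero: "(\<lambda>_. 0) \<in> square_integrable01" by (simp add: square_integrable01_def)
  have class_in: "L2_class f \<in> L2_space" if "f \<in> square_integrable01" for f
    using that by (simp add: L2_class_def L2_space_def quotientI)
  have sub: "?D \<subseteq> L2_space"
    using compactin_subset_topspace[OF comp] by simp
  have sq: "deriv01 G \<in> square_integrable01" if "G \<in> I1" for G
  proof -
    have "L2_class (deriv01 G) \<noteq> {}"
      using sub that in_quotient_imp_non_empty[OF equiv_ae_eq01] by (auto simp: L2_space_def)
    then show ?thesis by (auto simp: L2_class_def ae_eq01_def)
  qed
  have "L2.mbounded ?D"
    using comp by (rule L2.compactin_imp_mbounded)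
  then have "?D = {} \<or> (\<exists>A B. A \<in> L2_space \<and> (\<forall>D\<in>?D. L2_dist A D \<le> B))"
    unfolding L2.mbounded by blast
  then obtain A B where AB: "A \<in> L2_space" "\<And>G. G \<in> I1 \<Longrightarrow> L2_dist A (L2_class (deriv01 G)) \<le> B"
    using class_in[OF zero] by blast
  define R where "R = L2_dist (L2_class (\<lambda>_. 0)) A + B"
  have norm: "(LINT x|leb01. (deriv01 G x)\<^sup>2) \<le> R\<^sup>2" if G: "G \<in> I1" for G
  proof -
    have "sqrt (LINT x|leb01. (deriv01 G x)\<^sup>2) = L2_dist (L2_class (\<lambda>_. 0)) (L2_class (deriv01 G))"
      using L2_dist_class[OF zero sq[OF G]] by simp
    also have "\<dots> \<le> R"
      using L2.triangle[OF class_in[OF zero] AB(1) class_in[OF sq[OF G]]] AB(2)[OF G] by (simp add: R_def)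
    finally have "sqrt (LINT x|leb01. (deriv01 G x)\<^sup>2) \<le> R" .
    then show ?thesis by (rule sqrt_le_D)
  qed
  show ?thesis
  proof (rule that[of "(R\<^sup>2 + 1) / 2"])
    fix G and x y :: real assume G: "G \<in> I1" and x: "0 \<le> x" "x \<le> 1" and y: "0 \<le> y" "y \<le> 1"
    note h = L2_bounded_imp_holder[OF I1[OF G] sq[OF G] norm[OF G]]
    show "\<bar>G x - G y\<bar> \<le> (R\<^sup>2 + 1) / 2 * sqrt \<bar>x - y\<bar>"
      using h[of x y] h[of y x] x y by (cases "x \<le> y") (auto simp: abs_minus_commute)
  qed simp
qed

lemma cdfs01_bounds:
  assumes "F \<in> cdfs01"
  shows "0 \<le> F x" "F x \<le> 1" "x \<le> y \<Longrightarrow> F x \<le> F y" "1 \<le> x \<Longrightarrow> F x = 1"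
proof -
  obtain N where N: "real_distribution N" "measure N {0..1} = 1" "F = cdf N"
    using assms by (auto simp: cdfs01_def)
  interpret real_distribution N by (rule N(1))
  show "0 \<le> F x" "F x \<le> 1" "x \<le> y \<Longrightarrow> F x \<le> F y"
    using N(3) cdf_nonneg cdf_bounded_prob cdf_nondecreasing by auto
  assume "1 \<le> x"
  then have "prob {0..1} \<le> prob {..x}" by (intro finite_measure_mono) auto
  then show "F x = 1" using N(2,3) by (simp add: cdf_def antisym)
qed

lemma empirical_cdf_eq: "empirical_cdf n X x = real (count_le n X x) / real n"
  by (simp add: empirical_cdf_def count_le_def)

text \<open>
  Relates counts centred and divided by \<open>sqrt n\<close> to frequencies multiplied by \<open>sqrt n\<close>.
\<close>

lemma centred_count_scaling:
  assumes "0 < n"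
  shows "(m - real n * a) / sqrt (real n) = sqrt (real n) * (m / real n - a)"
proof -
  define s where "s = sqrt (real n)"
  have s: "0 < s" "real n = s * s" using assms by (auto simp: s_def)
  have "(m - real n * a) / s = s * (m / real n - a)"
    unfolding s(2) using s(1) by (simp add: field_simps)
  then show ?thesis unfolding s_def .
qed

lemma empirical_deviation_bounded: "\<bar>empirical_cdf n X x - F0 x\<bar> \<le> 2"
proof -
  have "count_le n X x \<le> card {1..n}" unfolding count_le_def by (intro card_mono) auto
  then have "0 \<le> empirical_cdf n X x" "empirical_cdf n X x \<le> 1"
    by (auto simp: empirical_cdf_eq divide_le_eq)
  moreover have "0 \<le> F0 x" "F0 x \<le> 1" by (auto simp: F0_def)
  ultimately show ?thesis by linarith
qed

lemma T_stat_greater_iff: "c < T_stat (empirical_cdf n X) \<longleftrightarrow> (\<exists>x\<in>{0..1}. c < \<bar>empirical_cdf n X x - F0 x\<bar>)"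
  unfolding T_stat_def max_dev_def
  by (intro less_cSUP_iff bdd_aboveI[of _ 2]) (use empirical_deviation_bounded in auto)

lemma sample_law_prob_space:
  assumes "F \<in> cdfs01"
  shows "prob_space (sample_law n F)"
proof -
  interpret real_distribution "interval_measure F" by (rule cdfs01_interval_measure(1)[OF assms])
  show ?thesis unfolding sample_law_def by (rule prob_space_PiM) (rule prob_space_axioms)
qed

lemma count_le_measurable_sample [measurable]:
  "(\<lambda>X. count_le n X t) \<in> measurable (sample_law n F) (count_space UNIV)"
  unfolding sample_law_def count_le_def by measurable

text \<open>
  The distribution function on the grid, with the values 0 and 1 forced at the ends, so that an atom
  of \<open>F\<close> at 0 counts as part of the first cell.
\<close>

definition grid_cdf :: "(real \<Rightarrow> real) \<Rightarrow> real \<Rightarrow> nat \<Rightarrow> nat \<Rightarrow> real" where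
  "grid_cdf F x l i = (if i = 0 then 0 else if i < 2 ^ Suc l then F (split_grid x l i) else 1)"

definition grid_event :: "nat \<Rightarrow> (nat \<Rightarrow> real) \<Rightarrow> (nat \<Rightarrow> real) \<Rightarrow> real \<Rightarrow> nat \<Rightarrow> nat \<Rightarrow> bool" where
  "grid_event n q c b i m \<longleftrightarrow> (real m - real n * q i) / sqrt (real n) \<in> band (c i) b"

text \<open>
  The counterpart of \<open>grid_prob\<close> for a sample of size \<open>n\<close> from \<open>F\<close>.
\<close>

definition grid_hit :: "nat \<Rightarrow> (real \<Rightarrow> real) \<Rightarrow> real \<Rightarrow> nat \<Rightarrow> (nat \<Rightarrow> real) \<Rightarrow> real \<Rightarrow> real" where
  "grid_hit n F x l c b =
     binom_tree (grid_cdf F x l) (grid_event n (grid_cdf F x l) c b) (Suc l) 0 0 n"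

lemma sample_grid_prob:
  assumes "F \<in> cdfs01" "0 < x" "x < 1"
  shows "measure (sample_law n F) {X \<in> space (sample_law n F). \<forall>i\<in>{0<..<2 ^ Suc l}. A i (count_le n X (split_grid x l i))}
    = binom_tree (grid_cdf F x l) A (Suc l) 0 0 n"
  using grid_event_prob_eq_binom_tree[OF cdfs01_interval_measure(1)[OF assms(1)], where t = "split_grid x l" and L = "Suc l" and n = n and A = A,
      OF split_grid_mono_on[OF assms(2,3)]]
  unfolding cdfs01_interval_measure(2)[OF assms(1)] sample_law_def count_le_def grid_cdf_def[abs_def] by simp

lemma split_grid_in_unit:
  assumes "0 < x" "x < 1" "i \<le> 2 ^ Suc l"
  shows "0 \<le> split_grid x l i" "split_grid x l i \<le> 1"
proof -
  have m: "mono (split_grid x l)" using split_grid_strict_mono[OF assms(1,2)] by (rule strict_mono_mono)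
  show "0 \<le> split_grid x l i" using monoD[OF m, of 0 i] by simp
  show "split_grid x l i \<le> 1" using monoD[OF m, of i "2 ^ Suc l"] assms(3) by simp
qed

text \<open>
  The test accepts only if the deviation is at most \<open>c\<close> at each grid point.
\<close>

lemma type2_error_le:
  assumes F: "F \<in> cdfs01" and x: "0 < x" "x < 1" and n: "0 < n"
  shows "type2_error n c F \<le> grid_hit n F x l
    (\<lambda>i. sqrt (real n) * (F (split_grid x l i) - F0 (split_grid x l i))) (sqrt (real n) * c)"
proof -
  interpret prob_space "sample_law n F" by (rule sample_law_prob_space[OF F])
  let ?G = "\<lambda>i. sqrt (real n) * (F (split_grid x l i) - F0 (split_grid x l i))"
  let ?A = "grid_event n (grid_cdf F x l) ?G (sqrt (real n) * c)"
  have "?A i (count_le n X (split_grid x l i))"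
    if T: "\<not> c < T_stat (empirical_cdf n X)" and i: "i \<in> {0<..<2 ^ Suc l}" for X i
  proof -
    let ?t = "split_grid x l i"
    have "?t \<in> {0..1}" using split_grid_in_unit[OF x, of i l] i by auto
    then have "\<bar>empirical_cdf n X ?t - F0 ?t\<bar> \<le> c"
      using T unfolding T_stat_greater_iff by (auto simp: not_less)
    then have "sqrt (real n) * \<bar>empirical_cdf n X ?t - F0 ?t\<bar> \<le> sqrt (real n) * c"
      by (intro mult_left_mono) auto
    moreover have "(real (count_le n X ?t) - real n * grid_cdf F x l i) / sqrt (real n) + ?G i
        = sqrt (real n) * (empirical_cdf n X ?t - F0 ?t)"
    proof -
      have "(real (count_le n X ?t) - real n * F ?t) / sqrt (real n) = sqrt (real n) * (empirical_cdf n X ?t - F ?t)"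
        unfolding empirical_cdf_eq by (rule centred_count_scaling[OF n])
      then show ?thesis using i by (simp add: grid_cdf_def algebra_simps)
    qed
    ultimately show ?thesis
      by (simp add: grid_event_def band_def abs_mult)
  qed
  then have "type2_error n c F \<le> prob {X \<in> space (sample_law n F). \<forall>i\<in>{0<..<2 ^ Suc l}. ?A i (count_le n X (split_grid x l i))}"
    unfolding type2_error_def
  proof (intro finite_measure_mono)
    have "(\<lambda>X. ?A i (count_le n X (split_grid x l i))) \<in> measurable (sample_law n F) (count_space UNIV)" for i
      by (rule measurable_compose[OF count_le_measurable_sample]) simp
    then show "{X \<in> space (sample_law n F). \<forall>i\<in>{0<..<2 ^ Suc l}. ?A i (count_le n X (split_grid x l i))} \<in> sets (sample_law n F)"
      by measurable
  qed blast
  also have "\<dots> = binom_tree (grid_cdf F x l) ?A (Suc l) 0 0 n"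
    by (rule sample_grid_prob[OF F x])
  finally show ?thesis by (simp only: grid_hit_def)
qed

lemma F0_unit: "0 \<le> t \<Longrightarrow> t \<le> 1 \<Longrightarrow> F0 t = t"
  by (simp add: F0_def)

lemma grid_cdf_F0:
  assumes "0 < x" "x < 1" "i \<le> 2 ^ Suc l"
  shows "grid_cdf F0 x l i = split_grid x l i"
proof (cases "i = 2 ^ Suc l")
  case False
  then show ?thesis
    using assms split_grid_in_unit[OF assms] by (auto simp: grid_cdf_def F0_unit)
qed (simp add: grid_cdf_def)

text \<open>
  The chaining bounds control deviations relative to the left end of a cell, so for the first cell
  the deviation at 0 itself has to vanish almost surely.
\<close>

lemma uniform_sample_positive:
  obtains Z where "Z \<in> null_sets (sample_law n F0)"
    "\<And>X. X \<in> space (sample_law n F0) \<Longrightarrow> X \<notin> Z \<Longrightarrow> emp_dev n X 0 = 0"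
proof -
  interpret U: real_distribution uniform01 by (rule uniform01)
  interpret P: prob_space "sample_law n F0" by (rule sample_law_prob_space[OF F0_in_cdfs01])
  let ?Z = "{X \<in> space (sample_law n F0). count_le n X 0 \<noteq> 0}"
  have "AE X in sample_law n F0. \<forall>k\<in>{1..n}. 0 < X k"
  proof (rule AE_finite_allI)
    fix k assume k: "k \<in> {1..n}"
    have "AE t in uniform01. 0 < t"
    proof (rule AE_I[where N = "{..0}"])
      have "measure uniform01 {..0} = cdf uniform01 0"
        by (simp only: cdf_def)
      also have "\<dots> = F0 0"
        by (simp only: uniform01(2))
      finally have "measure uniform01 {..0} = 0"
        by (simp add: F0_def)
      then show "emeasure uniform01 {..0} = 0" by (simp add: U.emeasure_eq_measure)
    qed auto
    moreover have "distr (sample_law n F0) uniform01 (\<lambda>X. X k) = uniform01"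
      unfolding sample_law_def using k U.prob_space_axioms by (intro distr_PiM_component)
    ultimately have "AE t in distr (sample_law n F0) uniform01 (\<lambda>X. X k). 0 < t"
      by (simp only:)
    then show "AE X in sample_law n F0. 0 < X k"
      by (rule AE_distrD[rotated]) (use k in \<open>simp add: sample_law_def\<close>)
  qed simp
  then have "AE X in sample_law n F0. X \<notin> ?Z"
    by eventually_elim (auto simp: count_le_def not_le)
  moreover have Zm: "?Z \<in> sets (sample_law n F0)"
  proof -
    have "(\<lambda>X. count_le n X 0 \<noteq> 0) \<in> measurable (sample_law n F0) (count_space UNIV)"
      by (rule measurable_compose[OF count_le_measurable_sample]) simp
    then show ?thesis by measurable
  qed
  ultimately have "?Z \<in> null_sets (sample_law n F0)"
    using AE_iff_null_sets[OF Zm] by simp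
  then show ?thesis
    by (rule that) (auto simp: emp_dev_def)
qed

lemma emp_dev_abs:
  assumes "0 < n" "0 \<le> t" "t \<le> 1"
  shows "\<bar>emp_dev n X t\<bar> = sqrt (real n) * \<bar>empirical_cdf n X t - F0 t\<bar>"
proof -
  have "emp_dev n X t = sqrt (real n) * (empirical_cdf n X t - F0 t)"
    unfolding emp_dev_def empirical_cdf_eq F0_unit[OF assms(2,3)] by (rule centred_count_scaling[OF assms(1)])
  then show ?thesis by (simp add: abs_mult)
qed

lemma type1_error_tail:
  assumes n: "0 < n" and \<eta>: "0 < \<eta>" and c: "7 * \<eta> + 2 / sqrt (real n) \<le> sqrt (real n) * c"
  shows "type1_error n c \<le> osc_const / \<eta> ^ 8"
proof -
  interpret P: prob_space "sample_law n F0" by (rule sample_law_prob_space[OF F0_in_cdfs01])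
  obtain Z where Z: "Z \<in> null_sets (sample_law n F0)"
    "\<And>X. X \<in> space (sample_law n F0) \<Longrightarrow> X \<notin> Z \<Longrightarrow> emp_dev n X 0 = 0" using uniform_sample_positive[of n] by blast
  obtain B where B: "B \<in> sets (sample_law n F0)" "P.prob B \<le> osc_const * 1 ^ 4 / \<eta> ^ 8"
    "\<And>X t. X \<in> space (sample_law n F0) \<Longrightarrow> X \<notin> B \<Longrightarrow> 0 \<le> t \<Longrightarrow> t \<le> 0 + 1 \<Longrightarrow>
        \<bar>emp_dev n X t - emp_dev n X 0\<bar> \<le> 7 * \<eta> + 2 / sqrt (real n)"
    using emp_dev_oscillation[OF n, of 0 1 \<eta>] \<eta> n unfolding sample_law_def by auto
  have "{X \<in> space (sample_law n F0). c < T_stat (empirical_cdf n X)} \<subseteq> B \<union> Z"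
  proof (rule subsetI, rule ccontr)
    fix X assume X: "X \<in> {X \<in> space (sample_law n F0). c < T_stat (empirical_cdf n X)}" "X \<notin> B \<union> Z"
    then obtain t where t: "0 \<le> t" "t \<le> 1" "c < \<bar>empirical_cdf n X t - F0 t\<bar>"
      by (auto simp: T_stat_greater_iff)
    have "sqrt (real n) * c < \<bar>emp_dev n X t\<bar>"
      unfolding emp_dev_abs[OF n t(1,2)] using t(3) n by (intro mult_strict_left_mono) auto
    moreover have "\<bar>emp_dev n X t\<bar> \<le> 7 * \<eta> + 2 / sqrt (real n)"
      using B(3)[of X t] Z(2)[of X] X t by auto
    ultimately show False using c by simp
  qed
  then have "type1_error n c \<le> P.prob (B \<union> Z)"
    unfolding type1_error_def using B Z by (intro P.finite_measure_mono) auto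
  also have "\<dots> \<le> P.prob B + P.prob Z"
    using B Z by (intro measure_Un_le) auto
  also have "P.prob Z = 0" using Z(1) by (simp add: measure_eq_0_null_sets)
  finally show ?thesis using B(2) by simp
qed

lemma grid_bracket:
  fixes \<tau> :: "nat \<Rightarrow> real"
  assumes "\<tau> 0 \<le> t" "t \<le> \<tau> M" "0 < M"
  obtains m where "m < M" "\<tau> m \<le> t" "t \<le> \<tau> (Suc m)"
  using assms
proof (induction M arbitrary: thesis)
  case (Suc M)
  show ?case
  proof (cases "M = 0 \<or> \<tau> M \<le> t")
    case True
    then show ?thesis using Suc.prems(1)[of M] Suc.prems(2,3) by auto
  next
    case False
    then obtain m where "m < M" "\<tau> m \<le> t" "t \<le> \<tau> (Suc m)"
      using Suc.IH[OF _ Suc.prems(2)] by auto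
    then show ?thesis using Suc.prems(1)[of m] by auto
  qed
qed simp

lemma split_grid_spacing:
  assumes "0 < x" "x < 1"
  shows "min x (1 - x) / 2 ^ l \<le> split_grid x l (Suc m) - split_grid x l m"
    and "split_grid x l (Suc m) - split_grid x l m \<le> 1 / 2 ^ l"
proof -
  have "split_grid x l (Suc m) - split_grid x l m = (if m < 2 ^ l then x else 1 - x) / 2 ^ l"
  proof (cases "m < 2 ^ l")
    case True
    then show ?thesis by (simp add: split_grid_def field_simps)
  next
    case False
    show ?thesis
    proof (cases "m = 2 ^ l")
      case True
      then show ?thesis by (simp add: split_grid_def)
    next
      case ne: False
      then show ?thesis using False by (simp add: split_grid_def field_simps)
    qed
  qed
  then show "min x (1 - x) / 2 ^ l \<le> split_grid x l (Suc m) - split_grid x l m"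
    "split_grid x l (Suc m) - split_grid x l m \<le> 1 / 2 ^ l"
    using assms by (auto intro!: divide_right_mono)
qed

lemma osc_const_pos: "0 < osc_const"
  by (simp add: osc_const_def)

text \<open>
  The test can reject only if some grid deviation exceeds \<open>b - 14 * \<eta>\<close>, with \<open>b = sqrt n * c\<close>, or
  the empirical process oscillates by more than \<open>14 * \<eta>\<close> in one of the \<open>2 ^ Suc l\<close> cells. Each of these
  cells has length at most \<open>1 / 2 ^ l\<close> and contributes the fourth power of this length, whence the
  factor \<open>1 / 8 ^ l\<close>.
\<close>

lemma type1_error_le:
  assumes x: "0 < x" "x < 1" and \<eta>: "0 < \<eta>" and n: "0 < n"
    and large: "2 ^ l / min x (1 - x) \<le> real n" "2 / sqrt (real n) \<le> 7 * \<eta>" and c: "14 * \<eta> \<le> sqrt (real n) * c"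
  shows "type1_error n c
    \<le> 1 - grid_hit n F0 x l (\<lambda>_. 0) (sqrt (real n) * c - 14 * \<eta>) + 2 * osc_const / (8 ^ l * \<eta> ^ 8)"
proof -
  interpret P: prob_space "sample_law n F0" by (rule sample_law_prob_space[OF F0_in_cdfs01])
  let ?\<tau> = "split_grid x l" and ?N = "2 ^ Suc l :: nat"
  let ?b = "sqrt (real n) * c - 14 * \<eta>"
  let ?A = "grid_event n (grid_cdf F0 x l) (\<lambda>_. 0) ?b"
  define E where "E = {X \<in> space (sample_law n F0). \<forall>i\<in>{0<..<?N}. ?A i (count_le n X (?\<tau> i))}"
  have "(\<lambda>X. ?A i (count_le n X (?\<tau> i))) \<in> measurable (sample_law n F0) (count_space UNIV)" for i
    by (rule measurable_compose[OF count_le_measurable_sample]) simp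
  then have E: "E \<in> sets (sample_law n F0)" unfolding E_def by measurable
  have pE: "P.prob E = binom_tree (grid_cdf F0 x l) ?A (Suc l) 0 0 n"
    unfolding E_def by (rule sample_grid_prob[OF F0_in_cdfs01 x])
  obtain Z where Z: "Z \<in> null_sets (sample_law n F0)"
    "\<And>X. X \<in> space (sample_law n F0) \<Longrightarrow> X \<notin> Z \<Longrightarrow> emp_dev n X 0 = 0" using uniform_sample_positive[of n] by blast
  have "\<exists>B. B \<in> sets (sample_law n F0) \<and> P.prob B \<le> osc_const / (16 ^ l * \<eta> ^ 8) \<and>
      (\<forall>X t. X \<in> space (sample_law n F0) \<longrightarrow> X \<notin> B \<longrightarrow> ?\<tau> m \<le> t \<longrightarrow> t \<le> ?\<tau> (Suc m) \<longrightarrow>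
        \<bar>emp_dev n X t - emp_dev n X (?\<tau> m)\<bar> \<le> 7 * \<eta> + 2 / sqrt (real n))" if m: "m < ?N" for m
  proof -
    define len where "len = ?\<tau> (Suc m) - ?\<tau> m"
    have min_pos: "0 < min x (1 - x)" using x by simp
    have sp: "min x (1 - x) / 2 ^ l \<le> len" "len \<le> 1 / 2 ^ l"
      unfolding len_def by (rule split_grid_spacing[OF x])+
    have "1 / real n \<le> min x (1 - x) / 2 ^ l"
    proof -
      have "1 / real n \<le> w / 2 ^ l" if "2 ^ l / w \<le> real n" "0 < w" for w :: real
        using that n by (simp add: field_simps)
      then show ?thesis using large(1) min_pos by blast
    qed
    then have l1: "1 / real n \<le> len" using sp(1) by linarith
    have s: "0 \<le> ?\<tau> m" "?\<tau> m + len \<le> 1"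
      using split_grid_in_unit[OF x, of m l] split_grid_in_unit[OF x, of "Suc m" l] m by (auto simp: len_def)
    have lp: "0 \<le> len" using sp(1) min_pos by (meson divide_nonneg_pos less_imp_le order_trans zero_less_numeral zero_less_power)
    obtain B where B: "B \<in> sets (sample_law n F0)" "P.prob B \<le> osc_const * len ^ 4 / \<eta> ^ 8"
      "\<And>X t. X \<in> space (sample_law n F0) \<Longrightarrow> X \<notin> B \<Longrightarrow> ?\<tau> m \<le> t \<Longrightarrow> t \<le> ?\<tau> m + len \<Longrightarrow>
        \<bar>emp_dev n X t - emp_dev n X (?\<tau> m)\<bar> \<le> 7 * \<eta> + 2 / sqrt (real n)"
      using emp_dev_oscillation[OF n s l1 \<eta>] unfolding sample_law_def by blast
    have "osc_const * len ^ 4 / \<eta> ^ 8 \<le> osc_const * (1 / 2 ^ l) ^ 4 / \<eta> ^ 8"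
      using sp(2) lp osc_const_pos \<eta> by (intro divide_right_mono mult_left_mono power_mono) auto
    also have "(1 / 2 ^ l :: real) ^ 4 = 1 / 16 ^ l"
    proof -
      have "(2 ^ l :: real) ^ 4 = (2 ^ 4) ^ l" by (simp only: power_mult[symmetric] mult.commute)
      then show ?thesis by (simp add: power_divide)
    qed
    finally have "P.prob B \<le> osc_const / (16 ^ l * \<eta> ^ 8)" using B(2) by simp
    then show ?thesis using B(1,3) by (intro exI[of _ B]) (auto simp: len_def)
  qed
  then obtain B where B: "\<And>m. m < ?N \<Longrightarrow> B m \<in> sets (sample_law n F0)" "\<And>m. m < ?N \<Longrightarrow> P.prob (B m) \<le> osc_const / (16 ^ l * \<eta> ^ 8)"
      "\<And>m X t. m < ?N \<Longrightarrow> X \<in> space (sample_law n F0) \<Longrightarrow> X \<notin> B m \<Longrightarrow> ?\<tau> m \<le> t \<Longrightarrow> t \<le> ?\<tau> (Suc m) \<Longrightarrow>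
        \<bar>emp_dev n X t - emp_dev n X (?\<tau> m)\<bar> \<le> 7 * \<eta> + 2 / sqrt (real n)"
    by metis
  have "{X \<in> space (sample_law n F0). c < T_stat (empirical_cdf n X)} \<subseteq> (space (sample_law n F0) - E) \<union> ((\<Union>m\<in>{..<?N}. B m) \<union> Z)"
  proof (rule subsetI, rule ccontr)
    fix X assume X: "X \<in> {X \<in> space (sample_law n F0). c < T_stat (empirical_cdf n X)}"
      "X \<notin> (space (sample_law n F0) - E) \<union> ((\<Union>m\<in>{..<?N}. B m) \<union> Z)"
    then obtain t where t: "0 \<le> t" "t \<le> 1" "c < \<bar>empirical_cdf n X t - F0 t\<bar>"
      by (auto simp: T_stat_greater_iff)
    have gt: "sqrt (real n) * c < \<bar>emp_dev n X t\<bar>"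
      unfolding emp_dev_abs[OF n t(1,2)] using t(3) n by (intro mult_strict_left_mono) auto
    obtain m where m: "m < ?N" "?\<tau> m \<le> t" "t \<le> ?\<tau> (Suc m)"
      using grid_bracket[of ?\<tau> t ?N] t by auto
    have base: "\<bar>emp_dev n X (?\<tau> m)\<bar> \<le> ?b"
    proof (cases "m = 0")
      case True
      then show ?thesis using Z(2)[of X] X c by auto
    next
      case False
      then have "?A m (count_le n X (?\<tau> m))" using X m by (auto simp: E_def)
      then show ?thesis
        using grid_cdf_F0[OF x, of m l] m(1) by (simp add: grid_event_def band_def emp_dev_def)
    qed
    have "\<bar>emp_dev n X t - emp_dev n X (?\<tau> m)\<bar> \<le> 7 * \<eta> + 2 / sqrt (real n)"
      using B(3)[OF m(1) _ _ m(2,3), of X] X m(1) by auto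
    then show False using base gt large(2) by linarith
  qed
  then have "type1_error n c \<le> P.prob ((space (sample_law n F0) - E) \<union> ((\<Union>m\<in>{..<?N}. B m) \<union> Z))"
    unfolding type1_error_def using B Z E by (intro P.finite_measure_mono) auto
  also have "\<dots> \<le> P.prob (space (sample_law n F0) - E) + P.prob ((\<Union>m\<in>{..<?N}. B m) \<union> Z)"
    using B Z E by (intro measure_Un_le) auto
  also have "P.prob ((\<Union>m\<in>{..<?N}. B m) \<union> Z) \<le> P.prob (\<Union>m\<in>{..<?N}. B m) + P.prob Z"
    using B Z E by (intro measure_Un_le) auto
  also have "P.prob Z = 0" using Z(1) by (simp add: measure_eq_0_null_sets)
  also have "P.prob (\<Union>m\<in>{..<?N}. B m) \<le> (\<Sum>m\<in>{..<?N}. P.prob (B m))"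
    using B by (intro P.finite_measure_subadditive_finite) auto
  also have "\<dots> \<le> (\<Sum>m\<in>{..<?N}. osc_const / (16 ^ l * \<eta> ^ 8))"
    using B by (intro sum_mono) auto
  also have "\<dots> = 2 * osc_const / (8 ^ l * \<eta> ^ 8)"
  proof -
    have "(16 :: real) ^ l = 2 ^ l * 8 ^ l" by (simp flip: power_mult_distrib)
    then show ?thesis by simp
  qed
  also have "P.prob (space (sample_law n F0) - E) = 1 - P.prob E" by (rule P.prob_compl[OF E])
  finally show ?thesis using pE by (simp add: grid_hit_def)
qed

section \<open>Uniform consistency\<close>

lemma convergent_subseq_finite:
  fixes u :: "nat \<Rightarrow> 'i \<Rightarrow> real"
  assumes "finite I" and "\<And>k i. i \<in> I \<Longrightarrow> \<bar>u k i\<bar> \<le> C"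
  obtains r :: "nat \<Rightarrow> nat" and v where "strict_mono r" "\<And>i. i \<in> I \<Longrightarrow> (\<lambda>k. u (r k) i) \<longlonglongrightarrow> v i"
  using assms
proof (induction I arbitrary: thesis rule: finite_induct)
  case empty
  show ?case by (rule empty(1)[of id]) (auto simp: strict_mono_def)
next
  case (insert j I)
  obtain r :: "nat \<Rightarrow> nat" and v where r: "strict_mono r" "\<And>i. i \<in> I \<Longrightarrow> (\<lambda>k. u (r k) i) \<longlonglongrightarrow> v i"
    using insert.IH insert.prems(2) by blast
  have "bounded (range (\<lambda>k. u (r k) j))"
    using insert.prems(2) by (auto simp: bounded_iff)
  then obtain w s where s: "strict_mono s" "((\<lambda>k. u (r k) j) \<circ> s) \<longlonglongrightarrow> w"
    using bounded_imp_convergent_subsequence by blast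
  show ?case
  proof (rule insert.prems(1)[of "r \<circ> s" "v(j := w)"])
    show "strict_mono (r \<circ> s)" using r(1) s(1) by (rule strict_mono_o)
    fix i assume i: "i \<in> insert j I"
    show "(\<lambda>k. u ((r \<circ> s) k) i) \<longlonglongrightarrow> (v(j := w)) i"
    proof (cases "i = j")
      case True
      then show ?thesis using s(2) by (simp add: o_def)
    next
      case False
      then show ?thesis using LIMSEQ_subseq_LIMSEQ[OF r(2)[of i] s(1)] i by (simp add: o_def)
    qed
  qed
qed

lemma grid_cdf_mono_on:
  assumes F: "F \<in> cdfs01" and x: "0 < x" "x < 1"
  shows "mono_on {..2 ^ Suc l} (grid_cdf F x l)"
proof (rule mono_onI)
  fix i j :: nat assume "i \<in> {..2 ^ Suc l}" "j \<in> {..2 ^ Suc l}" "i \<le> j"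
  then show "grid_cdf F x l i \<le> grid_cdf F x l j"
    using cdfs01_bounds[OF F] strict_mono_less_eq[OF split_grid_strict_mono[OF x], of l i j] by (auto simp: grid_cdf_def)
qed

theorem grid_hit_tendsto:
  assumes N: "filterlim N at_top sequentially" "\<And>k. 0 < N k" and F: "\<And>k. F k \<in> cdfs01" and x: "0 < x" "x < 1"
    and Flim: "\<And>i. i < 2 ^ Suc l \<Longrightarrow> 0 < i \<Longrightarrow> (\<lambda>k. F k (split_grid x l i)) \<longlonglongrightarrow> split_grid x l i"
    and c: "\<And>i. i < 2 ^ Suc l \<Longrightarrow> 0 < i \<Longrightarrow> (\<lambda>k. c k i) \<longlonglongrightarrow> c' i" and b: "b \<longlonglongrightarrow> b'"
  shows "(\<lambda>k. grid_hit (N k) (F k) x l (c k) (b k)) \<longlonglongrightarrow> grid_prob x b' l c'"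
proof -
  have ge: "grid_event n q c b = (\<lambda>i m. (real m - real n * q i) / sqrt (real n) \<in> band (c i) b)" for n q c b
    by (intro ext) (simp add: grid_event_def)
  have ql: "(\<lambda>k. grid_cdf (F k) x l i) \<longlonglongrightarrow> split_grid x l i" if le: "i \<le> 2 ^ Suc l" for i
  proof -
    consider "i = 0" | "i = 2 ^ Suc l" | "0 < i" "i < 2 ^ Suc l" using le by linarith
    then show ?thesis
    proof cases
      case 3
      then show ?thesis using Flim[of i] by (simp add: grid_cdf_def)
    qed (auto simp: grid_cdf_def)
  qed
  have z: "(\<lambda>k. (real 0 - real (N k) * grid_cdf (F k) x l 0) / sqrt (real (N k))) \<longlonglongrightarrow> 0"
    by (simp add: grid_cdf_def)
  have z': "(\<lambda>k. (real (0 + N k) - real (N k) * grid_cdf (F k) x l (0 + 2 ^ Suc l)) / sqrt (real (N k))) \<longlonglongrightarrow> 0"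
    by (simp add: grid_cdf_def)
  show ?thesis
    unfolding grid_hit_def ge grid_prob_def
    by (rule binom_tree_tendsto_gauss_tree[OF N grid_cdf_mono_on[OF F x] split_grid_mono_on[OF x] ql c b _ z z']) auto
qed

text \<open>
  A band of width zero constrains the value at \<open>x\<close> to a single point.
\<close>

lemma grid_prob_zero_width:
  assumes "0 < x" "x < 1"
  shows "grid_prob x 0 l c = 0"
proof -
  have "AE u in lborel. u \<noteq> - c (2 ^ l)" by (rule AE_lborel_singleton)
  then have "AE u in lborel. normal_density 0 (sqrt (x * (1 - x))) u * node_val (split_grid x l) c 0 l 0 0 0 u = 0"
  proof eventually_elim
    case (elim u)
    then have "u \<notin> band (c (2 ^ l)) 0" by (auto simp: band_def)
    then show ?case by simp
  qed
  then show ?thesis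
    unfolding grid_prob_eq by (rule integral_eq_zero_AE)
qed

lemma type2_error_negative: "0 < n \<Longrightarrow> c < 0 \<Longrightarrow> type2_error n c F = 0"
proof -
  assume c: "c < 0"
  have "c < T_stat (empirical_cdf n X)" for X
    unfolding T_stat_greater_iff by (rule bexI[of _ 1]) (use c abs_ge_zero less_le_trans in \<open>blast, auto\<close>)
  then show ?thesis by (simp add: type2_error_def)
qed

text \<open>
  The order of the choices matters. The limits of the half-widths \<open>b k\<close> and of the points \<open>xs k\<close>
  determine the gap, and the gap determines \<open>\<epsilon>\<close>; the height \<open>l\<close> of the tree is free until the
  end, and the subsequence along which the shifts \<open>G k\<close> converge on the grid depends on it.
\<close>

theorem trivial_power_impossible:
  fixes N :: "nat \<Rightarrow> nat" and F :: "nat \<Rightarrow> real \<Rightarrow> real" and c :: "nat \<Rightarrow> real"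
  defines "G \<equiv> \<lambda>k t. sqrt (real (N k)) * (F k t - F0 t)"
  assumes \<alpha>: "0 < \<alpha>" "\<alpha> < 1"
    and N: "filterlim N at_top sequentially" "\<And>k. 0 < N k"
    and F: "\<And>k. F k \<in> cdfs01"
    and type1: "(\<lambda>k. type1_error (N k) (c k)) \<longlonglongrightarrow> \<alpha>"
    and type2: "\<And>k. 1 - \<alpha> - 1 / real (Suc k) < type2_error (N k) (c k) (F k)"
    and holder: "\<And>k x y. 0 \<le> x \<Longrightarrow> x \<le> 1 \<Longrightarrow> 0 \<le> y \<Longrightarrow> y \<le> 1 \<Longrightarrow> \<bar>G k x - G k y\<bar> \<le> C * sqrt \<bar>x - y\<bar>"
    and C: "0 \<le> C" and e: "0 < e1" "e2 < 1" and a: "0 < a"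
    and dev: "\<And>k. e1 \<le> xs k \<and> xs k \<le> e2 \<and> a < \<bar>G k (xs k)\<bar>"
  shows False
proof -
  define b where "b k = sqrt (real (N k)) * c k" for k
  have rN: "filterlim (\<lambda>k. sqrt (real (N k))) at_top sequentially"
    by (intro filterlim_compose[OF sqrt_at_top] filterlim_compose[OF filterlim_real_sequentially] N)
  have rN_inv: "(\<lambda>k. 1 / sqrt (real (N k))) \<longlonglongrightarrow> 0"
    using tendsto_divide_0[OF tendsto_const filterlim_at_top_imp_at_infinity[OF rN], of 1] by simp
  have G1: "G k 1 = 0" for k
    using cdfs01_bounds(4)[OF F, of 1 k] by (simp add: G_def F0_def)
  have G_bd: "\<bar>G k t\<bar> \<le> C" if "0 \<le> t" "t \<le> 1" for k t
  proof -
    have "\<bar>G k t - G k 1\<bar> \<le> C * sqrt \<bar>t - 1\<bar>" using that by (intro holder) auto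
    also have "\<dots> \<le> C * 1" using C that by (intro mult_left_mono) auto
    finally show ?thesis by (simp add: G1)
  qed
  have F_lim: "(\<lambda>k. F k t) \<longlonglongrightarrow> t" if t: "0 \<le> t" "t \<le> 1" for t
  proof -
    have "(\<lambda>k. G k t * (1 / sqrt (real (N k)))) \<longlonglongrightarrow> 0"
      by (rule Lim_null_comparison[where g = "\<lambda>k. C * (1 / sqrt (real (N k)))"])
        (use G_bd[OF t] tendsto_mult_right_zero[OF rN_inv, of C] in \<open>auto simp: abs_mult intro!: always_eventually divide_right_mono\<close>)
    then have "(\<lambda>k. t + G k t * (1 / sqrt (real (N k)))) \<longlonglongrightarrow> t + 0" by (intro tendsto_intros)
    moreover have "t + G k t * (1 / sqrt (real (N k))) = F k t" for k
      using N(2)[of k] by (simp add: G_def F0_unit[OF t])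
    ultimately show ?thesis by simp
  qed
  have inv_Suc: "(\<lambda>k. 1 / real (Suc k)) \<longlonglongrightarrow> 0"
    using LIMSEQ_inverse_real_of_nat by (simp only: inverse_eq_divide)
  have pos: "\<forall>\<^sub>F k in sequentially. 0 < 1 - \<alpha> - 1 / real (Suc k)"
  proof (rule order_tendstoD(1))
    show "(\<lambda>k. 1 - \<alpha> - 1 / real (Suc k)) \<longlonglongrightarrow> 1 - \<alpha> - 0"
      by (intro tendsto_intros inv_Suc)
  qed (use \<alpha> in simp)
  \<comment> \<open>With a negative critical value the test always rejects and has no type II error.\<close>
  have b_nonneg: "\<forall>\<^sub>F k in sequentially. 0 \<le> b k"
    using pos
  proof eventually_elim
    case (elim k)
    have "\<not> c k < 0" using type2_error_negative[OF N(2)[of k], of "c k" "F k"] type2[of k] elim by auto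
    then show ?case by (simp add: b_def)
  qed
  \<comment> \<open>Large critical values would force the type I error below \<open>\<alpha>\<close>, by the oscillation bound on \<open>[0,1]\<close>.\<close>
  obtain M where M: "\<forall>\<^sub>F k in sequentially. b k \<le> M"
  proof -
    have "((\<lambda>\<eta>. osc_const / \<eta> ^ 8) \<longlongrightarrow> 0) at_top"
      by (intro tendsto_divide_0[OF tendsto_const] filterlim_at_top_imp_at_infinity filterlim_pow_at_top filterlim_ident) auto
    then have "\<forall>\<^sub>F \<eta> in at_top. osc_const / \<eta> ^ 8 < \<alpha>" using \<alpha>(1) by (rule order_tendstoD(2))
    then have "\<forall>\<^sub>F \<eta> in at_top. osc_const / \<eta> ^ 8 < \<alpha> \<and> 0 < \<eta>"
      using eventually_gt_at_top[of 0] by eventually_elim simp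
    then obtain \<eta> where \<eta>: "osc_const / \<eta> ^ 8 < \<alpha>" "0 < \<eta>"
      using eventually_happens'[OF trivial_limit_at_top_linorder] by blast
    have "\<forall>\<^sub>F k in sequentially. osc_const / \<eta> ^ 8 < type1_error (N k) (c k)"
      by (rule order_tendstoD(1)[OF type1 \<eta>(1)])
    then have "\<forall>\<^sub>F k in sequentially. b k \<le> 7 * \<eta> + 2"
    proof eventually_elim
      case (elim k)
      have "1 \<le> sqrt (real (N k))" using N(2)[of k] by simp
      then have "2 / sqrt (real (N k)) \<le> 2" by (simp add: divide_le_eq)
      then show ?case
        using type1_error_tail[OF N(2)[of k] \<eta>(2), of "c k"] elim by (fastforce simp: b_def)
    qed
    then show ?thesis by (rule that)
  qed
  from b_nonneg M obtain k0 where k0: "\<And>k. k0 \<le> k \<Longrightarrow> 0 \<le> b k \<and> b k \<le> M"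
    using eventually_conj[OF b_nonneg M] by (auto simp: eventually_sequentially)
  obtain r v where r: "strict_mono r" "\<And>i. i \<in> {True, False} \<Longrightarrow>
      (\<lambda>k. (\<lambda>k i. if i then b (k + k0) else xs (k + k0)) (r k) i) \<longlonglongrightarrow> v i"
  proof (rule convergent_subseq_finite[of "{True, False}" "\<lambda>k i. if i then b (k + k0) else xs (k + k0)" "max M 1"])
    fix k i
    show "\<bar>if i then b (k + k0) else xs (k + k0)\<bar> \<le> max M 1"
      using k0[of "k + k0"] dev[of "k + k0"] e by auto
  qed auto
  define s where "s k = r k + k0" for k
  have s: "strict_mono s" using r(1) by (auto simp: s_def strict_mono_def)
  define b0 where "b0 = v True"
  define x where "x = v False"
  have b_lim: "(\<lambda>k. b (s k)) \<longlonglongrightarrow> b0" and x_lim: "(\<lambda>k. xs (s k)) \<longlonglongrightarrow> x"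
    using r(2)[of True] r(2)[of False] by (auto simp: s_def b0_def x_def)
  have x: "0 < x" "x < 1"
    using LIMSEQ_le_const[OF x_lim, of e1] LIMSEQ_le_const2[OF x_lim, of e2] dev e by fastforce+
  have b0: "0 \<le> b0"
    by (rule LIMSEQ_le_const[OF b_lim]) (use k0 in \<open>auto simp: s_def\<close>)
  \<comment> \<open>Hoelder continuity moves the large deviation from the points \<open>xs\<close> to their limit \<open>x\<close>.\<close>
  have G_low: "\<forall>\<^sub>F k in sequentially. a / 2 \<le> \<bar>G (s k) x\<bar>"
  proof -
    have "(\<lambda>k. C * sqrt \<bar>xs (s k) - x\<bar>) \<longlonglongrightarrow> C * sqrt \<bar>x - x\<bar>" by (intro tendsto_intros x_lim)
    then have "\<forall>\<^sub>F k in sequentially. C * sqrt \<bar>xs (s k) - x\<bar> < a / 2" using a by (intro order_tendstoD(2)) auto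
    then show ?thesis
    proof eventually_elim
      case (elim k)
      have "\<bar>G (s k) (xs (s k)) - G (s k) x\<bar> \<le> C * sqrt \<bar>xs (s k) - x\<bar>"
        using dev[of "s k"] e x by (intro holder) auto
      then show ?case using elim dev[of "s k"] by linarith
    qed
  qed
  have sN: "filterlim (\<lambda>k. N (s k)) at_top sequentially"
    by (rule filterlim_compose[OF N(1) filterlim_subseq[OF s]])
  \<comment> \<open>The limiting shift depends on \<open>l\<close>, but the lower bound on its size at \<open>x\<close> does not.\<close>
  have alternative_limits: "\<exists>c'. a / 2 \<le> \<bar>c' (2 ^ l)\<bar> \<and> 1 - \<alpha> \<le> grid_prob x b0 l c'" for l
  proof -
    let ?\<tau> = "split_grid x l" and ?I = "{..2 ^ Suc l} :: nat set"
    have tau: "0 \<le> ?\<tau> i" "?\<tau> i \<le> 1" if "i \<in> ?I" for i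
      using split_grid_in_unit[OF x, of i l] that by auto
    obtain q c' where q: "strict_mono q" "\<And>i. i \<in> ?I \<Longrightarrow> (\<lambda>k. G (s (q k)) (?\<tau> i)) \<longlonglongrightarrow> c' i"
      by (rule convergent_subseq_finite[of ?I "\<lambda>k i. G (s k) (?\<tau> i)" C]) (use G_bd tau in auto)
    have sq: "strict_mono (\<lambda>k. s (q k))" using strict_mono_o[OF s q(1)] by (simp add: o_def)
    have lim: "(\<lambda>k. grid_hit (N (s (q k))) (F (s (q k))) x l (\<lambda>i. G (s (q k)) (?\<tau> i)) (b (s (q k))))
      \<longlonglongrightarrow> grid_prob x b0 l c'"
    proof (rule grid_hit_tendsto[OF _ N(2) F x])
      show "filterlim (\<lambda>k. N (s (q k))) at_top sequentially"
        by (rule filterlim_compose[OF N(1) filterlim_subseq[OF sq]])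
      show "(\<lambda>k. b (s (q k))) \<longlonglongrightarrow> b0"
        using LIMSEQ_subseq_LIMSEQ[OF b_lim q(1)] by (simp add: o_def)
      fix i :: nat assume i: "i < 2 ^ Suc l" "0 < i"
      then show "(\<lambda>k. G (s (q k)) (?\<tau> i)) \<longlonglongrightarrow> c' i" by (intro q) auto
      have "i \<in> ?I" using i by auto
      show "(\<lambda>k. F (s (q k)) (?\<tau> i)) \<longlonglongrightarrow> ?\<tau> i"
        using LIMSEQ_subseq_LIMSEQ[OF F_lim[OF tau[OF \<open>i \<in> ?I\<close>]] sq] by (simp add: o_def)
    qed
    have "1 - \<alpha> \<le> grid_prob x b0 l c'"
    proof (rule LIMSEQ_le[OF _ lim])
      have "(\<lambda>k. 1 - \<alpha> - 1 / real (Suc k)) \<longlonglongrightarrow> 1 - \<alpha> - 0" by (intro tendsto_intros inv_Suc)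
      from LIMSEQ_subseq_LIMSEQ[OF this sq] show "(\<lambda>k. 1 - \<alpha> - 1 / real (Suc (s (q k)))) \<longlonglongrightarrow> 1 - \<alpha>"
        by (simp add: o_def)
      have "1 - \<alpha> - 1 / real (Suc j) \<le> grid_hit (N j) (F j) x l (\<lambda>i. G j (?\<tau> i)) (b j)" for j
        using type2[of j] type2_error_le[OF F[of j] x N(2)[of j], of "c j" l] by (simp add: G_def b_def)
      then show "\<exists>n. \<forall>k\<ge>n. 1 - \<alpha> - 1 / real (Suc (s (q k))) \<le> grid_hit (N (s (q k))) (F (s (q k))) x l (\<lambda>i. G (s (q k)) (?\<tau> i)) (b (s (q k)))"
        by blast
    qed
    moreover have "a / 2 \<le> \<bar>c' (2 ^ l)\<bar>"
    proof (rule tendsto_lowerbound)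
      have "(\<lambda>k. G (s (q k)) (?\<tau> (2 ^ l))) \<longlonglongrightarrow> c' (2 ^ l)" by (intro q) auto
      then show "(\<lambda>k. \<bar>G (s (q k)) x\<bar>) \<longlonglongrightarrow> \<bar>c' (2 ^ l)\<bar>" by (intro tendsto_intros) simp
      show "\<forall>\<^sub>F k in sequentially. a / 2 \<le> \<bar>G (s (q k)) x\<bar>"
        using eventually_compose_filterlim[OF G_low filterlim_subseq[OF q(1)]] .
    qed simp
    ultimately show ?thesis by blast
  qed
  \<comment> \<open>The type II errors are asymptotically at least \<open>1 - \<alpha>\<close>, and a band of width zero has probability 0.\<close>
  have b0_pos: "0 < b0"
  proof (rule ccontr)
    assume "\<not> 0 < b0"
    then have "b0 = 0" using b0 by simp
    then show False using alternative_limits[of 0] grid_prob_zero_width[OF x] \<alpha> by auto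
  qed
  \<comment> \<open>Under the hypothesis, with the oscillation between the grid points accounted for.\<close>
  have null_limits: "\<alpha> \<le> 1 - grid_prob x (b0 - 14 * \<eta>) l (\<lambda>_. 0) + 2 * osc_const / (8 ^ l * \<eta> ^ 8)"
    if \<eta>: "0 < \<eta>" "14 * \<eta> < b0" for \<eta> l
  proof -
    let ?\<tau> = "split_grid x l"
    let ?B = "\<lambda>k. grid_hit (N (s k)) F0 x l (\<lambda>_. 0) (b (s k) - 14 * \<eta>)"
    have lim: "?B \<longlonglongrightarrow> grid_prob x (b0 - 14 * \<eta>) l (\<lambda>_. 0)"
    proof (rule grid_hit_tendsto[OF sN N(2) F0_in_cdfs01 x])
      fix i :: nat assume "i < 2 ^ Suc l" "0 < i"
      then show "(\<lambda>k. F0 (?\<tau> i)) \<longlonglongrightarrow> ?\<tau> i"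
        using split_grid_in_unit[OF x, of i l] by (simp add: F0_unit)
    qed (use b_lim in \<open>auto intro!: tendsto_intros\<close>)
    have ev: "\<forall>\<^sub>F k in sequentially. type1_error (N (s k)) (c (s k)) \<le> 1 - ?B k + 2 * osc_const / (8 ^ l * \<eta> ^ 8)"
    proof -
      have "\<forall>\<^sub>F k in sequentially. 2 ^ l / min x (1 - x) \<le> real (N (s k))"
        using filterlim_compose[OF filterlim_real_sequentially sN] by (simp add: filterlim_at_top)
      moreover have "\<forall>\<^sub>F k in sequentially. 1 / sqrt (real (N (s k))) < 7 * \<eta> / 2"
        using LIMSEQ_subseq_LIMSEQ[OF rN_inv s] \<eta> by (intro order_tendstoD(2)) (auto simp: o_def)
      moreover have "\<forall>\<^sub>F k in sequentially. 14 * \<eta> < b (s k)"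
        using order_tendstoD(1)[OF b_lim \<eta>(2)] .
      ultimately show ?thesis
      proof eventually_elim
        case (elim k)
        then show ?case
          using type1_error_le[OF x \<eta>(1) N(2)[of "s k"], of l "c (s k)"] by (simp add: b_def)
      qed
    qed
    have "(\<lambda>k. 1 - ?B k + 2 * osc_const / (8 ^ l * \<eta> ^ 8)) \<longlonglongrightarrow> 1 - grid_prob x (b0 - 14 * \<eta>) l (\<lambda>_. 0) + 2 * osc_const / (8 ^ l * \<eta> ^ 8)"
      by (intro tendsto_intros lim)
    moreover have "(\<lambda>k. type1_error (N (s k)) (c (s k))) \<longlonglongrightarrow> \<alpha>"
      using LIMSEQ_subseq_LIMSEQ[OF type1 s] by (simp add: o_def)
    ultimately show ?thesis
      using tendsto_le[OF sequentially_bot _ _ ev] by blast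
  qed
  define d where "d = min (a / 2) b0"
  have d: "0 < d" "d \<le> b0" using a b0_pos by (auto simp: d_def)
  obtain \<kappa> where \<kappa>: "0 < \<kappa>" "\<And>l c. d \<le> \<bar>c (2 ^ l)\<bar> \<Longrightarrow> grid_prob x b0 l c + \<kappa> \<le> grid_prob x b0 l (\<lambda>_. 0)"
    using grid_prob_gap[OF x d] by blast
  obtain \<epsilon> where \<epsilon>: "0 < \<epsilon>" "\<epsilon> < b0" "\<And>l. grid_prob x b0 l (\<lambda>_. 0) \<le> grid_prob x (b0 - \<epsilon>) l (\<lambda>_. 0) + \<kappa> / 2"
    using grid_prob_uniform_continuity[OF x b0_pos, of "\<kappa> / 2"] \<kappa>(1) by auto
  define \<eta> where "\<eta> = \<epsilon> / 14"
  have \<eta>: "0 < \<eta>" "14 * \<eta> = \<epsilon>" using \<epsilon> by (auto simp: \<eta>_def)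
  have "\<kappa> / 2 \<le> 2 * osc_const / \<eta> ^ 8 * (1 / 8) ^ l" for l
  proof -
    obtain c' where c': "a / 2 \<le> \<bar>c' (2 ^ l)\<bar>" "1 - \<alpha> \<le> grid_prob x b0 l c'" using alternative_limits by blast
    have "grid_prob x b0 l c' + \<kappa> \<le> grid_prob x b0 l (\<lambda>_. 0)" using c'(1) by (intro \<kappa>(2)) (simp add: d_def)
    moreover have "\<alpha> \<le> 1 - grid_prob x (b0 - \<epsilon>) l (\<lambda>_. 0) + 2 * osc_const / (8 ^ l * \<eta> ^ 8)"
      using null_limits[of \<eta> l] \<eta> \<epsilon> by simp
    moreover have "2 * osc_const / (8 ^ l * \<eta> ^ 8) = 2 * osc_const / \<eta> ^ 8 * (1 / 8) ^ l"
      by (simp add: power_divide)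
    ultimately show ?thesis using \<epsilon>(3)[of l] c'(2) by linarith
  qed
  moreover have "(\<lambda>l. 2 * osc_const / \<eta> ^ 8 * (1 / 8) ^ l) \<longlonglongrightarrow> 2 * osc_const / \<eta> ^ 8 * 0"
    by (intro tendsto_intros LIMSEQ_power_zero) auto
  ultimately have "\<kappa> / 2 \<le> 2 * osc_const / \<eta> ^ 8 * 0"
    by (intro LIMSEQ_le_const) auto
  then show False using \<kappa>(1) by simp
qed

theorem theorem3p3:
  fixes I1 :: "(real \<Rightarrow> real) set" and a e1 e2 :: real
  assumes "L2_compact_derivatives I1"
    and "a > 0"
    and "0 < e1" and "e1 < e2" and "e2 < 1"
  shows "uniformly_consistent (\<lambda>n. alternatives I1 e1 e2 a n)"
  unfolding uniformly_consistent_def alpha_uniformly_consistent_def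
proof (intro allI impI, elim conjE, rule ccontr)
  fix \<alpha> :: real and c :: "nat \<Rightarrow> real"
  assume \<alpha>: "0 < \<alpha>" "\<alpha> < 1" and type1: "(\<lambda>n. type1_error n (c n)) \<longlonglongrightarrow> \<alpha>"
    and contra: "\<not> limsup (\<lambda>n. sup_type2_error n (c n) (alternatives I1 e1 e2 a n)) < ereal (1 - \<alpha>)"
  let ?U = "alternatives I1 e1 e2 a"
  obtain C where C: "0 \<le> C" "\<And>G x y. G \<in> I1 \<Longrightarrow> 0 \<le> x \<Longrightarrow> x \<le> 1 \<Longrightarrow> 0 \<le> y \<Longrightarrow> y \<le> 1 \<Longrightarrow> \<bar>G x - G y\<bar> \<le> C * sqrt \<bar>x - y\<bar>"
    using L2_compact_derivatives_holder[OF assms(1)] by blast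
  have "\<exists>n F. Suc k \<le> n \<and> F \<in> ?U n \<and> 1 - \<alpha> - 1 / real (Suc k) < type2_error n (c n) F" for k
  proof (rule ccontr)
    assume no: "\<not> ?thesis"
    have "sup_type2_error n (c n) (?U n) \<le> ereal (1 - \<alpha> - 1 / real (Suc k))" if "Suc k \<le> n" for n
      unfolding sup_type2_error_def using no that by (intro SUP_least) (auto simp: not_less)
    then have "\<forall>\<^sub>F n in sequentially. sup_type2_error n (c n) (?U n) \<le> ereal (1 - \<alpha> - 1 / real (Suc k))"
      by (auto simp: eventually_sequentially)
    then have "limsup (\<lambda>n. sup_type2_error n (c n) (?U n)) \<le> ereal (1 - \<alpha> - 1 / real (Suc k))"
      by (rule Limsup_bounded)
    also have "\<dots> < ereal (1 - \<alpha>)" by simp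
    finally show False using contra by simp
  qed
  then obtain N F where NF: "\<And>k. Suc k \<le> N k" "\<And>k. F k \<in> ?U (N k)"
    "\<And>k. 1 - \<alpha> - 1 / real (Suc k) < type2_error (N k) (c (N k)) (F k)"
    by metis
  have Nlim: "filterlim N at_top sequentially"
    by (rule filterlim_at_top_mono[OF filterlim_ident]) (auto intro!: always_eventually Suc_leD[OF NF(1)])
  have N0: "0 < N k" for k using NF(1)[of k] by simp
  have F: "F k \<in> cdfs01" "a < sqrt (real (N k)) * max_dev {e1..e2} (F k)"
    "(\<lambda>x\<in>{0..1}. sqrt (real (N k)) * (F k x - F0 x)) \<in> I1" for k
    using NF(2)[of k] by (auto simp: alternatives_def)
  have "\<exists>x. e1 \<le> x \<and> x \<le> e2 \<and> a < \<bar>sqrt (real (N k)) * (F k x - F0 x)\<bar>" for k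
  proof -
    have pos: "0 < sqrt (real (N k))" using N0[of k] by simp
    have "a / sqrt (real (N k)) < (SUP x\<in>{e1..e2}. \<bar>F k x - F0 x\<bar>)"
      using F(2)[of k] pos by (simp add: max_dev_def pos_divide_less_eq mult.commute)
    moreover have "bdd_above ((\<lambda>x. \<bar>F k x - F0 x\<bar>) ` {e1..e2})"
    proof (rule bdd_aboveI2)
      fix x
      have "0 \<le> F k x" "F k x \<le> 1" "0 \<le> F0 x" "F0 x \<le> 1"
        using cdfs01_bounds(1,2)[OF F(1)] by (auto simp: F0_def)
      then show "\<bar>F k x - F0 x\<bar> \<le> 1" by linarith
    qed
    ultimately obtain x where x: "x \<in> {e1..e2}" "a / sqrt (real (N k)) < \<bar>F k x - F0 x\<bar>"
      using less_cSUP_iff[of "{e1..e2}" "\<lambda>x. \<bar>F k x - F0 x\<bar>"] assms(4) by auto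
    then show ?thesis using pos by (intro exI[of _ x]) (auto simp: abs_mult pos_divide_less_eq mult.commute)
  qed
  then obtain xs where xs: "\<And>k. e1 \<le> xs k \<and> xs k \<le> e2 \<and> a < \<bar>sqrt (real (N k)) * (F k (xs k) - F0 (xs k))\<bar>"
    by metis
  show False
  proof (rule trivial_power_impossible[OF \<alpha> Nlim N0 F(1) _ NF(3) _ C(1) assms(3) assms(5) assms(2) xs])
    show "(\<lambda>k. type1_error (N k) (c (N k))) \<longlonglongrightarrow> \<alpha>"
      by (rule filterlim_compose[OF type1 Nlim])
    fix k and x y :: real assume "0 \<le> x" "x \<le> 1" "0 \<le> y" "y \<le> 1"
    then show "\<bar>sqrt (real (N k)) * (F k x - F0 x) - sqrt (real (N k)) * (F k y - F0 y)\<bar> \<le> C * sqrt \<bar>x - y\<bar>"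
      using C(2)[OF F(3)[of k], of x y] by simp
  qed
qed

end
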